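(* Let $n\in\mathbb{N}$ and let $f$ be a non-constant meromorphic function on $\mathbb{C}$ with $\sigma_2^{\log}(f)<1$. Then, as $r\to\infty$ outside a set $F$ with $\int_F\frac{dt}{t\log t}<\infty$, $$T(r,\mathcal{D}_q^nf)\le(n+1)T(r,f)+S_{\log}(r,f),\quad T(r,\mathcal{A}_{q^n}f)\le 2T(r,f)+S_{\log}(r,f),$$ $$T\big(r,(\eta_{q^n}f)(\eta_{q^{-n}}f)\big)\le 2T(r,f)+S_{\log}(r,f).$$ Consequently $\sigma_2^{\log}(\mathcal{D}_q^nf)\le\sigma_2^{\log}(f)$, $\sigma_2^{\log}(\mathcal{A}_{q^n}f)\le\sigma_2^{\log}(f)$ and $\sigma_2^{\log}((\eta_{q^n}f)(\eta_{q^{-n}}f))\le\sigma_2^{\log}(f)$.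
   Context: Fix $q\in\mathbb{C}$ with $0<|q|<1$. Every $x\in\mathbb{C}$ is written uniquely as $x=\frac{z+z^{-1}}{2}$ with $|z|\ge 1$ (when $|z|=1$, $z=x+i\sqrt{1-x^2}$). $(\eta_q f)(x)=f\big(\tfrac{q^{1/2}z+q^{-1/2}z^{-1}}{2}\big)$, $(\eta_q^{-1}f)(x)=f\big(\tfrac{q^{-1/2}z+q^{1/2}z^{-1}}{2}\big)$, $(\eta_{q^{\pm n}}f)(x)=f\big(\tfrac{q^{\pm n/2}z+q^{\mp n/2}z^{-1}}{2}\big)$. Askey-Wilson operator $(\mathcal{D}_qf)(x)=\frac{(\eta_qf)(x)-(\eta_q^{-1}f)(x)}{\eta_qx-\eta_q^{-1}x}$ ($x\ne\pm1$; limit at $\pm1$), $\mathcal{D}_q^n=\mathcal{D}_q\circ\mathcal{D}_q^{n-1}$; $(\mathcal{A}_{q^n}f)(x)=\frac{(\eta_{q^n}f)(x)+(\eta_{q^{-n}}f)(x)}{2}$. $T(r,f)$ is the Nevanlinna characteristic, $\sigma_2^{\log}(f)=\limsup_{r\to\infty}\frac{\log^+\log^+T(r,f)}{\log\log r}$, and $S_{\log}(r,f)$ denotes any quantity of the form $O\big(\frac{T(r,f)}{\log\log r}\big)+O(\log r)$. *)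

theory Defs
  imports "HOL-Complex_Analysis.Complex_Analysis"
begin

text \<open>Joukowski parametrisation: x = (z + 1/z)/2 with |z| > 1, or |z| = 1 and Im z \<ge> 0
  (the latter is z = x + i sqrt(1-x^2) for x in [-1,1]).\<close>
definition aw_z :: "complex \<Rightarrow> complex" where
  "aw_z x = (THE z. (z + inverse z) / 2 = x \<and> (cmod z > 1 \<or> (cmod z = 1 \<and> Im z \<ge> 0)))"

text \<open>Shift operator eta_{q^{k}} with k an integer, where p is the fixed square root q^{1/2},
  so q^{k/2} = p powi k.\<close>
definition aw_eta :: "complex \<Rightarrow> int \<Rightarrow> (complex \<Rightarrow> complex) \<Rightarrow> complex \<Rightarrow> complex" where
  "aw_eta p k f x = f ((p powi k * aw_z x + inverse (p powi k) * inverse (aw_z x)) / 2)"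

definition aw_quot :: "complex \<Rightarrow> (complex \<Rightarrow> complex) \<Rightarrow> complex \<Rightarrow> complex" where
  "aw_quot p f x = (aw_eta p 1 f x - aw_eta p (-1) f x) / (aw_eta p 1 id x - aw_eta p (-1) id x)"

definition aw_D :: "complex \<Rightarrow> (complex \<Rightarrow> complex) \<Rightarrow> complex \<Rightarrow> complex" where
  "aw_D p f x = (if x = 1 \<or> x = -1 then Lim (at x) (aw_quot p f) else aw_quot p f x)"

definition aw_A :: "complex \<Rightarrow> nat \<Rightarrow> (complex \<Rightarrow> complex) \<Rightarrow> complex \<Rightarrow> complex" where
  "aw_A p n f x = (aw_eta p (int n) f x + aw_eta p (- int n) f x) / 2"

definition log_plus :: "real \<Rightarrow> real" where
  "log_plus x = max 0 (ln x)"

definition nev_m :: "(complex \<Rightarrow> complex) \<Rightarrow> real \<Rightarrow> real" where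
  "nev_m f r = integral {0..2*pi} (\<lambda>\<theta>. log_plus (cmod (f (of_real r * cis \<theta>)))) / (2*pi)"

definition nev_n :: "(complex \<Rightarrow> complex) \<Rightarrow> real \<Rightarrow> real" where
  "nev_n f t = real (\<Sum>z\<in>{z. cmod z \<le> t \<and> is_pole f z}. nat (- zorder f z))"

definition nev_N :: "(complex \<Rightarrow> complex) \<Rightarrow> real \<Rightarrow> real" where
  "nev_N f r = integral {0..r} (\<lambda>t. (nev_n f t - nev_n f 0) / t) + nev_n f 0 * ln r"

definition nev_T :: "(complex \<Rightarrow> complex) \<Rightarrow> real \<Rightarrow> real" where
  "nev_T f r = nev_m f r + nev_N f r"

definition sigma2_log :: "(complex \<Rightarrow> complex) \<Rightarrow> ereal" where
  "sigma2_log f = Limsup at_top (\<lambda>r::real. ereal (log_plus (log_plus (nev_T f r)) / ln (ln r)))"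

end

theory Submission
  imports Defs "HOL-Real_Asymp.Real_Asymp"
begin

text \<open>
  Let x = (z + 1/z)/2. In the coordinate z the shifts are dilations, so each of the three functions F
  in question satisfies D(x) F(x) = sum of C_j(z) times products of values f(x(p^m z)), where D is a fixed
  polynomial and the exponents m run through a set symmetric under negation. On the disc of radius R write
  f = g/h with h the monic polynomial of the poles of f. By the symmetry of the exponents the product of
  the h(x(p^m z)) is a polynomial in x, so F = G/H with G holomorphic and H a product of linear factors.
  Jensen's formula for H then bounds T(r, F) by the maximum of log |g| and log |h| on circles of
  radius O(r).
  For R of size r log r the Harnack inequality bounds log |g| by (1 + O(1/log r)) m(R, f) plus
  a counting term, and altogether, with A = r (log r)^3,
  T(r, F) \<le> (N + 1) T(A, f) + O(T(A, f) / log log r) + O(log r), where N + 1 is the number of exponents.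
  This holds for all large r and yields the inequalities between the orders. Since log T(e^s) = O(s^a)
  with a < 1, T(A, f) \<le> (1 + O(1/log log r)) T(r, f) + O(1) outside an exceptional set of finite
  logarithmic measure in log r.
\<close>

section \<open>Mean values over circles\<close>

text \<open>The factor \<open>N + 1\<close> must come out sharp, so no step may lose a multiple of
  the characteristic. On |x| = r each of the N + 1 shifted factors, whether a value of g or of h, is
  bounded by one quantity exp Y; up to its coefficients a sum then costs no more than one product.
  Bounding h by (2R)^n, where n counts the poles in the disc, costs n ln (2R), which is no error
  term. But Jensen's formula gives back about the sum of ln |b| over the poles b, and n ln R minus
  that sum is exactly N(R, f). What remains is O(n). Hence two radii. The gap from r to R brings the
  Harnack factor down to 1 + O(1/log r); the gap from R to A, of logarithmic length at least log log
  r, gives n \<le> T(A, f) / log log r. A second obstacle is that F is controlled only off finite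
  sets and that \<open>aw_z\<close> jumps across (-1, 1). The upper bound for T(r, F) is therefore
  proved for any function that agrees with G / H off a finite set, without assuming that it is
  meromorphic or that the integrals in its characteristic exist.\<close>

lemma mean_value_circle:
  fixes f :: "complex \<Rightarrow> complex"
  assumes f: "f holomorphic_on ball 0 \<rho>" and r: "0 < r" "r < \<rho>"
  shows "((\<lambda>\<theta>. f (of_real r * cis \<theta>)) has_integral (2 * pi * f 0)) {0..2*pi}"
proof -
  have "((\<lambda>u. f u / (u - 0)) has_contour_integral (2 * of_real pi * \<i> * f 0)) (circlepath 0 r)"
  proof (rule Cauchy_integral_circlepath)
    show "continuous_on (cball 0 r) f"
      using r by (intro holomorphic_on_imp_continuous_on holomorphic_on_subset[OF f]) auto
    show "f holomorphic_on ball 0 r"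
      using r by (intro holomorphic_on_subset[OF f]) auto
  qed (use r in auto)
  hence "((\<lambda>t. f (of_real r * cis t) / (of_real r * cis t) * r * \<i> * cis t) has_integral
      (2 * of_real pi * \<i> * f 0)) {0..2*pi}"
    unfolding circlepath_def by (subst (asm) has_contour_integral_part_circlepath_iff) auto
  hence "((\<lambda>t. f (of_real r * cis t) * \<i>) has_integral (2 * of_real pi * \<i> * f 0)) {0..2*pi}"
    by (rule has_integral_eq[rotated]) (use r in auto)
  hence "((\<lambda>t. f (of_real r * cis t) * \<i> * (-\<i>)) has_integral (2 * of_real pi * \<i> * f 0) * (-\<i>)) {0..2*pi}"
    by (rule has_integral_mult_left)
  moreover have "f (of_real r * cis t) * \<i> * (-\<i>) = f (of_real r * cis t)" for t
    by (simp add: algebra_simps)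
  moreover have "(2 * of_real pi * \<i> * f 0) * (-\<i>) = 2 * pi * f 0"
    by (simp add: algebra_simps)
  ultimately show ?thesis by (simp only:)
qed

lemma mean_value_circle_Re:
  fixes f :: "complex \<Rightarrow> complex"
  assumes "f holomorphic_on ball 0 \<rho>" "0 < r" "r < \<rho>"
  shows "((\<lambda>\<theta>. Re (f (of_real r * cis \<theta>))) has_integral (2 * pi * Re (f 0))) {0..2*pi}"
  using has_integral_Re[OF mean_value_circle[OF assms]] by simp

text \<open>For |w| < 1/|c| the number 1 - c w has positive real part, so its principal logarithm is
  holomorphic on a disc larger than the unit disc, with value 0 at the centre.\<close>

lemma integral_ln_norm_one_minus:
  fixes c :: complex
  assumes "cmod c < 1"
  shows "((\<lambda>\<theta>. ln (cmod (1 - c * cis \<theta>))) has_integral 0) {0..2*pi}"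
proof -
  define \<rho> where "\<rho> = (if c = 0 then 2 else 1 / cmod c)"
  have \<rho>: "1 < \<rho>" using assms by (auto simp: \<rho>_def field_simps)
  have c: "cmod (c * w) < 1" if "w \<in> ball 0 \<rho>" for w :: complex
    using that by (auto simp: \<rho>_def norm_mult field_simps split: if_splits)
  have "(\<lambda>w. Ln (1 - c * w)) holomorphic_on ball 0 \<rho>"
  proof (intro holomorphic_intros)
    fix w :: complex assume "w \<in> ball 0 \<rho>"
    hence "Re (c * w) < 1" using c[of w] complex_Re_le_cmod[of "c * w"] by linarith
    thus "1 - c * w \<notin> \<real>\<^sub>\<le>\<^sub>0" by (auto simp: complex_nonpos_Reals_iff)
  qed
  from mean_value_circle_Re[OF this _ \<rho>]
  have "((\<lambda>\<theta>. Re (Ln (1 - c * cis \<theta>))) has_integral 0) {0..2*pi}" by simp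
  thus ?thesis
  proof (rule has_integral_eq[rotated])
    fix \<theta> :: real
    have "cmod (c * cis \<theta>) < 1" using assms by (simp add: norm_mult)
    hence "1 - c * cis \<theta> \<noteq> 0" by auto
    thus "Re (Ln (1 - c * cis \<theta>)) = ln (cmod (1 - c * cis \<theta>))" by simp
  qed
qed

text \<open>Identities between the functions hold only off finite sets of points; this lets circle
  integrals ignore the corresponding angles.\<close>

lemma finite_cis_vimage:
  assumes "r \<noteq> 0" "finite E"
  shows "finite {\<theta>\<in>{0..2*pi}. of_real r * cis \<theta> \<in> E}"
proof -
  \<comment> \<open>\<open>Arg2pi\<close> takes values below 2 pi, so the right endpoint is added by
    hand.\<close>
  have "{\<theta>\<in>{0..2*pi}. of_real r * cis \<theta> \<in> E} \<subseteq> insert (2 * pi) ((\<lambda>a. Arg2pi (a / of_real r)) ` E)"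
  proof safe
    fix \<theta> assume \<theta>: "\<theta> \<in> {0..2*pi}" "\<theta> \<notin> (\<lambda>a. Arg2pi (a / of_real r)) ` E"
      and E: "of_real r * cis \<theta> \<in> E"
    have "\<not> \<theta> < 2 * pi"
    proof
      assume "\<theta> < 2 * pi"
      hence "Arg2pi (cis \<theta>) = \<theta>"
        using \<theta> by (intro Arg2pi_unique[of 1]) (auto simp: cis_conv_exp)
      moreover have "cis \<theta> = (of_real r * cis \<theta>) / of_real r" using assms by simp
      ultimately show False using \<theta>(2) E by (metis imageI)
    qed
    thus "\<theta> = 2 * pi" using \<theta> by simp
  qed
  thus ?thesis by (rule finite_subset) (use assms in auto)
qed

text \<open>Jensen's formula for one linear factor. If a is off the circle, pulling out the larger
  of r and |a| leaves a factor of the form |1 - c w| with |c| < 1. If a is on the circle, the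
  integrand has a logarithmic singularity, and its integrability is part of the claim.\<close>

lemma jensen_linear:
  assumes r: "0 < r"
  shows "((\<lambda>\<theta>. ln (cmod (of_real r * cis \<theta> - a))) has_integral (2 * pi * ln (max r (cmod a)))) {0..2*pi}"
proof -
  have const: "((\<lambda>\<theta>. c) has_integral (2 * pi * c)) {0..2*pi}" for c :: real
    using has_integral_const_real[of c 0 "2*pi"] by (simp add: mult.commute)
  have inside: "((\<lambda>\<theta>. ln (cmod (of_real r * cis \<theta> - a))) has_integral (2 * pi * ln r)) {0..2*pi}"
    if a: "cmod a < r" for a
  proof -
    define c where "c = cnj a / of_real r"
    have c: "cmod c < 1" using a r by (simp add: c_def norm_divide)
    have "((\<lambda>\<theta>. ln r + ln (cmod (1 - c * cis \<theta>))) has_integral (2 * pi * ln r + 0)) {0..2*pi}"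
      by (intro has_integral_add const integral_ln_norm_one_minus c)
    thus ?thesis
    proof (rule has_integral_eq_rhs[OF has_integral_eq[rotated]])
      fix \<theta> :: real
      have "of_real r * cis \<theta> - a = cis \<theta> * (of_real r * cnj (1 - c * cis \<theta>))"
        using r by (simp add: c_def algebra_simps cis_cnj cis_mult)
      hence "cmod (of_real r * cis \<theta> - a) = r * cmod (1 - c * cis \<theta>)"
        using r by (simp only: norm_mult complex_mod_cnj norm_cis) simp
      moreover have "1 - c * cis \<theta> \<noteq> 0" using c 
        by (metis eq_iff_diff_eq_0 mult.right_neutral norm_cis norm_mult norm_one order_less_irrefl)
      ultimately show "ln r + ln (cmod (1 - c * cis \<theta>)) = ln (cmod (of_real r * cis \<theta> - a))"
        using r by (simp add: ln_mult)
    qed simp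
  qed
  consider "cmod a < r" | "r < cmod a" | "cmod a = r" by linarith
  thus ?thesis
  proof cases
    case 1
    thus ?thesis using inside[OF 1] by (simp add: max_def)
  next
    case 2
    define c where "c = of_real r / a"
    have [simp]: "a \<noteq> 0" using 2 r by auto
    have c: "cmod c < 1" using 2 r by (simp add: c_def norm_divide)
    have "((\<lambda>\<theta>. ln (cmod a) + ln (cmod (1 - c * cis \<theta>))) has_integral (2 * pi * ln (cmod a) + 0)) {0..2*pi}"
      by (intro has_integral_add const integral_ln_norm_one_minus c)
    thus ?thesis
    proof (rule has_integral_eq_rhs[OF has_integral_eq[rotated]])
      fix \<theta> :: real
      have "of_real r * cis \<theta> - a = - a * (1 - c * cis \<theta>)" by (simp add: c_def algebra_simps)
      hence "cmod (of_real r * cis \<theta> - a) = cmod a * cmod (1 - c * cis \<theta>)"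
        by (simp only: norm_mult norm_minus_cancel)
      moreover have "1 - c * cis \<theta> \<noteq> 0" using c 
        by (metis eq_iff_diff_eq_0 mult.right_neutral norm_cis norm_mult norm_one order_less_irrefl)
      ultimately show "ln (cmod a) + ln (cmod (1 - c * cis \<theta>)) = ln (cmod (of_real r * cis \<theta> - a))"
        by (simp add: ln_mult)
    qed (use 2 in simp)
  next
    case 3
    \<comment> \<open>As \<rho> increases to 1, the functions 2 ln |w - \<rho> a| - ln \<rho> decrease to 2 ln |w - a| on |w| = r.\<close>
    define E where "E = {\<theta>\<in>{0..2*pi}. of_real r * cis \<theta> \<in> {a}}"
    have finE: "finite E" unfolding E_def using r by (intro finite_cis_vimage) auto
    define S where "S = {0..2*pi} - E"
    define \<rho> where "\<rho> k = 1 - 1 / (real k + 2)" for k :: nat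
    have \<rho>: "0 < \<rho> k" "\<rho> k < 1" "\<rho> k \<le> \<rho> (Suc k)" for k
      by (auto simp: \<rho>_def field_simps)
    define g where "g k \<theta> = 2 * ln (cmod (of_real r * cis \<theta> - of_real (\<rho> k) * a)) - ln (\<rho> k)" for k \<theta>
    have spike: "(h has_integral I) S \<longleftrightarrow> (h has_integral I) {0..2*pi}" for h :: "real \<Rightarrow> real" and I
      by (rule has_integral_spike_set_eq) (auto simp: S_def intro!: negligible_subset[OF negligible_finite[OF finE]])
    have g_int: "(g k has_integral (4 * pi * ln r - 2 * pi * ln (\<rho> k))) S" for k
    proof -
      have "cmod (of_real (\<rho> k) * a) < r" using \<rho>[of k] r 3 by (simp add: norm_mult)
      from has_integral_diff[OF has_integral_mult_right[OF inside[OF this], of 2] const[of "ln (\<rho> k)"]]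
      show ?thesis unfolding spike g_def by (simp add: algebra_simps)
    qed
    have sq: "(cmod (of_real r * cis \<theta> - of_real t * a))\<^sup>2 = r\<^sup>2 + t\<^sup>2 * r\<^sup>2 - 2 * t * Re (of_real r * cis \<theta> * cnj a)" for t \<theta>
    proof -
      have id: "(r * c - t * x)\<^sup>2 + (r * s - t * y)\<^sup>2 =
          r\<^sup>2 * (c\<^sup>2 + s\<^sup>2) + t\<^sup>2 * (x\<^sup>2 + y\<^sup>2) - 2 * t * (r * c * x + r * s * y)" for c s x y
        by (simp add: power2_eq_square algebra_simps)
      have "(Re a)\<^sup>2 + (Im a)\<^sup>2 = r\<^sup>2" using 3 by (metis cmod_power2)
      moreover have "(cos \<theta>)\<^sup>2 + (sin \<theta>)\<^sup>2 = 1" by simp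
      moreover have "(cmod (of_real r * cis \<theta> - of_real t * a))\<^sup>2 =
         r\<^sup>2 * ((cos \<theta>)\<^sup>2 + (sin \<theta>)\<^sup>2) + t\<^sup>2 * ((Re a)\<^sup>2 + (Im a)\<^sup>2) - 2 * t * Re (of_real r * cis \<theta> * cnj a)"
        using id[of "cos \<theta>" "Re a" "sin \<theta>" "Im a"] unfolding cmod_power2 by simp
      ultimately show ?thesis by simp
    qed
    have nz: "of_real r * cis \<theta> - of_real (\<rho> k) * a \<noteq> 0" for k \<theta>
    proof
      assume "of_real r * cis \<theta> - of_real (\<rho> k) * a = 0"
      hence "cmod (of_real r * cis \<theta>) = cmod (of_real (\<rho> k) * a)" by simp
      thus False using \<rho>[of k] r 3 by (simp add: norm_mult)
    qed
    \<comment> \<open>In this form g depends on \<rho> only through \<rho> + 1/\<rho>, which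
      decreases on (0, 1]. This is the purpose of subtracting ln \<rho>.\<close>
    have g_eq: "g k \<theta> = ln (r\<^sup>2 * (\<rho> k + 1 / \<rho> k) - 2 * Re (of_real r * cis \<theta> * cnj a))" for k \<theta>
    proof -
      have "g k \<theta> = ln ((cmod (of_real r * cis \<theta> - of_real (\<rho> k) * a))\<^sup>2 / \<rho> k)"
        using nz[of \<theta> k] \<rho>[of k] by (simp add: g_def ln_div ln_realpow)
      also have "(cmod (of_real r * cis \<theta> - of_real (\<rho> k) * a))\<^sup>2 / \<rho> k =
          r\<^sup>2 * (\<rho> k + 1 / \<rho> k) - 2 * Re (of_real r * cis \<theta> * cnj a)"
        unfolding sq using \<rho>(1)[of k] by (simp add: field_simps power2_eq_square)
      finally show ?thesis .
    qed
    have g_pos: "r\<^sup>2 * (\<rho> k + 1 / \<rho> k) - 2 * Re (of_real r * cis \<theta> * cnj a) > 0" for k \<theta>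
    proof -
      have "(cmod (of_real r * cis \<theta> - of_real (\<rho> k) * a))\<^sup>2 / \<rho> k > 0"
        using nz[of \<theta> k] \<rho>(1)[of k] by simp
      thus ?thesis unfolding sq using \<rho>(1)[of k] by (simp add: field_simps power2_eq_square)
    qed
    have \<rho>_lim: "\<rho> \<longlonglongrightarrow> 1" unfolding \<rho>_def by real_asymp
    define G where "G \<theta> = 2 * ln (cmod (of_real r * cis \<theta> - a))" for \<theta>
    have dec: "g (Suc k) \<theta> \<le> g k \<theta>" for k \<theta>
    proof -
      have "\<rho> (Suc k) + 1 / \<rho> (Suc k) \<le> \<rho> k + 1 / \<rho> k"
      proof -
        have "0 \<le> (\<rho> (Suc k) - \<rho> k) * (1 - \<rho> k * \<rho> (Suc k))"
          using \<rho>[of k] \<rho>[of "Suc k"] by (intro mult_nonneg_nonneg) (auto intro: mult_le_one less_imp_le)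
        thus ?thesis using \<rho>(1)[of k] \<rho>(1)[of "Suc k"] by (simp add: field_simps)
      qed
      hence "r\<^sup>2 * (\<rho> (Suc k) + 1 / \<rho> (Suc k)) \<le> r\<^sup>2 * (\<rho> k + 1 / \<rho> k)"
        by (intro mult_left_mono) auto
      thus ?thesis unfolding g_eq using g_pos[of "Suc k" \<theta>] by (subst ln_le_cancel_iff) (use g_pos[of k \<theta>] in auto)
    qed
    have "G integrable_on S \<and> (\<lambda>k. integral S (g k)) \<longlonglongrightarrow> integral S G"
    proof (rule monotone_convergence_decreasing)
      show "g k integrable_on S" for k using g_int by blast
      show "g (Suc k) \<theta> \<le> g k \<theta>" for k \<theta> by (rule dec)
      show "(\<lambda>k. g k \<theta>) \<longlonglongrightarrow> G \<theta>" if "\<theta> \<in> S" for \<theta>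
      proof -
        have "of_real r * cis \<theta> - of_real 1 * a \<noteq> 0" using that by (auto simp: S_def E_def)
        hence "(\<lambda>k. g k \<theta>) \<longlonglongrightarrow> 2 * ln (cmod (of_real r * cis \<theta> - of_real 1 * a)) - ln 1"
          unfolding g_def by (intro tendsto_intros \<rho>_lim) auto
        thus ?thesis by (simp add: G_def)
      qed
      have "(\<lambda>k. 4 * pi * ln r - 2 * pi * ln (\<rho> k)) \<longlonglongrightarrow> 4 * pi * ln r - 2 * pi * ln 1"
        by (intro tendsto_intros \<rho>_lim) auto
      moreover have "integral S (g k) = 4 * pi * ln r - 2 * pi * ln (\<rho> k)" for k
        using g_int by (rule integral_unique)
      ultimately show "bounded (range (\<lambda>k. integral S (g k)))"
        by (simp add: convergent_imp_bounded)
    qed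
    moreover have "(\<lambda>k. integral S (g k)) \<longlonglongrightarrow> 4 * pi * ln r"
    proof -
      have "(\<lambda>k. 4 * pi * ln r - 2 * pi * ln (\<rho> k)) \<longlonglongrightarrow> 4 * pi * ln r - 2 * pi * ln 1"
        by (intro tendsto_intros \<rho>_lim) auto
      moreover have "integral S (g k) = 4 * pi * ln r - 2 * pi * ln (\<rho> k)" for k
        using g_int by (rule integral_unique)
      ultimately show ?thesis by simp
    qed
    ultimately have "(G has_integral (4 * pi * ln r)) S"
      by (metis LIMSEQ_unique integrable_integral)
    hence "((\<lambda>\<theta>. G \<theta> / 2) has_integral (4 * pi * ln r) / 2) {0..2*pi}"
      unfolding spike by (rule has_integral_divide)
    thus ?thesis using 3 by (simp add: G_def mult.assoc)
  qed
qed

text \<open>On |w| = R the conjugate of w is R^2/w, so Re and Im, and hence all polynomials in them, are Laurent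
  polynomials in w there; replacing c/w^k by the conjugate term makes the result the real part of a polynomial.\<close>

lemma circle_trig_approx:
  fixes V :: "complex \<Rightarrow> real"
  assumes V: "continuous_on (sphere 0 R) V" and R: "R > 0" and e: "e > 0"
  obtains Q where "Q holomorphic_on UNIV" "\<And>w. w \<in> sphere 0 R \<Longrightarrow> \<bar>V w - Re (Q w)\<bar> < e"
proof -
  define P where "P f \<longleftrightarrow> continuous_on (sphere 0 R) f \<and>
     (\<exists>N q. \<forall>w\<in>sphere 0 R. complex_of_real (f w) * w ^ N = poly q w)" for f :: "complex \<Rightarrow> real"
  have cnj: "cnj w = of_real (R\<^sup>2) / w" "w \<noteq> 0" if "w \<in> sphere 0 R" for w
  proof -
    show "w \<noteq> 0" using that R by auto
    have "w * cnj w = of_real (R\<^sup>2)" using that by (simp flip: complex_norm_square)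
    thus "cnj w = of_real (R\<^sup>2) / w" using \<open>w \<noteq> 0\<close> by (simp add: field_simps)
  qed
  have "\<exists>g. P g \<and> (\<forall>w\<in>sphere 0 R. \<bar>V w - g w\<bar> < e)"
  proof (rule Stone_Weierstrass_HOL[of "sphere 0 R" P])
    show "P (\<lambda>x. c)" for c
      unfolding P_def by (auto intro!: exI[of _ 0] exI[of _ "[:of_real c:]"])
    show "P (\<lambda>x. f x + g x)" if "P f \<and> P g" for f g
    proof -
      from that obtain N q M s where *: "\<forall>w\<in>sphere 0 R. complex_of_real (f w) * w ^ N = poly q w"
          "\<forall>w\<in>sphere 0 R. complex_of_real (g w) * w ^ M = poly s w"
          and c: "continuous_on (sphere 0 R) f" "continuous_on (sphere 0 R) g" unfolding P_def by blast
      have "\<forall>w\<in>sphere 0 R. complex_of_real (f w + g w) * w ^ (N + M) = poly (q * monom 1 M + s * monom 1 N) w"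
      proof
        fix w :: complex assume w: "w \<in> sphere 0 R"
        have "complex_of_real (f w + g w) * w ^ (N + M) =
            (complex_of_real (f w) * w ^ N) * w ^ M + (complex_of_real (g w) * w ^ M) * w ^ N"
          by (simp add: power_add algebra_simps)
        also have "\<dots> = poly q w * w ^ M + poly s w * w ^ N"
          using *(1)[rule_format, OF w] *(2)[rule_format, OF w] by (simp only:)
        finally show "complex_of_real (f w + g w) * w ^ (N + M) = poly (q * monom 1 M + s * monom 1 N) w"
          by (simp add: poly_monom)
      qed
      moreover have "continuous_on (sphere 0 R) (\<lambda>x. f x + g x)"
        by (rule continuous_on_add[OF c])
      ultimately show ?thesis unfolding P_def by - (rule conjI, assumption, rule exI, rule exI, assumption)
    qed
    show "P (\<lambda>x. f x * g x)" if "P f \<and> P g" for f g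
    proof -
      from that obtain N q M s where *: "\<forall>w\<in>sphere 0 R. complex_of_real (f w) * w ^ N = poly q w"
          "\<forall>w\<in>sphere 0 R. complex_of_real (g w) * w ^ M = poly s w"
          and c: "continuous_on (sphere 0 R) f" "continuous_on (sphere 0 R) g" unfolding P_def by blast
      have "\<forall>w\<in>sphere 0 R. complex_of_real (f w * g w) * w ^ (N + M) = poly (q * s) w"
      proof
        fix w :: complex assume w: "w \<in> sphere 0 R"
        have "complex_of_real (f w * g w) * w ^ (N + M) =
            (complex_of_real (f w) * w ^ N) * (complex_of_real (g w) * w ^ M)"
          by (simp add: power_add algebra_simps)
        also have "\<dots> = poly q w * poly s w"
          using *(1)[rule_format, OF w] *(2)[rule_format, OF w] by (simp only:)
        finally show "complex_of_real (f w * g w) * w ^ (N + M) = poly (q * s) w" by simp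
      qed
      moreover have "continuous_on (sphere 0 R) (\<lambda>x. f x * g x)"
        by (rule continuous_on_mult[OF c])
      ultimately show ?thesis unfolding P_def by - (rule conjI, assumption, rule exI, rule exI, assumption)
    qed
    have "P Re"
    proof -
      have "complex_of_real (Re w) * w ^ 1 = poly [:of_real (R\<^sup>2) / 2, 0, 1/2:] w" if "w \<in> sphere 0 R" for w
      proof -
        have "complex_of_real (Re w) = (w + cnj w) / 2" by (simp add: complex_add_cnj)
        thus ?thesis using cnj[OF that] by (simp add: field_simps)
      qed
      thus ?thesis unfolding P_def by (intro conjI exI ballI) (intro continuous_intros)
    qed
    moreover have "P Im"
    proof -
      have "complex_of_real (Im w) * w ^ 1 = poly [:- of_real (R\<^sup>2) / (2 * \<i>), 0, 1/(2 * \<i>):] w" if "w \<in> sphere 0 R" for w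
      proof -
        have "complex_of_real (Im w) = (w - cnj w) / (2 * \<i>)" by (simp add: complex_eq_iff)
        thus ?thesis using cnj[OF that] by (simp add: field_simps)
      qed
      thus ?thesis unfolding P_def by (intro conjI exI ballI) (intro continuous_intros)
    qed
    ultimately show "\<exists>f. P f \<and> f x \<noteq> f y" if "x \<in> sphere 0 R \<and> y \<in> sphere 0 R \<and> x \<noteq> y" for x y
      using that complex_eq_iff by blast
  qed (use V e in \<open>auto simp: P_def\<close>)
  then obtain g N q where g: "\<forall>w\<in>sphere 0 R. complex_of_real (g w) * w ^ N = poly q w"
      "\<forall>w\<in>sphere 0 R. \<bar>V w - g w\<bar> < e"
    unfolding P_def by blast
  define t where "t k w = (if k \<ge> N then coeff q k * w ^ (k - N)
     else cnj (coeff q k) * (w / of_real (R\<^sup>2)) ^ (N - k))" for k w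
  define Q where "Q w = (\<Sum>k\<le>degree q. t k w)" for w
  have "Q holomorphic_on UNIV"
  proof -
    have "t k holomorphic_on UNIV" for k
      using R unfolding t_def by (cases "k \<ge> N") (auto intro!: holomorphic_intros)
    thus ?thesis unfolding Q_def by (auto intro!: holomorphic_intros)
  qed
  moreover have "Re (Q w) = g w" if w: "w \<in> sphere 0 R" for w
  proof -
    note [simp] = cnj(2)[OF w]
    have Rt: "Re (t k w) = Re (coeff q k * w ^ k / w ^ N)" for k
    proof (cases "k \<ge> N")
      case True
      thus ?thesis by (simp add: t_def power_diff)
    next
      case False
      have "cnj (1 / w) = 1 / (of_real (R\<^sup>2) / w)" by (simp only: complex_cnj_divide complex_cnj_one cnj(1)[OF w])
      hence "w / of_real (R\<^sup>2) = cnj (1 / w)" by simp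
      hence "t k w = cnj (coeff q k * (1 / w) ^ (N - k))" using False by (simp add: t_def)
      also have "coeff q k * (1 / w) ^ (N - k) = coeff q k * w ^ k / w ^ N"
        using False by (simp add: power_diff power_one_over field_simps)
      finally show ?thesis by (simp only: cnj.simps)
    qed
    have "complex_of_real (g w) = poly q w / w ^ N" using g(1) w by (simp add: field_simps)
    also have "\<dots> = (\<Sum>k\<le>degree q. coeff q k * w ^ k / w ^ N)"
      by (simp add: poly_altdef sum_divide_distrib)
    finally have "g w = Re (\<Sum>k\<le>degree q. coeff q k * w ^ k / w ^ N)" by (metis Re_complex_of_real)
    also have "\<dots> = Re (Q w)" by (simp add: Q_def Rt)
    finally show ?thesis by simp
  qed
  ultimately show ?thesis using that g(2) by simp
qed

section \<open>Harmonic majorants\<close>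

text \<open>A Cayley transform maps the right half-plane to the unit disc and takes Q 0 to 0; the
  Schwarz lemma for the composition is Harnack's inequality.\<close>

lemma Harnack_holomorphic:
  fixes Q :: "complex \<Rightarrow> complex"
  assumes Q: "Q holomorphic_on UNIV" and pos: "\<And>w. w \<in> sphere 0 R \<Longrightarrow> Re (Q w) \<ge> 0"
    and z: "cmod z < R"
  shows "Re (Q z) \<le> (R + cmod z) / (R - cmod z) * Re (Q 0)"
proof -
  have R: "R > 0" using z norm_ge_zero[of z] by linarith
  have pos': "Re (Q w) \<ge> 0" if "w \<in> cball 0 R" for w
  proof -
    \<comment> \<open>Nonnegativity of Re Q passes from the circle to the disc by the maximum
      principle for exp (-Q).\<close>
    have "cmod (exp (- Q w)) \<le> 1"
    proof (rule maximum_modulus_frontier[of "\<lambda>w. exp (- Q w)" "cball 0 R"])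
      show "(\<lambda>w. exp (- Q w)) holomorphic_on interior (cball 0 R)"
        by (intro holomorphic_intros holomorphic_on_subset[OF Q]) auto
      show "continuous_on (closure (cball 0 R)) (\<lambda>w. exp (- Q w))"
        by (intro continuous_intros continuous_on_subset[OF holomorphic_on_imp_continuous_on[OF Q]]) auto
    qed (use pos that R in auto)
    thus ?thesis by simp
  qed
  \<comment> \<open>Adding e makes the real part strictly positive, as the Cayley transform
    requires; e tends to 0 at the end.\<close>
  have main: "Re (Q z) \<le> (R + cmod z) / (R - cmod z) * (Re (Q 0) + e) + ((R + cmod z) / (R - cmod z)) * 0" if e: "e > 0" for e
  proof -
    define P where "P w = Q w + of_real e" for w
    have P: "P holomorphic_on UNIV" unfolding P_def by (intro holomorphic_intros Q)
    have Ppos: "Re (P w) > 0" if "w \<in> cball 0 R" for w using pos'[OF that] e by (simp add: P_def)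
    define c where "c = P 0"
    have c: "Re c > 0" unfolding c_def by (rule Ppos) (use R in auto)
    define F where "F u = (P (of_real R * u) - c) / (P (of_real R * u) + cnj c)" for u
    have inb: "of_real R * u \<in> cball 0 R" if "cmod u < 1" for u :: complex
      using that R by (simp add: norm_mult mult_le_cancel_left1 less_imp_le)
    have nz: "P (of_real R * u) + cnj c \<noteq> 0" if "cmod u < 1" for u
    proof
      assume "P (of_real R * u) + cnj c = 0"
      hence "Re (P (of_real R * u)) + Re c = 0" by (metis complex_cnj(1) cnj.simps(1) plus_complex.simps(1) zero_complex.simps(1))
      thus False using Ppos[OF inb[OF that]] c by simp
    qed
    have holF: "F holomorphic_on ball 0 1" unfolding F_def
      by (intro holomorphic_intros holomorphic_on_compose_gen[OF _ P, unfolded o_def] nz) auto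
    have F1: "cmod (F u) < 1" if u: "cmod u < 1" for u
    proof -
      have "(cmod (P (of_real R * u) - c))\<^sup>2 < (cmod (P (of_real R * u) + cnj c))\<^sup>2"
        using mult_pos_pos[OF Ppos[OF inb[OF u]] c] unfolding cmod_power2
        by (simp add: power2_eq_square algebra_simps)
      hence "cmod (P (of_real R * u) - c) < cmod (P (of_real R * u) + cnj c)"
        by (rule power_less_imp_less_base) simp
      thus ?thesis using nz[OF u] by (simp add: F_def norm_divide)
    qed
    define u where "u = z / of_real R"
    have u: "cmod u < 1" using z R by (simp add: u_def norm_divide)
    have "cmod (F u) \<le> cmod u"
      by (rule Schwarz_Lemma(1)[OF holF]) (use F1 u in \<open>auto simp: F_def c_def\<close>)
    define t where "t = cmod u"
    have t: "0 \<le> t" "t < 1" using u by (auto simp: t_def)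
    have zu: "of_real R * u = z" using R by (simp add: u_def)
    have le: "cmod (P z - c) \<le> t * cmod (P z + cnj c)"
      using \<open>cmod (F u) \<le> cmod u\<close> nz[OF u] unfolding F_def zu t_def norm_divide
      by (subst (asm) pos_divide_le_eq) auto
    have sq: "(cmod (P z - c))\<^sup>2 \<le> t\<^sup>2 * (cmod (P z + cnj c))\<^sup>2"
      using power_mono[OF le, of 2] by (simp add: power_mult_distrib)
    define a where "a = Re (P z)"
    define b where "b = Re c"
    have ab: "a > 0" "b > 0" using c Ppos[of z] z by (auto simp: a_def b_def)
    \<comment> \<open>Both squared moduli contain the same imaginary contribution y. As t < 1,
      dropping it keeps the inequality and leaves one between real parts.\<close>
    have "(a - b)\<^sup>2 \<le> t\<^sup>2 * (a + b)\<^sup>2"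
    proof -
      define y where "y = (Im (P z) - Im c)\<^sup>2"
      have "(a - b)\<^sup>2 + y \<le> t\<^sup>2 * ((a + b)\<^sup>2 + y)"
        using sq unfolding cmod_power2 by (simp add: a_def b_def y_def)
      moreover have "t\<^sup>2 * y \<le> y" using t by (intro mult_left_le_one_le) (auto simp: y_def power_le_one)
      ultimately show ?thesis by (simp add: algebra_simps)
    qed
    hence "(a - b)\<^sup>2 \<le> (t * (a + b))\<^sup>2" by (simp add: power_mult_distrib)
    hence "a - b \<le> t * (a + b)" by (rule power2_le_imp_le) (use t ab in auto)
    hence "a * (1 - t) \<le> b * (1 + t)" by (simp add: algebra_simps)
    hence "a \<le> (1 + t) / (1 - t) * b" using t by (simp add: field_simps)
    also have "(1 + t) / (1 - t) = (R + cmod z) / (R - cmod z)"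
      using R z by (simp add: t_def u_def norm_divide field_simps)
    finally show ?thesis using e by (simp add: a_def b_def c_def P_def)
  qed
  show ?thesis
  proof (rule tendsto_lowerbound)
    show "((\<lambda>e. (R + cmod z) / (R - cmod z) * (Re (Q 0) + e)) \<longlongrightarrow> (R + cmod z) / (R - cmod z) * Re (Q 0)) (at_right 0)"
      using z by (auto intro!: tendsto_eq_intros)
    show "\<forall>\<^sub>F e in at_right 0. Re (Q z) \<le> (R + cmod z) / (R - cmod z) * (Re (Q 0) + e)"
      using main by (auto simp: eventually_at_right_less intro: eventually_mono[OF eventually_at_right_less])
  qed auto
qed

text \<open>The modulus of g exp (-Q) is |g| exp (-Re Q), so the maximum principle applies to this
  product.\<close>

lemma max_modulus_exp_bound:
  assumes g: "g analytic_on cball 0 R" and Q: "Q holomorphic_on UNIV" and R: "R > 0"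
    and le: "\<And>w. w \<in> sphere 0 R \<Longrightarrow> cmod (g w) \<le> exp (B + Re (Q w))" and z: "z \<in> cball 0 R"
  shows "cmod (g z) \<le> exp (B + Re (Q z))"
proof -
  have "cmod (g z * exp (- Q z)) \<le> exp B"
  proof (rule maximum_modulus_frontier[of "\<lambda>w. g w * exp (- Q w)" "cball 0 R"])
    have "g holomorphic_on cball 0 R" using g by (rule analytic_imp_holomorphic)
    thus "(\<lambda>w. g w * exp (- Q w)) holomorphic_on interior (cball 0 R)"
      by (intro holomorphic_intros holomorphic_on_subset[OF Q]) (auto elim: holomorphic_on_subset)
    show "continuous_on (closure (cball 0 R)) (\<lambda>w. g w * exp (- Q w))"
      using \<open>g holomorphic_on cball 0 R\<close>
      by (intro continuous_intros continuous_on_subset[OF holomorphic_on_imp_continuous_on[OF Q]])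
         (auto intro: holomorphic_on_imp_continuous_on)
    show "cmod (g w * exp (- Q w)) \<le> exp B" if "w \<in> frontier (cball 0 R)" for w
      using le[of w] that R by (simp add: norm_mult norm_divide exp_add exp_minus field_simps)
  qed (use z in auto)
  thus ?thesis by (simp add: norm_mult norm_divide exp_add exp_minus field_simps)
qed

definition circle_mean :: "(complex \<Rightarrow> real) \<Rightarrow> real \<Rightarrow> real" where
  "circle_mean u r = integral {0..2*pi} (\<lambda>\<theta>. u (of_real r * cis \<theta>)) / (2 * pi)"

lemma continuous_on_circle_integrable:
  assumes "continuous_on (sphere 0 r) (V :: complex \<Rightarrow> real)" "r \<ge> 0"
  shows "(\<lambda>\<theta>. V (of_real r * cis \<theta>)) integrable_on {0..2*pi}"
  using assms(2)
  by (intro integrable_continuous_interval continuous_on_compose2[OF assms(1)] continuous_intros)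
     (auto simp: norm_mult)

lemma circle_mean_Re:
  assumes "Q holomorphic_on UNIV" "r > 0"
  shows "circle_mean (\<lambda>w. Re (Q w)) r = Re (Q 0)"
proof -
  have "((\<lambda>\<theta>. Re (Q (of_real r * cis \<theta>))) has_integral (2 * pi * Re (Q 0))) {0..2*pi}"
    by (rule mean_value_circle_Re[of _ "r + 1"]) (use assms in \<open>auto elim: holomorphic_on_subset\<close>)
  thus ?thesis by (simp add: circle_mean_def integral_unique)
qed

lemma circle_mean_mono:
  assumes "(\<lambda>\<theta>. u (of_real r * cis \<theta>)) integrable_on {0..2*pi}"
    and "(\<lambda>\<theta>. v (of_real r * cis \<theta>)) integrable_on {0..2*pi}"
    and "r \<ge> 0" "\<And>w. w \<in> sphere 0 r \<Longrightarrow> u w \<le> v w"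
  shows "circle_mean u r \<le> circle_mean v r"
  unfolding circle_mean_def using assms
  by (intro divide_right_mono integral_le) (auto simp: norm_mult)

lemma circle_mean_add_const:
  assumes "continuous_on (sphere 0 r) u" "r \<ge> 0"
  shows "circle_mean (\<lambda>w. u w + c) r = circle_mean u r + c"
  using Henstock_Kurzweil_Integration.integral_add[OF continuous_on_circle_integrable[OF assms] integrable_const_ivl[of c]]
  by (simp add: circle_mean_def add_divide_distrib)

text \<open>Takes the place of the Poisson integral of V. Approximating V + e/2 within e/2, instead
  of V itself, puts Re Q above V while its mean exceeds that of V by at most e.\<close>

lemma harmonic_majorant:
  fixes V :: "complex \<Rightarrow> real"
  assumes V: "continuous_on (sphere 0 R) V" and R: "R > 0" and e: "e > 0"
  obtains Q where "Q holomorphic_on UNIV" "\<And>w. w \<in> sphere 0 R \<Longrightarrow> V w \<le> Re (Q w)"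
    "Re (Q 0) \<le> circle_mean V R + e"
proof -
  have "continuous_on (sphere 0 R) (\<lambda>w. V w + e / 2)" using V by (intro continuous_intros)
  from circle_trig_approx[OF this R, of "e / 2"] e obtain Q
    where Q: "Q holomorphic_on UNIV" "\<And>w. w \<in> sphere 0 R \<Longrightarrow> \<bar>V w + e / 2 - Re (Q w)\<bar> < e / 2"
    by auto
  have cQ: "continuous_on (sphere 0 R) (\<lambda>w. Re (Q w))"
    by (intro continuous_intros holomorphic_on_imp_continuous_on holomorphic_on_subset[OF Q(1)]) auto
  have "Re (Q 0) = circle_mean (\<lambda>w. Re (Q w)) R" using circle_mean_Re[OF Q(1) R] by simp
  also have "\<dots> \<le> circle_mean (\<lambda>w. V w + e) R"
  proof (rule circle_mean_mono)
    show "Re (Q w) \<le> V w + e" if "w \<in> sphere 0 R" for w using Q(2)[OF that] by linarith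
  qed (use R in \<open>auto intro!: continuous_on_circle_integrable cQ V continuous_intros\<close>)
  also have "\<dots> = circle_mean V R + e" using circle_mean_add_const[OF V] R by simp
  finally have "Re (Q 0) \<le> circle_mean V R + e" .
  moreover have "V w \<le> Re (Q w)" if "w \<in> sphere 0 R" for w
    using Q(2)[OF that] e by linarith
  ultimately show ?thesis using that Q(1) by blast
qed

text \<open>A harmonic majorant of V on the circle bounds ln |g| - B inside, and being nonnegative
  it obeys Harnack's inequality. So only the mean of V enters, not its maximum; with V = log+ |f|
  that mean is m(R, f).\<close>

lemma Poisson_Harnack_bound:
  assumes g: "g analytic_on cball 0 R" and V: "continuous_on (sphere 0 R) V"
    and V0: "\<And>w. w \<in> sphere 0 R \<Longrightarrow> V w \<ge> 0"
    and le: "\<And>w. w \<in> sphere 0 R \<Longrightarrow> cmod (g w) \<le> exp (B + V w)" and z: "cmod z < R"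
  shows "cmod (g z) \<le> exp (B + (R + cmod z) / (R - cmod z) * circle_mean V R)"
proof (rule tendsto_lowerbound)
  have R: "R > 0" using z norm_ge_zero[of z] by linarith
  have K: "(R + cmod z) / (R - cmod z) \<ge> 0" using z R by simp
  show "((\<lambda>e. exp (B + (R + cmod z) / (R - cmod z) * (circle_mean V R + e))) \<longlongrightarrow>
     exp (B + (R + cmod z) / (R - cmod z) * circle_mean V R)) (at_right 0)"
    using z by (auto intro!: tendsto_eq_intros)
  have "cmod (g z) \<le> exp (B + (R + cmod z) / (R - cmod z) * (circle_mean V R + e))" if "e > 0" for e
  proof -
    obtain Q where Q: "Q holomorphic_on UNIV" "\<And>w. w \<in> sphere 0 R \<Longrightarrow> V w \<le> Re (Q w)"
      "Re (Q 0) \<le> circle_mean V R + e"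
      using harmonic_majorant[OF V R \<open>e > 0\<close>] by blast
    have "cmod (g z) \<le> exp (B + Re (Q z))"
    proof (rule max_modulus_exp_bound[OF g Q(1) R])
      show "cmod (g w) \<le> exp (B + Re (Q w))" if "w \<in> sphere 0 R" for w
        using le[OF that] Q(2)[OF that] by (smt (verit) exp_le_cancel_iff)
    qed (use z in auto)
    also have "Re (Q z) \<le> (R + cmod z) / (R - cmod z) * Re (Q 0)"
      using V0 Q(2) by (intro Harnack_holomorphic Q(1) z) (meson order_trans)
    also have "\<dots> \<le> (R + cmod z) / (R - cmod z) * (circle_mean V R + e)"
      using K Q(3) by (rule mult_left_mono[rotated])
    finally show ?thesis by simp
  qed
  thus "\<forall>\<^sub>F e in at_right 0. cmod (g z) \<le> exp (B + (R + cmod z) / (R - cmod z) * (circle_mean V R + e))"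
    by (auto intro: eventually_mono[OF eventually_at_right_less])
qed auto

text \<open>The function ln (max |g| |h|) is subharmonic: a harmonic majorant of it on |w| = R
  bounds ln |g| and ln |h| throughout the disc, and the mean of that majorant over |w| = r is its
  value at 0.\<close>

lemma circle_mean_max_ln_mono:
  assumes g: "g analytic_on cball 0 R" and h: "h analytic_on cball 0 R"
    and nz: "\<And>w. w \<in> cball 0 R \<Longrightarrow> max (cmod (g w)) (cmod (h w)) \<noteq> 0"
    and r: "0 < r" "r \<le> R"
  shows "circle_mean (\<lambda>w. ln (max (cmod (g w)) (cmod (h w)))) r
       \<le> circle_mean (\<lambda>w. ln (max (cmod (g w)) (cmod (h w)))) R"
proof (rule field_le_epsilon)
  fix e :: real assume e: "e > 0"
  define u where "u w = ln (max (cmod (g w)) (cmod (h w)))" for w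
  have R: "R > 0" using r by simp
  have "continuous_on (cball 0 R) g" "continuous_on (cball 0 R) h"
    using g h by (auto intro: holomorphic_on_imp_continuous_on analytic_imp_holomorphic)
  hence cu: "continuous_on (cball 0 R) u" unfolding u_def using nz by (intro continuous_intros) auto
  obtain Q where Q: "Q holomorphic_on UNIV" "\<And>w. w \<in> sphere 0 R \<Longrightarrow> u w \<le> Re (Q w)"
      "Re (Q 0) \<le> circle_mean u R + e"
    using harmonic_majorant[OF continuous_on_subset[OF cu] R e] by auto
  have mx: "max (cmod (g w)) (cmod (h w)) = exp (u w)" if "w \<in> cball 0 R" for w
    using nz[OF that] by (simp add: u_def less_max_iff_disj) (smt (verit) exp_ln norm_ge_zero)
  have gh: "cmod (g w) \<le> exp (0 + Re (Q w))" "cmod (h w) \<le> exp (0 + Re (Q w))" if "w \<in> sphere 0 R" for w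
    using mx[of w] Q(2)[OF that] that R by (smt (verit) exp_le_cancel_iff mem_cball mem_sphere)+
  have "u w \<le> Re (Q w)" if w: "w \<in> cball 0 R" for w
  proof -
    have "cmod (g w) \<le> exp (0 + Re (Q w))" "cmod (h w) \<le> exp (0 + Re (Q w))"
      using max_modulus_exp_bound[OF g Q(1) R gh(1) w] max_modulus_exp_bound[OF h Q(1) R gh(2) w] by auto
    thus ?thesis using mx[OF w] by (smt (verit) exp_le_cancel_iff)
  qed
  hence "circle_mean u r \<le> circle_mean (\<lambda>w. Re (Q w)) r"
    using r
    by (intro circle_mean_mono continuous_on_circle_integrable continuous_intros
          continuous_on_subset[OF cu] continuous_on_subset[OF holomorphic_on_imp_continuous_on[OF Q(1)]]) auto
  also have "\<dots> \<le> circle_mean u R + e" using circle_mean_Re[OF Q(1) r(1)] Q(3) by simp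
  finally show "circle_mean (\<lambda>w. ln (max (cmod (g w)) (cmod (h w)))) r \<le>
       circle_mean (\<lambda>w. ln (max (cmod (g w)) (cmod (h w)))) R + e" unfolding u_def .
qed

section \<open>Nevanlinna functions\<close>

lemma prod_mset_linear_split:
  fixes M :: "'a::comm_ring_1 multiset"
  shows "(\<Prod>b\<in>#M. w - b) = (w - z) ^ count M z * (\<Prod>b\<in>#filter_mset (\<lambda>b. b \<noteq> z) M. w - b)"
  by (induction M) (auto simp: algebra_simps)

lemma prod_mset_linear_eq_0_iff:
  fixes M :: "'a::idom multiset"
  shows "(\<Prod>b\<in>#M. w - b) = 0 \<longleftrightarrow> w \<in># M"
  by (induction M) auto

lemma holomorphic_prod_mset_linear [holomorphic_intros]:
  "(\<lambda>w::complex. \<Prod>b\<in>#M. w - b) holomorphic_on S"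
  by (induction M) (auto intro!: holomorphic_intros)

lemma ln_norm_prod_mset_linear:
  fixes w :: complex
  assumes "w \<notin># M"
  shows "ln (cmod (\<Prod>b\<in>#M. w - b)) = (\<Sum>b\<in>#M. ln (cmod (w - b)))"
  using assms
proof (induction M)
  case (add x M)
  have "(\<Prod>b\<in>#M. w - b) \<noteq> 0" using add.prems by (subst prod_mset_linear_eq_0_iff) auto
  thus ?case using add by (simp add: norm_mult ln_mult)
qed simp

lemma has_integral_sum_mset:
  fixes f :: "'b \<Rightarrow> real \<Rightarrow> real"
  assumes "\<And>a. a \<in># A \<Longrightarrow> (f a has_integral I a) S"
  shows "((\<lambda>x. \<Sum>a\<in>#A. f a x) has_integral (\<Sum>a\<in>#A. I a)) S"
  using assms by (induction A) (auto intro!: has_integral_add)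

lemma jensen_multiset:
  assumes "r > 0"
  shows "((\<lambda>\<theta>. \<Sum>a\<in>#A. ln (cmod (of_real r * cis \<theta> - a)))
           has_integral (2 * pi * (\<Sum>a\<in>#A. ln (max r (cmod a))))) {0..2*pi}"
  using has_integral_sum_mset[where A = A, OF jensen_linear[OF assms]]
  by (simp add: sum_mset_distrib_left)

lemma has_integral_counting_linear:
  fixes a :: complex
  assumes r: "r > 0"
  shows "((\<lambda>t. if a \<noteq> 0 \<and> cmod a \<le> t then 1 / t else 0)
           has_integral (if a = 0 then 0 else ln (max r (cmod a)) - ln (cmod a))) {0..r}"
proof (cases "a \<noteq> 0 \<and> cmod a \<le> r")
  case True
  have "((\<lambda>t. 1 / t) has_integral (ln r - ln (cmod a))) {cmod a..r}"
    using True less_le_trans[OF zero_less_norm_iff[THEN iffD2]] by (intro fundamental_theorem_of_calculus)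
      (auto intro!: derivative_eq_intros simp flip: has_real_derivative_iff_has_vector_derivative simp: field_simps)
  hence "((\<lambda>t. if t \<in> {cmod a..r} then 1 / t else 0) has_integral (ln r - ln (cmod a))) {0..r}"
    by (subst has_integral_restrict) auto
  hence "((\<lambda>t. if a \<noteq> 0 \<and> cmod a \<le> t then 1 / t else 0) has_integral (ln r - ln (cmod a))) {0..r}"
    by (rule has_integral_eq[rotated]) (use True in auto)
  moreover have "max r (cmod a) = r" using True by simp
  ultimately show ?thesis using True by simp
next
  case False
  have "((\<lambda>t. 0::real) has_integral 0) {0..r}" by simp
  hence "((\<lambda>t. if a \<noteq> 0 \<and> cmod a \<le> t then 1 / t else 0) has_integral 0) {0..r}"
    by (rule has_integral_eq[rotated]) (use False in auto)
  thus ?thesis using False by (auto simp: max_def)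
qed

text \<open>Equals n(t, f) when A lists the poles of f in a larger disc; it also serves for
  multisets that merely contain the poles.\<close>

definition count_fun :: "complex multiset \<Rightarrow> real \<Rightarrow> real" where
  "count_fun A t = real (size (filter_mset (\<lambda>a. cmod a \<le> t) A))"

lemma count_fun_diff:
  assumes "t \<ge> 0"
  shows "count_fun A t - count_fun A 0 = (\<Sum>a\<in>#A. if a \<noteq> 0 \<and> cmod a \<le> t then 1 else 0)"
  unfolding count_fun_def using assms by (induction A) auto

lemma has_integral_count_fun:
  assumes r: "r > 0"
  shows "((\<lambda>t. (count_fun A t - count_fun A 0) / t) has_integral
           (\<Sum>a\<in>#A. if a = 0 then 0 else ln (max r (cmod a)) - ln (cmod a))) {0..r}"
proof -
  have "((\<lambda>t. \<Sum>a\<in>#A. if a \<noteq> 0 \<and> cmod a \<le> t then 1 / t else 0) has_integral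
           (\<Sum>a\<in>#A. if a = 0 then 0 else ln (max r (cmod a)) - ln (cmod a))) {0..r}"
    by (intro has_integral_sum_mset has_integral_counting_linear r)
  thus ?thesis
  proof (rule has_integral_eq[rotated])
    fix t assume "t \<in> {0..r}"
    hence "(count_fun A t - count_fun A 0) / t = (\<Sum>a\<in>#A. if a \<noteq> 0 \<and> cmod a \<le> t then 1 else 0) / t"
      by (subst count_fun_diff) auto
    also have "\<dots> = (\<Sum>a\<in>#A. if a \<noteq> 0 \<and> cmod a \<le> t then 1 / t else 0)"
      by (induction A) (auto simp: add_divide_distrib)
    finally show "(\<Sum>a\<in>#A. if a \<noteq> 0 \<and> cmod a \<le> t then 1 / t else 0) = (count_fun A t - count_fun A 0) / t" ..
  qed
qed

text \<open>An element a = 0 contributes ln r on both sides: through \<open>count_fun A 0\<close> on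
  the left, and because \<open>ln 0 = 0\<close> on the right.\<close>

lemma sum_mset_jensen_terms:
  assumes r: "r > 0"
  shows "(\<Sum>a\<in>#A. if a = 0 then 0 else ln (max r (cmod a)) - ln (cmod a)) + count_fun A 0 * ln r
       = (\<Sum>a\<in>#A. ln (max r (cmod a))) - (\<Sum>a\<in>#A. ln (cmod a))"
  unfolding count_fun_def using r by (induction A) (auto simp: algebra_simps)

section \<open>Poles in a disc and the factorisation f = g / h\<close>

definition nev_poles :: "(complex \<Rightarrow> complex) \<Rightarrow> real \<Rightarrow> complex multiset" where
  "nev_poles f R = Abs_multiset (\<lambda>b. if is_pole f b \<and> cmod b \<le> R then nat (- zorder f b) else 0)"

lemma finite_singularities_cball:
  assumes "f meromorphic_on UNIV"
  shows "finite {w\<in>cball 0 R. \<not> f analytic_on {w}}"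
proof -
  have "{w. \<not> f analytic_on {w}} sparse_in cball 0 R"
    using meromorphic_on_imp_sparse_singularities[OF meromorphic_on_subset[OF assms]] by auto
  from sparse_in_compact_finite[OF this] show ?thesis by (simp add: Int_def conj_commute)
qed

lemma finite_poles_cball:
  assumes "f meromorphic_on UNIV"
  shows "finite {b. is_pole f b \<and> cmod b \<le> R}"
  by (rule finite_subset[OF _ finite_singularities_cball[OF assms, of R]])
     (auto dest: analytic_at_imp_no_pole)

text \<open>A disc contains only finitely many poles, which makes the abstraction to a multiset
  legitimate.\<close>

lemma count_nev_poles:
  assumes "f meromorphic_on UNIV"
  shows "count (nev_poles f R) b = (if is_pole f b \<and> cmod b \<le> R then nat (- zorder f b) else 0)"
  unfolding nev_poles_def
  by (subst count_Abs_multiset)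
     (auto intro: finite_subset[OF _ finite_poles_cball[OF assms, of R]])

lemma pole_factorization:
  assumes mero: "f meromorphic_on UNIV" and pole: "is_pole f z"
  obtains g r where "r > 0" "g holomorphic_on cball z r" "g z \<noteq> 0" "zorder f z < 0"
    "\<And>w. w \<in> cball z r - {z} \<Longrightarrow> f w = g w / (w - z) ^ nat (- zorder f z)"
proof -
  have "isolated_singularity_at f z"
    using mero by (meson meromorphic_on_isolated_singularity meromorphic_on_subset subset_UNIV)
  then obtain s where s: "s > 0" "f analytic_on ball z s - {z}"
    unfolding isolated_singularity_at_def by blast
  have "f holomorphic_on ball z s - {z}" using s(2) by (rule analytic_imp_holomorphic)
  from zorder_exist_pole[OF this _ _ pole] s(1) obtain r where
    "zorder f z < 0" "zor_poly f z z \<noteq> 0" "r > 0" "zor_poly f z holomorphic_on cball z r"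
    "\<forall>w\<in>cball z r - {z}. f w = zor_poly f z w / (w - z) ^ nat (- zorder f z)"
    by auto
  thus ?thesis using that by blast
qed

lemma set_mset_nev_poles:
  assumes "f meromorphic_on UNIV"
  shows "set_mset (nev_poles f R) = {b. is_pole f b \<and> cmod b \<le> R}"
proof -
  have "nat (- zorder f b) > 0" if "is_pole f b" for b
    by (rule pole_factorization[OF assms that]) simp
  thus ?thesis by (auto simp: set_mset_def count_nev_poles[OF assms] split: if_splits)
qed

lemma nev_n_eq_count_fun:
  assumes mero: "f meromorphic_on UNIV" and t: "t \<le> R"
  shows "nev_n f t = count_fun (nev_poles f R) t"
proof -
  have eq: "filter_mset (\<lambda>a. cmod a \<le> t) (nev_poles f R) = nev_poles f t"
    using t by (intro multiset_eqI) (auto simp: count_nev_poles[OF mero])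
  have "{z. cmod z \<le> t \<and> is_pole f z} = set_mset (nev_poles f t)"
    by (auto simp: set_mset_nev_poles[OF mero])
  hence "nev_n f t = real (\<Sum>z\<in>set_mset (nev_poles f t). nat (- zorder f z))"
    unfolding nev_n_def by simp
  also have "(\<Sum>z\<in>set_mset (nev_poles f t). nat (- zorder f z)) = size (nev_poles f t)"
    unfolding size_multiset_overloaded_eq
    by (rule sum.cong) (auto simp: count_nev_poles[OF mero] set_mset_nev_poles[OF mero])
  finally show ?thesis by (simp add: count_fun_def eq)
qed

text \<open>The poles of a larger disc may be used: those with r < |b| \<le> R cancel, since then
  \<open>max r (cmod b)\<close> is |b|. One multiset thus serves all radii up to R.\<close>

lemma nev_N_eq:
  assumes mero: "f meromorphic_on UNIV" and r: "0 < r" "r \<le> R"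
  shows "nev_N f r = (\<Sum>b\<in>#nev_poles f R. ln (max r (cmod b))) - (\<Sum>b\<in>#nev_poles f R. ln (cmod b))"
proof -
  let ?A = "nev_poles f R"
  have "((\<lambda>t. (nev_n f t - nev_n f 0) / t) has_integral
     (\<Sum>a\<in>#?A. if a = 0 then 0 else ln (max r (cmod a)) - ln (cmod a))) {0..r}"
    by (rule has_integral_eq[OF _ has_integral_count_fun[OF r(1)]])
       (use r in \<open>auto simp: nev_n_eq_count_fun[OF mero, of _ R]\<close>)
  hence "nev_N f r = (\<Sum>a\<in>#?A. if a = 0 then 0 else ln (max r (cmod a)) - ln (cmod a)) + count_fun ?A 0 * ln r"
    using r by (simp add: nev_N_def integral_unique nev_n_eq_count_fun[OF mero, of _ R])
  thus ?thesis using sum_mset_jensen_terms[OF r(1)] by simp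
qed

text \<open>The polynomial h cancels each pole exactly, so f h has finite limits everywhere, nonzero
  at the poles, and g is obtained by removing singularities. Values of f at its singular points are
  arbitrary, hence the finite set E. That g does not vanish at the poles means that g and h have no
  common zero, so ln (max |g| |h|) is continuous.\<close>

lemma meromorphic_quotient_cball:
  assumes mero: "f meromorphic_on UNIV"
  obtains g E where "g analytic_on cball 0 R" "finite E"
    "\<And>w. w \<in> cball 0 R - E \<Longrightarrow> f w * (\<Prod>b\<in>#nev_poles f R. w - b) = g w"
    "\<And>b. b \<in># nev_poles f R \<Longrightarrow> g b \<noteq> 0" "set_mset (nev_poles f R) \<subseteq> E"
proof -
  define M where "M = nev_poles f R"
  define h where "h w = (\<Prod>b\<in>#M. w - b)" for w
  define F where "F w = f w * h w" for w
  define E where "E = {w\<in>cball 0 R. \<not> f analytic_on {w}}"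
  have hh: "h holomorphic_on UNIV" unfolding h_def by (rule holomorphic_prod_mset_linear)
  hence han: "h analytic_on S" for S using analytic_on_holomorphic by blast
  have Fm: "F meromorphic_on UNIV" unfolding F_def
    by (intro meromorphic_intros mero) (auto intro: analytic_on_imp_meromorphic_on han)
  have lim: "\<exists>c. F \<midarrow>z\<rightarrow> c \<and> (z \<in># M \<longrightarrow> c \<noteq> 0)" if z: "z \<in> cball 0 R" for z
  proof (cases "is_pole f z")
    case True
    obtain g r where g: "r > 0" "g holomorphic_on cball z r" "g z \<noteq> 0" 
      "\<And>w. w \<in> cball z r - {z} \<Longrightarrow> f w = g w / (w - z) ^ nat (- zorder f z)"
      using pole_factorization[OF mero True] by metis
    define k where "k w = (\<Prod>b\<in>#filter_mset (\<lambda>b. b \<noteq> z) M. w - b)" for w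
    have cnt: "count M z = nat (- zorder f z)" using True z by (simp add: M_def count_nev_poles[OF mero])
    have k: "k holomorphic_on UNIV" unfolding k_def by (rule holomorphic_prod_mset_linear)
    have kz: "k z \<noteq> 0" unfolding k_def by (subst prod_mset_linear_eq_0_iff) auto
    have "(\<lambda>w. g w * k w) holomorphic_on ball z r"
      by (intro holomorphic_intros holomorphic_on_subset[OF k] holomorphic_on_subset[OF g(2)]) auto
    hence "isCont (\<lambda>w. g w * k w) z"
      using g(1) by (metis analytic_at_imp_isCont centre_in_ball holomorphic_on_imp_analytic_at open_ball)
    hence "(\<lambda>w. g w * k w) \<midarrow>z\<rightarrow> g z * k z" by (simp add: isCont_def)
    moreover have "\<forall>\<^sub>F w in at z. g w * k w = F w"
    proof -
      have "\<forall>\<^sub>F w in at z. w \<in> ball z r - {z}" using g(1) by (intro eventually_at_in_open) auto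
      thus ?thesis
      proof eventually_elim
        case (elim w)
        thus ?case using g(4)[of w]
          by (simp add: F_def h_def prod_mset_linear_split[of w M z] cnt k_def)
      qed
    qed
    ultimately have "F \<midarrow>z\<rightarrow> g z * k z" by (rule Lim_transform_eventually)
    thus ?thesis using g(3) kz by auto
  next
    case False
    have "not_essential f z" using mero by (meson meromorphic_on_not_essential meromorphic_on_subset subset_UNIV)
    then obtain c where "f \<midarrow>z\<rightarrow> c" using False by (auto simp: not_essential_def)
    moreover have "h \<midarrow>z\<rightarrow> h z" using han[of "{z}"] analytic_at_imp_isCont isCont_def by blast
    ultimately have "F \<midarrow>z\<rightarrow> c * h z" unfolding F_def by (intro tendsto_intros)
    moreover have "z \<notin># M" using False by (simp add: M_def set_mset_nev_poles[OF mero])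
    ultimately show ?thesis by blast
  qed
  show ?thesis
  proof (rule that[of "remove_sings F" E])
    show "remove_sings F analytic_on cball 0 R"
    proof (subst analytic_on_analytic_at, safe)
      fix z assume "z \<in> cball (0::complex) R"
      then obtain c where "F \<midarrow>z\<rightarrow> c" using lim by blast
      moreover have "isolated_singularity_at F z"
        using Fm by (meson meromorphic_on_isolated_singularity meromorphic_on_subset subset_UNIV)
      ultimately show "remove_sings F analytic_on {z}" by (rule remove_sings_analytic_at[rotated])
    qed
    show "finite E" unfolding E_def by (rule finite_singularities_cball[OF mero])
    show "f w * (\<Prod>b\<in>#nev_poles f R. w - b) = remove_sings F w" if "w \<in> cball 0 R - E" for w
    proof -
      have "f analytic_on {w}" using that by (auto simp: E_def)
      hence "F analytic_on {w}" unfolding F_def by (rule analytic_on_mult[OF _ han])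
      thus ?thesis by (simp add: F_def h_def M_def)
    qed
    show "remove_sings F b \<noteq> 0" if "b \<in># nev_poles f R" for b
    proof -
      have "b \<in> cball 0 R" using that by (simp add: set_mset_nev_poles[OF mero])
      from lim[OF this] that obtain c where c: "F \<midarrow>b\<rightarrow> c" "c \<noteq> 0" unfolding M_def by blast
      thus ?thesis using remove_sings_eqI[OF c(1)] by simp
    qed
    show "set_mset (nev_poles f R) \<subseteq> E"
      by (auto simp: set_mset_nev_poles[OF mero] E_def dest: analytic_at_imp_no_pole)
  qed
qed

section \<open>The characteristic as a circle mean\<close>

lemma ln_max_quotient:
  assumes "h \<noteq> 0" "f * h = g"
  shows "log_plus (cmod f) = ln (max (cmod g) (cmod h)) - ln (cmod h)"
proof (cases "f = 0")
  case True
  thus ?thesis using assms by (auto simp: log_plus_def max_def)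
next
  case False
  have g: "cmod g = cmod f * cmod h" using assms(2) by (metis norm_mult)
  have "cmod f > 0" "cmod h > 0" using False assms by auto
  show ?thesis
  proof (cases "cmod f \<ge> 1")
    case True
    hence "cmod h \<le> cmod f * cmod h" using \<open>cmod h > 0\<close> by simp
    hence "max (cmod g) (cmod h) = cmod f * cmod h" using g by simp
    moreover have "log_plus (cmod f) = ln (cmod f)" using True by (simp add: log_plus_def)
    ultimately show ?thesis using \<open>cmod f > 0\<close> \<open>cmod h > 0\<close> by (simp add: ln_mult)
  next
    case f: False
    hence "max (cmod g) (cmod h) = cmod h" using g \<open>cmod h > 0\<close> by (simp add: max_def)
    thus ?thesis using f \<open>cmod f > 0\<close> by (simp add: log_plus_def max_def)
  qed
qed

text \<open>Here log+ |f| = ln (max |g| |h|) - ln |h|. By Jensen's formula the mean of ln |h| is the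
  sum of ln (max r |b|), which is also the r-dependent part of N(r, f). The two cancel, and the
  remaining correction does not depend on r.\<close>

lemma nev_T_eq_circle_mean:
  assumes mero: "f meromorphic_on UNIV" and r: "0 < r" "r \<le> R"
    and g: "g analytic_on cball 0 R" and E: "finite E" "set_mset (nev_poles f R) \<subseteq> E"
    and fg: "\<And>w. w \<in> cball 0 R - E \<Longrightarrow> f w * (\<Prod>b\<in>#nev_poles f R. w - b) = g w"
    and nz: "\<And>b. b \<in># nev_poles f R \<Longrightarrow> g b \<noteq> 0"
  shows "nev_T f r = circle_mean (\<lambda>w. ln (max (cmod (g w)) (cmod (\<Prod>b\<in>#nev_poles f R. w - b)))) r
           - (\<Sum>b\<in>#nev_poles f R. ln (cmod b))"
proof -
  let ?M = "nev_poles f R"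
  define u where "u w = ln (max (cmod (g w)) (cmod (\<Prod>b\<in>#?M. w - b)))" for w
  have "continuous_on (cball 0 R) g" using g by (intro holomorphic_on_imp_continuous_on analytic_imp_holomorphic)
  moreover have "continuous_on (cball 0 R) (\<lambda>w. \<Prod>b\<in>#?M. w - b)"
    by (intro holomorphic_on_imp_continuous_on holomorphic_prod_mset_linear)
  moreover have "max (cmod (g w)) (cmod (\<Prod>b\<in>#?M. w - b)) \<noteq> 0" for w
    using nz[of w] prod_mset_linear_eq_0_iff[of w ?M] by (smt (verit, best) norm_le_zero_iff)
  ultimately have "continuous_on (cball 0 R) u" unfolding u_def by (intro continuous_intros) auto
  hence "continuous_on (sphere 0 r) u" using r by (elim continuous_on_subset) auto
  hence "((\<lambda>\<theta>. u (of_real r * cis \<theta>)) has_integral (2 * pi * circle_mean u r)) {0..2*pi}"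
    using continuous_on_circle_integrable[of r u] r by (simp add: circle_mean_def has_integral_integral)
  from has_integral_diff[OF this jensen_multiset[OF r(1), of ?M]]
  have I: "((\<lambda>\<theta>. u (of_real r * cis \<theta>) - (\<Sum>b\<in>#?M. ln (cmod (of_real r * cis \<theta> - b))))
     has_integral (2 * pi * (circle_mean u r - (\<Sum>b\<in>#?M. ln (max r (cmod b)))))) {0..2*pi}"
    by (simp add: right_diff_distrib)
  have "((\<lambda>\<theta>. log_plus (cmod (f (of_real r * cis \<theta>))))
     has_integral (2 * pi * (circle_mean u r - (\<Sum>b\<in>#?M. ln (max r (cmod b)))))) {0..2*pi}"
  proof (rule has_integral_spike_finite[OF _ _ I])
    show "finite {\<theta>\<in>{0..2*pi}. of_real r * cis \<theta> \<in> E}" by (rule finite_cis_vimage) (use r E in auto)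
    fix \<theta> assume "\<theta> \<in> {0..2*pi} - {\<theta>\<in>{0..2*pi}. of_real r * cis \<theta> \<in> E}"
    hence w: "of_real r * cis \<theta> \<in> cball 0 R - E" using r by (auto simp: norm_mult)
    hence nM: "of_real r * cis \<theta> \<notin># ?M" using E by auto
    hence h0: "(\<Prod>b\<in>#?M. of_real r * cis \<theta> - b) \<noteq> 0" by (subst prod_mset_linear_eq_0_iff)
    show "log_plus (cmod (f (of_real r * cis \<theta>))) =
        u (of_real r * cis \<theta>) - (\<Sum>b\<in>#?M. ln (cmod (of_real r * cis \<theta> - b)))"
      unfolding u_def ln_max_quotient[OF h0 fg[OF w]] ln_norm_prod_mset_linear[OF nM] ..
  qed
  hence "nev_m f r = circle_mean u r - (\<Sum>b\<in>#?M. ln (max r (cmod b)))"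
    by (simp add: nev_m_def integral_unique)
  thus ?thesis unfolding nev_T_def nev_N_eq[OF mero r] u_def by simp
qed

text \<open>Both radii are treated with the factorisation on the larger disc, so the corrections
  agree and only the circle means have to be compared.\<close>

lemma nev_T_mono:
  assumes mero: "f meromorphic_on UNIV" and r: "0 < r" "r \<le> R"
  shows "nev_T f r \<le> nev_T f R"
proof -
  obtain g E where g: "g analytic_on cball 0 R" "finite E"
    "\<And>w. w \<in> cball 0 R - E \<Longrightarrow> f w * (\<Prod>b\<in>#nev_poles f R. w - b) = g w"
    "\<And>b. b \<in># nev_poles f R \<Longrightarrow> g b \<noteq> 0" "set_mset (nev_poles f R) \<subseteq> E"
    using meromorphic_quotient_cball[OF mero] by metis
  have "(\<lambda>w. \<Prod>b\<in>#nev_poles f R. w - b) holomorphic_on UNIV"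
    by (rule holomorphic_prod_mset_linear)
  hence h: "(\<lambda>w. \<Prod>b\<in>#nev_poles f R. w - b) analytic_on cball 0 R"
    using analytic_on_holomorphic by blast
  have "max (cmod (g w)) (cmod (\<Prod>b\<in>#nev_poles f R. w - b)) \<noteq> 0" for w
    using g(4)[of w] prod_mset_linear_eq_0_iff[of w "nev_poles f R"] by (smt (verit, best) norm_le_zero_iff)
  from circle_mean_max_ln_mono[OF g(1) h this r]
  show ?thesis
    using nev_T_eq_circle_mean[OF mero r g(1,2,5,3,4)]
      nev_T_eq_circle_mean[OF mero _ order_refl g(1,2,5,3,4)] r by simp
qed

lemma nev_m_nonneg: "nev_m f r \<ge> 0"
  unfolding nev_m_def log_plus_def
  by (cases "(\<lambda>\<theta>. max 0 (ln (cmod (f (of_real r * cis \<theta>))))) integrable_on {0..2*pi}")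
     (auto intro!: divide_nonneg_nonneg integral_nonneg simp: not_integrable_integral)

text \<open>The terms with a = 0 contribute ln 0 = 0 to the sum, which is the normalisation of nev_N at the origin.
  Integrals of functions not known to be integrable are harmless, as they are 0 and the bounds are nonnegative.
  The lower bound 0 matters because ln (- x) = ln x, so that log_plus does not ignore negative arguments.\<close>

lemma nev_T_upper_bound:
  fixes F G :: "complex \<Rightarrow> complex"
  assumes G: "G holomorphic_on ball 0 \<rho>" and r: "1 \<le> r" "r < \<rho>" and E: "finite E"
    and FG: "\<And>x. x \<in> ball 0 \<rho> - E \<Longrightarrow> F x * (\<Prod>a\<in>#A. x - a) = G x"
    and G_le: "\<And>x. x \<in> sphere 0 r \<Longrightarrow> cmod (G x) \<le> exp B"
    and A_le: "\<And>x. x \<in> sphere 0 r \<Longrightarrow> cmod (\<Prod>a\<in>#A. x - a) \<le> exp B"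
  shows "0 \<le> nev_T F r \<and> nev_T F r \<le> B - (\<Sum>a\<in>#A. ln (cmod a))"
proof -
  have r0: "r > 0" using r by simp
  define k where "k \<theta> = B - (\<Sum>a\<in>#A. ln (cmod (of_real r * cis \<theta> - a)))" for \<theta>
  define Z where "Z = {\<theta>\<in>{0..2*pi}. of_real r * cis \<theta> \<in> E \<union> set_mset A}"
  have Z: "finite Z" unfolding Z_def by (rule finite_cis_vimage) (use r E in auto)
  have k_int: "(k has_integral (2 * pi * (B - (\<Sum>a\<in>#A. ln (max r (cmod a)))))) {0..2*pi}"
    using has_integral_diff[OF has_integral_const_real[of B 0 "2*pi"] jensen_multiset[OF r0, of A]]
    by (simp add: k_def[abs_def] right_diff_distrib)
  define l where "l \<theta> = log_plus (cmod (F (of_real r * cis \<theta>)))" for \<theta>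
  have l0: "l \<theta> \<ge> 0" for \<theta> by (simp add: l_def log_plus_def)
  \<comment> \<open>At the angles in Z the function k need not dominate l, as F is uncontrolled
    there and \<open>ln 0 = 0\<close>. Changing k at finitely many angles keeps its integral and
    makes the comparison pointwise.\<close>
  define k' where "k' \<theta> = (if \<theta> \<in> Z then l \<theta> else k \<theta>)" for \<theta>
  have k'_int: "(k' has_integral (2 * pi * (B - (\<Sum>a\<in>#A. ln (max r (cmod a)))))) {0..2*pi}"
    by (rule has_integral_spike_finite[OF Z _ k_int]) (auto simp: k'_def)
  have lk: "l \<theta> \<le> k' \<theta>" if "\<theta> \<in> {0..2*pi}" for \<theta>
  proof (cases "\<theta> \<in> Z")
    case False
    define w where "w = of_real r * cis \<theta>"
    have w: "w \<in> ball 0 \<rho> - E" "w \<in> sphere 0 r" "w \<notin># A"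
      using False that r by (auto simp: Z_def w_def norm_mult)
    define h where "h = (\<Prod>a\<in>#A. w - a)"
    have h0: "h \<noteq> 0" unfolding h_def using w by (subst prod_mset_linear_eq_0_iff) auto
    have "l \<theta> = ln (max (cmod (G w)) (cmod h)) - ln (cmod h)"
      unfolding l_def w_def[symmetric] by (rule ln_max_quotient[OF h0]) (use FG[OF w(1)] in \<open>simp add: h_def\<close>)
    also have "max (cmod (G w)) (cmod h) \<le> exp B" using G_le[OF w(2)] A_le[OF w(2)] by (simp add: h_def)
    hence "ln (max (cmod (G w)) (cmod h)) \<le> ln (exp B)"
      using h0 by (subst ln_le_cancel_iff) (auto simp: less_max_iff_disj)
    also have "ln (cmod h) = (\<Sum>a\<in>#A. ln (cmod (w - a)))" unfolding h_def by (rule ln_norm_prod_mset_linear[OF w(3)])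
    finally show ?thesis using False by (simp add: k'_def k_def w_def)
  qed (simp add: k'_def)
  have int_le: "integral {0..2*pi} l \<le> 2 * pi * (B - (\<Sum>a\<in>#A. ln (max r (cmod a))))"
  proof (cases "l integrable_on {0..2*pi}")
    case True
    hence "integral {0..2*pi} l \<le> integral {0..2*pi} k'" using k'_int lk by (intro integral_le) auto
    thus ?thesis using integral_unique[OF k'_int] by simp
  next
    case False
    have "0 \<le> 2 * pi * (B - (\<Sum>a\<in>#A. ln (max r (cmod a))))"
      by (rule has_integral_nonneg[OF k'_int]) (use lk l0 in \<open>meson order_trans\<close>)
    thus ?thesis using not_integrable_integral[OF False] by simp
  qed
  hence m: "nev_m F r \<le> B - (\<Sum>a\<in>#A. ln (max r (cmod a)))"
    unfolding nev_m_def l_def by (simp add: field_simps)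
  \<comment> \<open>If the order exceeded the multiplicity of z in A by d + 1, then (w - z)^order
    F(w) = (w - z)^(d+1) G(w) / h(w) would tend to 0 at z, whereas the limit at a pole of that order
    is nonzero.\<close>
  have order: "nat (- zorder F z) \<le> count A z" "0 < nat (- zorder F z)" if z: "is_pole F z" "cmod z \<le> r" for z
  proof -
    define h where "h w = (\<Prod>a\<in>#filter_mset (\<lambda>a. a \<noteq> z) A. w - a)" for w
    have hh: "h holomorphic_on UNIV" unfolding h_def by (rule holomorphic_prod_mset_linear)
    have hz: "h z \<noteq> 0" unfolding h_def by (subst prod_mset_linear_eq_0_iff) auto
    define S where "S = ball 0 \<rho> - (E \<union> set_mset A - {z})"
    have S: "open S" "z \<in> S" using z r E unfolding S_def by (auto intro!: open_Diff finite_imp_closed)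
    have eqF: "F w = G w / (\<Prod>a\<in>#A. w - a)" "(\<Prod>a\<in>#A. w - a) \<noteq> 0" if "w \<in> S - {z}" for w
    proof -
      show "(\<Prod>a\<in>#A. w - a) \<noteq> 0" using that unfolding S_def by (subst prod_mset_linear_eq_0_iff) auto
      moreover have "w \<in> ball 0 \<rho> - E" using that by (auto simp: S_def)
      ultimately show "F w = G w / (\<Prod>a\<in>#A. w - a)" using FG[of w] by (metis nonzero_mult_div_cancel_right)
    qed
    have "(\<lambda>w. G w / (\<Prod>a\<in>#A. w - a)) holomorphic_on S - {z}"
      by (intro holomorphic_intros holomorphic_on_subset[OF G] eqF) (auto simp: S_def)
    hence "F holomorphic_on S - {z}" by (rule holomorphic_transform) (simp add: eqF)
    from zorder_exist_pole[OF this S z(1)] obtain s where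
      s: "zorder F z < 0" "zor_poly F z z \<noteq> 0" "s > 0" "cball z s \<subseteq> S" "zor_poly F z holomorphic_on cball z s"
      "\<forall>w\<in>cball z s - {z}. F w = zor_poly F z w / (w - z) ^ nat (- zorder F z)"
      by auto
    show "0 < nat (- zorder F z)" using s(1) by simp
    show "nat (- zorder F z) \<le> count A z"
    proof (rule ccontr)
      assume "\<not> ?thesis"
      then obtain d where d: "nat (- zorder F z) = count A z + Suc d"
        by (metis add_Suc_right less_imp_Suc_add not_le)
      have "(\<lambda>w. G w / h w * (w - z) ^ Suc d) \<midarrow>z\<rightarrow> G z / h z * (z - z) ^ Suc d"
      proof (intro tendsto_intros hz)
        show "G \<midarrow>z\<rightarrow> G z" using G z r 
          by (metis analytic_at_imp_isCont holomorphic_on_imp_analytic_at isCont_def mem_ball_0 open_ball order_le_less_trans)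
        show "h \<midarrow>z\<rightarrow> h z" using hh
          by (metis UNIV_I analytic_at_imp_isCont holomorphic_on_imp_analytic_at isCont_def open_UNIV)
      qed
      moreover have "\<forall>\<^sub>F w in at z. G w / h w * (w - z) ^ Suc d = zor_poly F z w"
      proof -
        have "\<forall>\<^sub>F w in at z. w \<in> ball z s - {z}" using s(3) by (intro eventually_at_in_open) auto
        thus ?thesis
        proof eventually_elim
          case (elim w)
          hence w: "w \<in> S - {z}" "w \<in> cball z s - {z}" "w \<noteq> z" using s(4) by auto
          have hw: "(\<Prod>a\<in>#A. w - a) = (w - z) ^ count A z * h w"
            unfolding h_def by (rule prod_mset_linear_split)
          have "h w \<noteq> 0" using eqF(2)[OF w(1)] hw by auto
          have "zor_poly F z w = F w * (w - z) ^ (count A z + Suc d)"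
            using s(6) w by (simp add: d)
          also have "\<dots> = G w / h w * (w - z) ^ Suc d"
            unfolding eqF(1)[OF w(1)] hw using \<open>h w \<noteq> 0\<close> w(3) by (simp add: power_add)
          finally show ?case ..
        qed
      qed
      ultimately have "zor_poly F z \<midarrow>z\<rightarrow> 0" using Lim_transform_eventually by fastforce
      moreover have "zor_poly F z \<midarrow>z\<rightarrow> zor_poly F z z"
        using s(3,5) by (metis analytic_at_imp_isCont ball_subset_cball centre_in_ball holomorphic_on_imp_analytic_at
             holomorphic_on_subset isCont_def open_ball)
      ultimately show False using s(2) by (metis LIM_unique)
    qed
  qed
  define ord where "ord z = nat (- zorder F z)" for z
  define P where "P t = {z. cmod z \<le> t \<and> is_pole F z}" for t
  have PA: "P t \<subseteq> set_mset A" if "t \<le> r" for t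
  proof
    fix z assume "z \<in> P t"
    hence "is_pole F z" "cmod z \<le> r" using that by (auto simp: P_def)
    from order[OF this] have "count A z > 0" by linarith
    thus "z \<in># A" by simp
  qed
  have finP: "finite (P t)" if "t \<le> r" for t using PA[OF that] by (rule finite_subset) auto
  have n_eq: "nev_n F t = (\<Sum>z\<in>P t. real (ord z))" for t by (simp add: nev_n_def P_def ord_def)
  have n0: "nev_n F 0 \<le> count_fun A 0"
  proof -
    have "nev_n F 0 \<le> (\<Sum>z\<in>P 0. real (count A z))" unfolding n_eq
      by (intro sum_mono) (use order r in \<open>auto simp: ord_def P_def\<close>)
    also have "\<dots> \<le> (\<Sum>z\<in>{z\<in>set_mset A. cmod z \<le> 0}. real (count A z))"
      by (intro sum_mono2) (use PA[of 0] r in \<open>auto simp: P_def\<close>)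
    also have "\<dots> = count_fun A 0" unfolding count_fun_def size_multiset_overloaded_eq
      by (simp add: if_distrib sum.If_cases)
    finally show ?thesis .
  qed
  have nt: "nev_n F t - nev_n F 0 \<le> count_fun A t - count_fun A 0" "0 \<le> nev_n F t - nev_n F 0" if t: "0 \<le> t" "t \<le> r" for t
  proof -
    have P0: "P 0 \<subseteq> P t" using t by (auto simp: P_def)
    have d: "nev_n F t - nev_n F 0 = (\<Sum>z\<in>P t - P 0. real (ord z))"
      unfolding n_eq by (subst sum_diff[OF finP[OF t(2)] P0]) simp
    show "0 \<le> nev_n F t - nev_n F 0" unfolding d by (intro sum_nonneg) auto
    have "nev_n F t - nev_n F 0 \<le> (\<Sum>z\<in>P t - P 0. real (count A z))" unfolding d
      by (intro sum_mono) (use order t in \<open>auto simp: ord_def P_def\<close>)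
    also have "\<dots> \<le> (\<Sum>z\<in>{z\<in>set_mset A. cmod z \<le> t} - {z\<in>set_mset A. cmod z \<le> 0}. real (count A z))"
      by (intro sum_mono2) (use PA[OF t(2)] in \<open>auto simp: P_def\<close>)
    also have "\<dots> = (\<Sum>z\<in>{z\<in>set_mset A. cmod z \<le> t}. real (count A z)) - (\<Sum>z\<in>{z\<in>set_mset A. cmod z \<le> 0}. real (count A z))"
      using t by (intro sum_diff) auto
    also have "\<dots> = count_fun A t - count_fun A 0"
    proof -
      have "(\<Sum>z\<in>{z\<in>set_mset A. cmod z \<le> t}. real (count A z)) = count_fun A t" for t
        unfolding count_fun_def size_multiset_overloaded_eq of_nat_sum by (intro sum.cong) auto
      thus ?thesis by (simp only:)
    qed
    finally show "nev_n F t - nev_n F 0 \<le> count_fun A t - count_fun A 0" .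
  qed
  have "integral {0..r} (\<lambda>t. (nev_n F t - nev_n F 0) / t) \<le>
      (\<Sum>a\<in>#A. if a = 0 then 0 else ln (max r (cmod a)) - ln (cmod a))"
  proof (cases "(\<lambda>t. (nev_n F t - nev_n F 0) / t) integrable_on {0..r}")
    case True
    have "integral {0..r} (\<lambda>t. (nev_n F t - nev_n F 0) / t) \<le> integral {0..r} (\<lambda>t. (count_fun A t - count_fun A 0) / t)"
      using True has_integral_count_fun[OF r0, of A] nt by (intro integral_le divide_right_mono) auto
    thus ?thesis using integral_unique[OF has_integral_count_fun[OF r0, of A]] by simp
  next
    case False
    have "0 \<le> (\<Sum>a\<in>#A. if a = 0 then 0 else ln (max r (cmod a)) - ln (cmod a))"
      by (rule has_integral_nonneg[OF has_integral_count_fun[OF r0, of A]])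
         (use nt in \<open>auto intro!: divide_nonneg_nonneg order_trans[OF nt(2) nt(1)]\<close>)
    thus ?thesis using not_integrable_integral[OF False] by simp
  qed
  hence "nev_N F r \<le> (\<Sum>a\<in>#A. if a = 0 then 0 else ln (max r (cmod a)) - ln (cmod a)) + count_fun A 0 * ln r"
    unfolding nev_N_def using n0 r by (intro add_mono mult_right_mono) auto
  hence N: "nev_N F r \<le> (\<Sum>a\<in>#A. ln (max r (cmod a))) - (\<Sum>a\<in>#A. ln (cmod a))"
    using sum_mset_jensen_terms[OF r0] by simp
  have "0 \<le> integral {0..r} (\<lambda>t. (nev_n F t - nev_n F 0) / t)"
    using nt(2)
    by (cases "(\<lambda>t. (nev_n F t - nev_n F 0) / t) integrable_on {0..r}")
       (auto intro!: integral_nonneg divide_nonneg_nonneg simp: not_integrable_integral)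
  moreover have "0 \<le> nev_n F 0 * ln r" using r unfolding nev_n_def by (intro mult_nonneg_nonneg of_nat_0_le_iff ln_ge_zero)
  ultimately have "0 \<le> nev_N F r" by (simp add: nev_N_def)
  thus ?thesis unfolding nev_T_def using m N nev_m_nonneg[of F r] by linarith
qed

text \<open>Every pole with |b| \<le> R contributes at least ln S - ln R to N(S, f), the others at
  least 0; R \<ge> 1 takes care of b = 0, where \<open>ln 0 = 0\<close>. This converts a number of
  poles into a small multiple of the characteristic at a larger radius.\<close>

lemma nev_N_ge:
  assumes mero: "f meromorphic_on UNIV" and R: "1 \<le> R" "R \<le> S"
  shows "real (size (nev_poles f R)) * (ln S - ln R) \<le> nev_N f S"
proof -
  have "size (nev_poles f R) = size (filter_mset (\<lambda>b. cmod b \<le> R) (nev_poles f S))"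
    using R by (intro arg_cong[of _ _ size] multiset_eqI) (auto simp: count_nev_poles[OF mero])
  moreover have "real (size (filter_mset (\<lambda>b. cmod b \<le> R) M)) * (ln S - ln R) \<le>
      (\<Sum>b\<in>#M. ln (max S (cmod b))) - (\<Sum>b\<in>#M. ln (cmod b))" for M
  proof (induction M)
    case (add b M)
    have "ln (cmod b) \<le> ln R" if "cmod b \<le> R"
      using that R by (cases "b = 0") auto
    moreover have "ln (cmod b) \<le> ln (max S (cmod b))" using R by (cases "b = 0") auto
    moreover have "ln S \<le> ln (max S (cmod b))" using R by (subst ln_le_cancel_iff) auto
    ultimately show ?case using add by (auto simp: algebra_simps)
  qed simp
  moreover have "nev_N f S = (\<Sum>b\<in>#nev_poles f S. ln (max S (cmod b))) - (\<Sum>b\<in>#nev_poles f S. ln (cmod b))"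
    by (rule nev_N_eq[OF mero]) (use R in auto)
  ultimately show ?thesis by simp
qed

lemma nev_N_nonneg:
  assumes "f meromorphic_on UNIV" "1 \<le> R"
  shows "nev_N f R \<ge> 0"
  using nev_N_ge[OF assms order_refl] by simp

section \<open>The Askey-Wilson operators in the Joukowski coordinate\<close>

definition joukowski :: "complex \<Rightarrow> complex" where
  "joukowski z = (z + inverse z) / 2"

lemma joukowski_inverse [simp]: "joukowski (inverse z) = joukowski z"
  by (simp add: joukowski_def add.commute)

lemma joukowski_diff:
  assumes "a \<noteq> 0" "b \<noteq> 0"
  shows "joukowski a - joukowski b = (a - b) * (1 - inverse (a * b)) / 2"
  using assms by (simp add: joukowski_def field_simps)

lemma joukowski_eq_iff:
  assumes "a \<noteq> 0" "b \<noteq> 0"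
  shows "joukowski a = joukowski b \<longleftrightarrow> a = b \<or> a = inverse b"
proof -
  have "joukowski a = joukowski b \<longleftrightarrow> joukowski a - joukowski b = 0" by simp
  also have "\<dots> \<longleftrightarrow> a = b \<or> a = inverse b"
  proof -
    have "1 - inverse (a * b) = 0 \<longleftrightarrow> a = inverse b" using assms by (auto simp: field_simps)
    thus ?thesis unfolding joukowski_diff[OF assms] by simp
  qed
  finally show ?thesis .
qed

lemma joukowski_surj:
  obtains z where "z \<noteq> 0" "joukowski z = x"
proof -
  define s where "s = csqrt (x\<^sup>2 - 1)"
  have "(x + s) * (x - s) = 1" by (simp add: s_def algebra_simps flip: power2_eq_square)
  hence "x + s \<noteq> 0" "inverse (x + s) = x - s" by (auto simp: inverse_unique)
  thus ?thesis using that[of "x + s"] by (simp add: joukowski_def)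
qed

text \<open>Justifies the definite description in \<open>aw_z\<close>: the preimages of x are z and
  1/z, of which one lies outside the unit circle unless both lie on it; there 1/z is the conjugate
  of z, and the sign of Im z decides.\<close>

lemma aw_z:
  "joukowski (aw_z x) = x" "cmod (aw_z x) \<ge> 1"
proof -
  define P where "P z \<longleftrightarrow> (z + inverse z) / 2 = x \<and> (cmod z > 1 \<or> (cmod z = 1 \<and> Im z \<ge> 0))" for z
  obtain z where z: "z \<noteq> 0" "joukowski z = x" by (rule joukowski_surj)
  have inv: "inverse w = cnj w" if "cmod w = 1" for w
  proof -
    have "w * cnj w = 1" using that by (simp flip: complex_norm_square)
    thus ?thesis by (rule inverse_unique)
  qed
  have "\<exists>!z. P z"
  proof (rule ex_ex1I)
    consider "P z" | "P (inverse z)" using z inv[of z] joukowski_inverse[of z]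
      by (cases "cmod z > 1"; cases "cmod z < 1"; cases "Im z \<ge> 0")
         (auto simp: P_def joukowski_def norm_inverse one_less_inverse)
    thus "\<exists>z. P z" by cases auto
  next
    fix a b assume ab: "P a" "P b"
    hence "a \<noteq> 0" "b \<noteq> 0" "joukowski a = joukowski b" by (auto simp: P_def joukowski_def)
    hence "a = b \<or> a = inverse b" by (simp add: joukowski_eq_iff)
    moreover have "a = b" if a: "a = inverse b"
    proof -
      have "cmod a * cmod b = 1" using a \<open>b \<noteq> 0\<close> by (simp add: norm_inverse)
      moreover have "cmod a \<ge> 1" "cmod b \<ge> 1" using ab by (auto simp: P_def)
      ultimately have "cmod a = 1" "cmod b = 1"
        by (smt (verit) mult_le_cancel_left1 mult_le_cancel_right1)+
      hence "Im a \<ge> 0" "Im b \<ge> 0" using ab by (auto simp: P_def)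
      moreover have "a = cnj b" using a inv \<open>cmod b = 1\<close> by simp
      ultimately show "a = b" by (simp add: complex_eq_iff)
    qed
    ultimately show "a = b" by blast
  qed
  moreover have "aw_z x = (THE z. P z)" unfolding aw_z_def P_def ..
  ultimately have "P (aw_z x)" by (metis theI')
  thus "joukowski (aw_z x) = x" "cmod (aw_z x) \<ge> 1" by (auto simp: P_def joukowski_def)
qed

lemma aw_z_nonzero [simp]: "aw_z x \<noteq> 0"
  using aw_z(2)[of x] by auto

lemma aw_z_joukowski:
  assumes "z \<noteq> 0"
  shows "aw_z (joukowski z) = z \<or> aw_z (joukowski z) = inverse z"
  using joukowski_eq_iff[OF aw_z_nonzero assms] aw_z(1) by blast

lemma aw_eta_eq: "aw_eta p k f x = f (joukowski (p powi k * aw_z x))"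
  by (simp add: aw_eta_def joukowski_def)

lemma joukowski_dilate_inverse: "joukowski (p powi k * inverse z) = joukowski (p powi (- k) * z)"
proof -
  have "p powi k * inverse z = inverse (p powi (- k) * z)" by (simp add: power_int_minus)
  thus ?thesis by (simp only: joukowski_inverse)
qed

text \<open>Which case occurs depends only on whether \<open>aw_z\<close> returns z or 1/z, not on
  k, so the disjunction stands outside the quantifier. Expressions symmetric in k and -k agree in
  both cases.\<close>

lemma aw_eta_joukowski:
  assumes "z \<noteq> 0"
  shows "(\<forall>k. aw_eta p k f (joukowski z) = f (joukowski (p powi k * z)))
       \<or> (\<forall>k. aw_eta p k f (joukowski z) = f (joukowski (p powi (- k) * z)))"
  using aw_z_joukowski[OF assms] by (auto simp: aw_eta_eq joukowski_dilate_inverse)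

text \<open>Both branches satisfy (z - x)^2 = x^2 - 1, so |z - x| tends to 0 at the branch points
  whichever one is selected.\<close>

lemma isCont_aw_z_branch:
  assumes "x0 = 1 \<or> x0 = -1"
  shows "isCont aw_z x0" "aw_z x0 = x0"
proof -
  have sq: "(aw_z x - x)\<^sup>2 = x\<^sup>2 - 1" for x
  proof -
    have "aw_z x * (2 * x - aw_z x) = 1"
      using aw_z(1)[of x] by (simp add: joukowski_def field_simps)
    thus ?thesis by (simp add: power2_eq_square algebra_simps)
  qed
  have n: "cmod (aw_z x - x) = sqrt (cmod (x\<^sup>2 - 1))" for x
    by (metis norm_ge_zero norm_power real_sqrt_abs2 real_sqrt_power power2_eq_square abs_of_nonneg sq real_sqrt_abs)
  have "x0\<^sup>2 - 1 = 0" using assms by auto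
  hence "cmod (aw_z x0 - x0) = 0" using n[of x0] by simp
  thus eq: "aw_z x0 = x0" by simp
  have "(\<lambda>x. aw_z x - x) \<midarrow>x0\<rightarrow> 0"
  proof (rule tendsto_norm_zero_cancel)
    have "(\<lambda>x. sqrt (cmod (x\<^sup>2 - 1))) \<midarrow>x0\<rightarrow> sqrt (cmod (x0\<^sup>2 - 1))" by (intro tendsto_intros)
    thus "(\<lambda>x. cmod (aw_z x - x)) \<midarrow>x0\<rightarrow> 0" using assms unfolding n by auto
  qed
  hence "(\<lambda>x. (aw_z x - x) + x) \<midarrow>x0\<rightarrow> 0 + x0" by (intro tendsto_intros)
  thus "isCont aw_z x0" unfolding isCont_def eq by simp
qed

section \<open>Descent through the Joukowski map\<close>

lemma holomorphic_joukowski: "joukowski holomorphic_on - {0}"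
  unfolding joukowski_def[abs_def] by (intro holomorphic_intros) auto

lemma continuous_on_joukowski: "continuous_on (- {0}) joukowski"
  by (intro holomorphic_on_imp_continuous_on holomorphic_joukowski)

lemma open_joukowski_vimage:
  assumes "open U"
  shows "open {z. z \<noteq> 0 \<and> joukowski z \<in> U}"
proof -
  have "open (- {0} \<inter> joukowski -` U)"
    by (rule continuous_open_preimage[OF continuous_on_joukowski _ assms]) auto
  moreover have "- {0} \<inter> joukowski -` U = {z. z \<noteq> 0 \<and> joukowski z \<in> U}" by auto
  ultimately show ?thesis by simp
qed

text \<open>Although aw_z jumps across [-1, 1], a symmetric function of it is holomorphic: locally aw_z is one of
  the two holomorphic branches x + s, x - s with s^2 = x^2 - 1, and the points 1 and -1 are removable.\<close>

lemma joukowski_descent: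
  assumes U: "open U" and \<Phi>: "\<Phi> holomorphic_on {z. z \<noteq> 0 \<and> joukowski z \<in> U}"
    and sym: "\<And>z. z \<noteq> 0 \<Longrightarrow> joukowski z \<in> U \<Longrightarrow> \<Phi> (inverse z) = \<Phi> z"
  shows "(\<lambda>x. \<Phi> (aw_z x)) holomorphic_on U"
    and "\<And>z. z \<noteq> 0 \<Longrightarrow> joukowski z \<in> U \<Longrightarrow> \<Phi> (aw_z (joukowski z)) = \<Phi> z"
proof -
  let ?D = "{z. z \<noteq> 0 \<and> joukowski z \<in> U}"
  have D: "open ?D" by (rule open_joukowski_vimage[OF U])
  show descend: "\<Phi> (aw_z (joukowski z)) = \<Phi> z" if "z \<noteq> 0" "joukowski z \<in> U" for z
    using aw_z_joukowski[OF that(1)] sym[OF that] by auto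
  have regular: "(\<lambda>x. \<Phi> (aw_z x)) analytic_on {x0}" if x0: "x0 \<in> U" "x0 \<noteq> 1" "x0 \<noteq> -1" for x0
  proof -
    define c where "c = x0\<^sup>2 - 1"
    have c: "c \<noteq> 0" using x0 by (simp add: c_def power2_eq_1_iff)
    \<comment> \<open>Dividing by c places the argument of the square root at 1 when x = x0, away
      from the cut of \<open>csqrt\<close>.\<close>
    define s where "s x = csqrt c * csqrt ((x\<^sup>2 - 1) / c)" for x
    define V where "V = U \<inter> (\<lambda>x. (x\<^sup>2 - 1) / c) -` (- \<real>\<^sub>\<le>\<^sub>0)"
    have V: "open V" unfolding V_def
      by (intro open_Int U open_vimage) (auto intro!: continuous_intros simp: c)
    have x0V: "x0 \<in> V" using x0 c by (simp add: V_def flip: c_def)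
    have s: "s holomorphic_on V" unfolding s_def
      by (intro holomorphic_intros holomorphic_on_compose_gen[OF _ holomorphic_on_csqrt, unfolded o_def])
         (auto simp: V_def c)
    have s2: "(x + s x) * (x - s x) = 1" for x
    proof -
      have "(s x)\<^sup>2 = x\<^sup>2 - 1" using c by (simp add: s_def power_mult_distrib)
      thus ?thesis by (simp add: power2_eq_square algebra_simps)
    qed
    have z1: "x + s x \<noteq> 0" "joukowski (x + s x) = x" for x
    proof -
      show "x + s x \<noteq> 0" using s2[of x] by auto
      have "inverse (x + s x) = x - s x" using s2[of x] by (rule inverse_unique)
      thus "joukowski (x + s x) = x" by (simp add: joukowski_def)
    qed
    have "(\<lambda>x. x + s x) holomorphic_on V" by (intro holomorphic_intros s)
    hence "(\<lambda>x. \<Phi> (x + s x)) holomorphic_on V"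
      by (rule holomorphic_on_compose_gen[OF _ \<Phi>, unfolded o_def])
         (use z1 in \<open>auto simp: V_def\<close>)
    moreover have "\<Phi> (x + s x) = \<Phi> (aw_z x)" if "x \<in> V" for x
      using descend[of "x + s x"] z1[of x] that by (simp add: V_def)
    ultimately have "(\<lambda>x. \<Phi> (aw_z x)) holomorphic_on V" by (rule holomorphic_transform)
    thus ?thesis using V x0V holomorphic_on_imp_analytic_at by blast
  qed
  show "(\<lambda>x. \<Phi> (aw_z x)) holomorphic_on U"
  proof (rule no_isolated_singularity[of U _ "{1, -1}"])
    show "(\<lambda>x. \<Phi> (aw_z x)) holomorphic_on U - {1, - 1}"
      by (rule analytic_imp_holomorphic) (use regular in \<open>auto simp: analytic_on_analytic_at[of _ "U - _"]\<close>)
    have "isCont (\<lambda>x. \<Phi> (aw_z x)) x" if x: "x \<in> U" for x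
    proof (cases "x = 1 \<or> x = -1")
      case True
      have "x \<in> ?D" using True x by (auto simp: joukowski_def)
      hence "isCont \<Phi> x" by (rule analytic_at_imp_isCont[OF holomorphic_on_imp_analytic_at[OF \<Phi> D]])
      hence "isCont \<Phi> (aw_z x)" using isCont_aw_z_branch(2)[OF True] by simp
      with isCont_aw_z_branch(1)[OF True] show ?thesis by (rule isCont_o2)
    next
      case False
      thus ?thesis using regular[OF x] analytic_at_imp_isCont by blast
    qed
    thus "continuous_on U (\<lambda>x. \<Phi> (aw_z x))" by (simp add: continuous_at_imp_continuous_on)
  qed (use U in auto)
qed

text \<open>The product on the left is thus a polynomial in the joukowski coordinate of z.\<close>

lemma prod_joukowski_dilate:
  fixes N :: nat
  assumes p: "p \<noteq> 0" and \<beta>: "\<beta> \<noteq> 0" and z: "z \<noteq> 0"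
    and m: "\<And>i. i \<le> N \<Longrightarrow> m (N - i) = - (m i :: int)"
  shows "(\<Prod>i\<le>N. joukowski (p powi m i * z) - joukowski \<beta>) = (\<Prod>i\<le>N. joukowski z - joukowski (p powi m i * \<beta>))"
proof -
  have rev: "(\<Prod>i\<le>N. g (m i)) = (\<Prod>i\<le>N. g (- m i))" for g :: "int \<Rightarrow> complex"
  proof -
    have "(\<Prod>i\<le>N. g (m i)) = (\<Prod>i\<le>N. g (m (N - i)))"
      by (rule prod.reindex_bij_witness[of _ "\<lambda>i. N - i" "\<lambda>i. N - i"]) auto
    also have "\<dots> = (\<Prod>i\<le>N. g (- m i))" by (intro prod.cong) (auto simp: m)
    finally show ?thesis .
  qed
  \<comment> \<open>The exponents sum to 0, so the powers of p pulled out of the factors multiply to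
    1.\<close>
  have "(\<Sum>i\<le>N. m i) = (\<Sum>i\<le>N. m (N - i))"
    by (rule sum.reindex_bij_witness[of _ "\<lambda>i. N - i" "\<lambda>i. N - i"]) auto
  also have "\<dots> = - (\<Sum>i\<le>N. m i)" unfolding sum_negf[symmetric] by (intro sum.cong) (auto simp: m)
  finally have "(\<Sum>i\<le>N. m i) = 0" by simp
  moreover have "(\<Prod>i\<le>k. p powi m i) = p powi (\<Sum>i\<le>k. m i)" for k
    using p by (induction k) (auto simp: power_int_add)
  ultimately have one: "(\<Prod>i\<le>N. p powi m i) = 1" by simp
  have "(\<Prod>i\<le>N. joukowski (p powi m i * z) - joukowski \<beta>) =
     (\<Prod>i\<le>N. p powi m i * ((z - p powi (- m i) * \<beta>) * ((1 - inverse (p powi m i * z * \<beta>)) / 2)))"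
  proof (intro prod.cong refl)
    fix i
    have "p powi m i \<noteq> 0" using p by simp
    thus "joukowski (p powi m i * z) - joukowski \<beta> =
        p powi m i * ((z - p powi (- m i) * \<beta>) * ((1 - inverse (p powi m i * z * \<beta>)) / 2))"
      using z \<beta> by (subst joukowski_diff) (auto simp: power_int_minus field_simps)
  qed
  also have "\<dots> = (\<Prod>i\<le>N. z - p powi (- m i) * \<beta>) * (\<Prod>i\<le>N. (1 - inverse (p powi m i * z * \<beta>)) / 2)"
    by (simp only: prod.distrib one mult_1_left)
  \<comment> \<open>Only the first product is reversed; afterwards both products carry the same
    exponent at index i, and the factors recombine in pairs into differences of
    \<open>joukowski\<close> values.\<close>
  also have "(\<Prod>i\<le>N. z - p powi (- m i) * \<beta>) = (\<Prod>i\<le>N. z - p powi (m i) * \<beta>)"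
    by (rule rev[of "\<lambda>k. z - p powi k * \<beta>", symmetric])
  also have "\<dots> * (\<Prod>i\<le>N. (1 - inverse (p powi m i * z * \<beta>)) / 2) = 
      (\<Prod>i\<le>N. joukowski z - joukowski (p powi m i * \<beta>))"
    unfolding prod.distrib[symmetric] using p z \<beta>
    by (intro prod.cong refl) (subst joukowski_diff, auto simp: mult_ac)
  finally show ?thesis .
qed

text \<open>These are exactly the Laurent polynomials in z, described by growth: the estimate needs
  only sizes, and |z| + 1/|z| is at most 2(|x| + 1) for x = \<open>joukowski z\<close>.\<close>

definition laurent_bounded :: "(complex \<Rightarrow> complex) \<Rightarrow> bool" where
  "laurent_bounded c \<longleftrightarrow> c holomorphic_on - {0} \<and>
     (\<exists>K M. \<forall>z. z \<noteq> 0 \<longrightarrow> cmod (c z) \<le> K * (cmod z + inverse (cmod z)) ^ M)"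

lemma norm_plus_inverse_ge_1:
  assumes "z \<noteq> 0"
  shows "cmod z + inverse (cmod z) \<ge> 1"
proof (cases "cmod z \<ge> 1")
  case False
  hence "inverse (cmod z) \<ge> 1" using assms by (intro one_le_inverse) auto
  thus ?thesis by (simp add: add.commute add_increasing)
qed (simp add: add_increasing2)

lemma laurent_boundedI:
  assumes "c holomorphic_on - {0}" "\<And>z. z \<noteq> 0 \<Longrightarrow> cmod (c z) \<le> K * (cmod z + inverse (cmod z)) ^ M"
  shows "laurent_bounded c"
  using assms unfolding laurent_bounded_def by blast

lemma laurent_boundedE:
  assumes "laurent_bounded c"
  obtains K M where "K \<ge> 0" "\<And>z. z \<noteq> 0 \<Longrightarrow> cmod (c z) \<le> K * (cmod z + inverse (cmod z)) ^ M"
proof -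
  from assms obtain K M where KM: "\<And>z. z \<noteq> 0 \<Longrightarrow> cmod (c z) \<le> K * (cmod z + inverse (cmod z)) ^ M"
    unfolding laurent_bounded_def by blast
  have "0 \<le> K * 2 ^ M" using order_trans[OF norm_ge_zero KM[of 1]] by simp
  hence "K \<ge> 0" by (smt (verit) mult_neg_pos zero_less_power)
  thus ?thesis using that KM by blast
qed

lemma laurent_bounded_const [intro]: "laurent_bounded (\<lambda>z. a)"
  by (rule laurent_boundedI[of _ "cmod a" 0]) auto

lemma laurent_bounded_id [intro]: "laurent_bounded (\<lambda>z. z)"
  by (rule laurent_boundedI[of _ 1 1]) auto

lemma laurent_bounded_inverse [intro]: "laurent_bounded inverse"
  by (rule laurent_boundedI[of _ 1 1]) (auto intro!: holomorphic_intros simp: norm_inverse)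

lemma laurent_bounded_mult [intro]:
  assumes c: "laurent_bounded c" and d: "laurent_bounded d"
  shows "laurent_bounded (\<lambda>z. c z * d z)"
proof -
  obtain K M where K: "K \<ge> 0" "\<And>z. z \<noteq> 0 \<Longrightarrow> cmod (c z) \<le> K * (cmod z + inverse (cmod z)) ^ M"
    using laurent_boundedE[OF c] by blast
  obtain L P where L: "L \<ge> 0" "\<And>z. z \<noteq> 0 \<Longrightarrow> cmod (d z) \<le> L * (cmod z + inverse (cmod z)) ^ P"
    using laurent_boundedE[OF d] by blast
  show ?thesis
  proof (rule laurent_boundedI)
    show "(\<lambda>z. c z * d z) holomorphic_on - {0}"
      using c d by (auto simp: laurent_bounded_def intro: holomorphic_on_mult)
    show "cmod (c z * d z) \<le> (K * L) * (cmod z + inverse (cmod z)) ^ (M + P)" if "z \<noteq> 0" for z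
      using mult_mono[OF K(2)[OF that] L(2)[OF that]] K(1) by (simp add: norm_mult power_add mult_ac)
  qed
qed

lemma laurent_bounded_add [intro]:
  assumes c: "laurent_bounded c" and d: "laurent_bounded d"
  shows "laurent_bounded (\<lambda>z. c z + d z)"
proof -
  obtain K M where K: "K \<ge> 0" "\<And>z. z \<noteq> 0 \<Longrightarrow> cmod (c z) \<le> K * (cmod z + inverse (cmod z)) ^ M"
    using laurent_boundedE[OF c] by blast
  obtain L P where L: "L \<ge> 0" "\<And>z. z \<noteq> 0 \<Longrightarrow> cmod (d z) \<le> L * (cmod z + inverse (cmod z)) ^ P"
    using laurent_boundedE[OF d] by blast
  show ?thesis
  proof (rule laurent_boundedI)
    show "(\<lambda>z. c z + d z) holomorphic_on - {0}"
      using c d by (auto simp: laurent_bounded_def intro: holomorphic_on_add)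
    show "cmod (c z + d z) \<le> (K + L) * (cmod z + inverse (cmod z)) ^ (M + P)" if "z \<noteq> 0" for z
    proof -
      let ?t = "cmod z + inverse (cmod z)"
      have "?t \<ge> 1" by (rule norm_plus_inverse_ge_1[OF that])
      hence "K * ?t ^ M \<le> K * ?t ^ (M + P)" "L * ?t ^ P \<le> L * ?t ^ (M + P)"
        using K(1) L(1) by (auto intro!: mult_left_mono power_increasing)
      thus ?thesis using K(2)[OF that] L(2)[OF that] norm_triangle_ineq[of "c z" "d z"]
        by (simp add: distrib_right)
    qed
  qed
qed

lemma laurent_bounded_diff [intro]:
  assumes "laurent_bounded c" "laurent_bounded d"
  shows "laurent_bounded (\<lambda>z. c z - d z)"
  using laurent_bounded_add[OF assms(1) laurent_bounded_mult[OF laurent_bounded_const[of "-1"] assms(2)]] by simp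

lemma laurent_bounded_dilate [intro]:
  assumes c: "laurent_bounded c" and p: "p \<noteq> 0"
  shows "laurent_bounded (\<lambda>z. c (p * z))"
proof -
  obtain K M where K: "K \<ge> 0" "\<And>z. z \<noteq> 0 \<Longrightarrow> cmod (c z) \<le> K * (cmod z + inverse (cmod z)) ^ M"
    using laurent_boundedE[OF c] by blast
  define s where "s = cmod p + inverse (cmod p)"
  show ?thesis
  proof (rule laurent_boundedI)
    have "(c \<circ> (*) p) holomorphic_on - {0}"
      by (rule holomorphic_on_compose_gen) (use c p in \<open>auto simp: laurent_bounded_def intro!: holomorphic_intros\<close>)
    thus "(\<lambda>z. c (p * z)) holomorphic_on - {0}" by (simp add: o_def)
    show "cmod (c (p * z)) \<le> (K * s ^ M) * (cmod z + inverse (cmod z)) ^ M" if "z \<noteq> 0" for z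
    proof -
      have "cmod (c (p * z)) \<le> K * (cmod (p * z) + inverse (cmod (p * z))) ^ M" using that p by (intro K) auto
      also have "cmod (p * z) + inverse (cmod (p * z)) \<le> s * (cmod z + inverse (cmod z))"
        unfolding s_def by (simp add: norm_mult algebra_simps)
      hence "K * (cmod (p * z) + inverse (cmod (p * z))) ^ M \<le> K * (s * (cmod z + inverse (cmod z))) ^ M"
        using K(1) by (intro mult_left_mono power_mono) auto
      finally show ?thesis by (simp add: power_mult_distrib mult.assoc)
    qed
  qed
qed

lemma laurent_bounded_prod_mset:
  assumes "p \<noteq> 0"
  shows "laurent_bounded (\<lambda>z. \<Prod>d\<in>#ds. joukowski (p * z) - d)"
proof -
  have "laurent_bounded joukowski"
    using laurent_bounded_mult[OF laurent_bounded_add[OF laurent_bounded_id laurent_bounded_inverse] laurent_bounded_const[of "1/2"]]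
    by (simp add: joukowski_def[abs_def])
  hence "laurent_bounded (\<lambda>z. joukowski (p * z) - d)" for d using assms by (intro laurent_bounded_diff) auto
  thus ?thesis by (induction ds) auto
qed

section \<open>Iterates of the Askey-Wilson operator\<close>

lemma joukowski_dilate_pm1_diff:
  assumes "p \<noteq> 0" "z \<noteq> 0"
  shows "joukowski (p * z) - joukowski (z / p) = (p - inverse p) * (z - inverse z) / 2"
  using assms by (simp add: joukowski_def field_simps)

text \<open>Exchanging z and 1/z swaps the two shifts, which changes the sign of both numerator and
  denominator; the quotient therefore does not depend on the branch taken by
  \<open>aw_z\<close>.\<close>

lemma aw_D_joukowski:
  assumes p: "p \<noteq> 0" and z: "z \<noteq> 0" "z \<noteq> 1" "z \<noteq> -1"
  shows "aw_D p F (joukowski z) =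
    (F (joukowski (p * z)) - F (joukowski (z / p))) / (joukowski (p * z) - joukowski (z / p))"
proof -
  have "joukowski z \<noteq> joukowski 1" "joukowski z \<noteq> joukowski (-1)"
    using z by (subst joukowski_eq_iff; simp)+
  hence "joukowski z \<noteq> 1" "joukowski z \<noteq> -1" by (auto simp: joukowski_def)
  hence D: "aw_D p F (joukowski z) = (aw_eta p 1 F (joukowski z) - aw_eta p (-1) F (joukowski z)) /
     (aw_eta p 1 id (joukowski z) - aw_eta p (-1) id (joukowski z))"
    by (simp add: aw_D_def aw_quot_def)
  have 1: "joukowski (p powi (-1) * z) = joukowski (z / p)" by (simp add: power_int_minus field_simps)
  show ?thesis
  proof (cases "aw_z (joukowski z) = z")
    case True
    thus ?thesis unfolding D aw_eta_eq using 1 by simp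
  next
    case False
    hence "aw_z (joukowski z) = inverse z" using aw_z_joukowski[OF z(1)] by auto
    hence "aw_eta p k G (joukowski z) = G (joukowski (p powi (-k) * z))" for k and G :: "complex \<Rightarrow> complex"
      by (simp add: aw_eta_eq joukowski_dilate_inverse)
    moreover have "(b - a) / (d - c) = (a - b) / (c - d)" for a b c d :: complex
      using minus_divide_divide[of "a - b" "c - d"] by simp
    ultimately show ?thesis unfolding D using 1 by simp
  qed
qed

text \<open>The symmetric exponents 1 and -1. It shows that the product of a denominator at p z and
  at z / p is again a polynomial in the coordinate x, so denominators keep their shape under
  iteration.\<close>

lemma prod_mset_dilate_pair:
  assumes p: "p \<noteq> 0" and z: "z \<noteq> 0"
  shows "(\<Prod>d\<in>#ds. joukowski (p * z) - d) * (\<Prod>d\<in>#ds. joukowski (z / p) - d) =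
     (\<Prod>d\<in>#(\<Sum>d\<in>#ds. {#joukowski (p * aw_z d), joukowski (aw_z d / p)#}). joukowski z - d)"
proof (induction ds)
  case (add d ds)
  have "(joukowski (p * z) - d) * (joukowski (z / p) - d) =
      (joukowski z - joukowski (p * aw_z d)) * (joukowski z - joukowski (aw_z d / p))"
  proof -
    define m :: "nat \<Rightarrow> int" where "m i = (if i = 0 then 1 else -1)" for i
    have two: "(\<Prod>i\<le>1. h i) = h 0 * h 1" for h :: "nat \<Rightarrow> complex" by simp
    have "m (1 - i) = - m i" if "i \<le> 1" for i using that by (cases "i = 0") (auto simp: m_def)
    from prod_joukowski_dilate[OF p aw_z_nonzero[of d] z, of 1 m, OF this]
    show ?thesis unfolding two aw_z m_def by (simp add: power_int_minus divide_inverse mult.commute)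
  qed
  hence "((joukowski (p * z) - d) * (joukowski (z / p) - d)) *
      ((\<Prod>d\<in>#ds. joukowski (p * z) - d) * (\<Prod>d\<in>#ds. joukowski (z / p) - d)) =
      ((joukowski z - joukowski (p * aw_z d)) * (joukowski z - joukowski (aw_z d / p))) *
      (\<Prod>d\<in>#(\<Sum>d\<in>#ds. {#joukowski (p * aw_z d), joukowski (aw_z d / p)#}). joukowski z - d)"
    unfolding add.IH by (simp only:)
  thus ?case by (simp add: mult_ac)
qed simp

text \<open>One more application replaces z by p z and by z / p, so the n + 1 exponents n - 2k move
  by 1 and by -1 and become n + 2 in number. The denominator stays a polynomial in x, whereas the
  individual coefficients are functions of z only.\<close>

lemma aw_D_power_representation:
  assumes p: "p \<noteq> 0" "p\<^sup>2 \<noteq> 1"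
  shows "\<exists>ds C Z. finite Z \<and> (\<forall>k. laurent_bounded (C k)) \<and>
    (\<forall>z. z \<noteq> 0 \<and> z \<notin> Z \<longrightarrow> (\<Prod>d\<in>#ds. joukowski z - d) * (aw_D p ^^ n) f (joukowski z) =
        (\<Sum>k\<le>n. C k z * f (joukowski (p powi (int n - 2 * int k) * z))))"
proof (induction n)
  case 0
  show ?case
    by (rule exI[of _ "{#}"], rule exI[of _ "\<lambda>_ _. 1"], rule exI[of _ "{}"]) auto
next
  case (Suc n)
  then obtain ds C Z where Z: "finite Z" and C: "\<And>k. laurent_bounded (C k)" and
    eq: "\<And>z. z \<noteq> 0 \<Longrightarrow> z \<notin> Z \<Longrightarrow> (\<Prod>d\<in>#ds. joukowski z - d) * (aw_D p ^^ n) f (joukowski z) =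
        (\<Sum>k\<le>n. C k z * f (joukowski (p powi (int n - 2 * int k) * z)))" by blast
  define P1 where "P1 z = (\<Prod>d\<in>#ds. joukowski (p * z) - d)" for z
  define P2 where "P2 z = (\<Prod>d\<in>#ds. joukowski (inverse p * z) - d)" for z
  define ds' where "ds' = {#1, -1#} + (\<Sum>d\<in>#ds. {#joukowski (p * aw_z d), joukowski (aw_z d / p)#})"
  \<comment> \<open>Chosen so that c z times the denominator (p - 1/p)(z - 1/z)/2 of the operator is
    x^2 - 1; this accounts for the new roots 1 and -1 in \<open>ds'\<close>.\<close>
  define c where "c z = (z - inverse z) * (1 / (2 * (p - inverse p)))" for z
  define C1 where "C1 k z = c z * (P2 z * C k (p * z))" for k z
  define C2 where "C2 k z = c z * (P1 z * C k (inverse p * z))" for k z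
  \<comment> \<open>\<open>C1 k\<close> belongs to the exponent n + 1 - 2k and \<open>C2 k\<close>
    to n + 1 - 2(k + 1), hence the index shift and the two boundary cases.\<close>
  define C' where "C' k z = (if k \<le> n then C1 k z else 0) - (if k = 0 then 0 else C2 (k - 1) z)" for k z
  \<comment> \<open>The branch points, and the z for which p z or z / p falls into Z.\<close>
  define Z' where "Z' = {1, -1} \<union> (\<lambda>w. w / p) ` Z \<union> (\<lambda>w. p * w) ` Z"
  have pp: "p - inverse p \<noteq> 0" using p by (auto simp: field_simps power2_eq_square)
  have lc: "laurent_bounded c" unfolding c_def
    by (intro laurent_bounded_mult laurent_bounded_diff laurent_bounded_id laurent_bounded_inverse laurent_bounded_const)
  have "laurent_bounded (C1 k)" "laurent_bounded (C2 k)" for k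
    unfolding C1_def C2_def P1_def P2_def using p
    by (auto intro!: laurent_bounded_mult lc laurent_bounded_prod_mset laurent_bounded_dilate C)
  hence "laurent_bounded (\<lambda>z. if k \<le> n then C1 k z else 0)"
      "laurent_bounded (\<lambda>z. if k = 0 then 0 else C2 (k - 1) z)" for k
    by (cases "k \<le> n"; cases "k = 0"; auto)+
  hence "laurent_bounded (C' k)" for k unfolding C'_def by (intro laurent_bounded_diff)
  moreover have "finite Z'" using Z by (simp add: Z'_def)
  moreover have "(\<Prod>d\<in>#ds'. joukowski z - d) * (aw_D p ^^ Suc n) f (joukowski z) =
        (\<Sum>k\<le>Suc n. C' k z * f (joukowski (p powi (int (Suc n) - 2 * int k) * z)))" if z: "z \<noteq> 0" "z \<notin> Z'" for z
  proof -
    define F where "F = (aw_D p ^^ n) f"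
    have z1: "z \<noteq> 1" "z \<noteq> -1" using z by (auto simp: Z'_def)
    have zZ: "p * z \<notin> Z" "inverse p * z \<notin> Z"
    proof -
      show "p * z \<notin> Z"
      proof
        assume "p * z \<in> Z"
        hence "(p * z) / p \<in> Z'" unfolding Z'_def by blast
        thus False using p z by simp
      qed
      show "inverse p * z \<notin> Z"
      proof
        assume "inverse p * z \<in> Z"
        hence "p * (inverse p * z) \<in> Z'" unfolding Z'_def by blast
        thus False using p z by (simp flip: mult.assoc)
      qed
    qed
    have F1: "P1 z * F (joukowski (p * z)) = (\<Sum>k\<le>n. C k (p * z) * f (joukowski (p powi (int (Suc n) - 2 * int k) * z)))"
    proof -
      have "p powi (int (Suc n) - 2 * int k) = p powi (int n - 2 * int k) * p" for k
        using p power_int_add_1[of p "int n - 2 * int k"] by (simp add: algebra_simps)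
      thus ?thesis using eq[of "p * z"] z zZ p by (simp add: F_def P1_def mult.assoc)
    qed
    have F2: "P2 z * F (joukowski (inverse p * z)) = (\<Sum>k\<le>n. C k (inverse p * z) * f (joukowski (p powi (int (Suc n) - 2 * int (Suc k)) * z)))"
    proof -
      have "p powi (int (Suc n) - 2 * int (Suc k)) = p powi (int n - 2 * int k) * inverse p" for k
        using p power_int_diff[of p "int n - 2 * int k" 1] by (simp add: algebra_simps divide_inverse)
      thus ?thesis using eq[of "inverse p * z"] z zZ p by (simp add: F_def P2_def mult.assoc)
    qed
    define X where "X = joukowski (p * z) - joukowski (z / p)"
    have X: "X = (p - inverse p) * (z - inverse z) / 2" unfolding X_def by (rule joukowski_dilate_pm1_diff) (use p z in auto)
    have zz: "z - inverse z \<noteq> 0"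
    proof
      assume "z - inverse z = 0"
      hence "z * z = 1" using z by (simp add: field_simps)
      thus False using z1 by (simp add: square_eq_1_iff)
    qed
    have X0: "X \<noteq> 0" using pp zz unfolding X by (simp only: divide_eq_0_iff mult_eq_0_iff) simp
    have xx: "(joukowski z - 1) * (joukowski z - (-1)) = c z * X"
      unfolding X c_def using pp z by (simp add: joukowski_def divide_simps) (simp add: algebra_simps power2_eq_square)
    have zp: "inverse p * z = z / p" by (simp add: field_simps)
    have ds': "(\<Prod>d\<in>#ds'. joukowski z - d) = c z * X * (P1 z * P2 z)"
      unfolding ds'_def P1_def P2_def zp prod_mset_dilate_pair[OF p(1) z(1)] using xx by (simp add: mult.assoc)
    have Dn: "(aw_D p ^^ Suc n) f (joukowski z) = (F (joukowski (p * z)) - F (joukowski (z / p))) / X"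
      unfolding X_def F_def using aw_D_joukowski[OF p(1) z(1) z1] by simp
    have "(\<Prod>d\<in>#ds'. joukowski z - d) * (aw_D p ^^ Suc n) f (joukowski z) =
        c z * (P2 z * (P1 z * F (joukowski (p * z)))) - c z * (P1 z * (P2 z * F (joukowski (z / p))))"
    proof -
      have "t * X * (u * v) * ((a - b) / X) = t * (v * (u * a)) - t * (u * (v * b))" for t u v a b
        using X0 by (simp add: field_simps)
      thus ?thesis unfolding ds' Dn .
    qed
    also have "\<dots> = (\<Sum>k\<le>n. C1 k z * f (joukowski (p powi (int (Suc n) - 2 * int k) * z))) -
        (\<Sum>k\<le>n. C2 k z * f (joukowski (p powi (int (Suc n) - 2 * int (Suc k)) * z)))"
      unfolding F1 F2[unfolded zp] C1_def C2_def zp by (simp add: sum_distrib_left mult.assoc)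
    also have "(\<Sum>k\<le>n. C1 k z * f (joukowski (p powi (int (Suc n) - 2 * int k) * z))) =
        (\<Sum>k\<le>Suc n. (if k \<le> n then C1 k z else 0) * f (joukowski (p powi (int (Suc n) - 2 * int k) * z)))"
      by simp
    also have "(\<Sum>k\<le>n. C2 k z * f (joukowski (p powi (int (Suc n) - 2 * int (Suc k)) * z))) =
        (\<Sum>k\<le>Suc n. (if k = 0 then 0 else C2 (k - 1) z) * f (joukowski (p powi (int (Suc n) - 2 * int k) * z)))"
      unfolding sum.atMost_Suc_shift by simp
    finally show ?thesis unfolding C'_def by (simp only: left_diff_distrib sum_subtractf)
  qed
  ultimately show ?case by blast
qed

section \<open>The main estimate\<close>

lemma joukowski_conv_inverse: "2 * joukowski w - inverse w = w"
  by (simp add: joukowski_def add_divide_distrib)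

lemma norm_plus_inverse_le_joukowski:
  assumes z: "z \<noteq> 0"
  shows "cmod z + inverse (cmod z) \<le> 2 * (cmod (joukowski z) + 1)"
proof -
  have ge1: "cmod w + inverse (cmod w) \<le> 2 * (cmod (joukowski w) + 1)" if "cmod w \<ge> 1" for w
  proof -
    have i: "inverse (cmod w) \<le> 1" using that by (intro inverse_le_1_iff[THEN iffD2]) auto
    have "w = 2 * joukowski w - inverse w" by (rule joukowski_conv_inverse[symmetric])
    hence "cmod w \<le> cmod (2 * joukowski w) + cmod (inverse w)" by (metis norm_triangle_ineq4)
    thus ?thesis using i by (simp add: norm_mult norm_inverse)
  qed
  show ?thesis
  proof (cases "cmod z \<ge> 1")
    case False
    hence "cmod (inverse z) \<ge> 1" using z by (auto simp: norm_inverse intro!: one_le_inverse)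
    from ge1[OF this] show ?thesis by (simp add: norm_inverse add.commute)
  qed (rule ge1)
qed

lemma norm_joukowski_dilate_le:
  assumes z: "z \<noteq> 0"
  shows "cmod (joukowski (P * z)) \<le> (cmod P + inverse (cmod P)) * (cmod (joukowski z) + 1)"
proof -
  have "2 * cmod (joukowski (P * z)) = cmod (P * z + inverse (P * z))"
    by (simp add: joukowski_def norm_divide)
  also have "\<dots> \<le> cmod (P * z) + cmod (inverse (P * z))" by (rule norm_triangle_ineq)
  also have "\<dots> \<le> (cmod P + inverse (cmod P)) * (cmod z + inverse (cmod z))"
    by (simp add: norm_mult norm_inverse algebra_simps)
  also have "\<dots> \<le> (cmod P + inverse (cmod P)) * (2 * (cmod (joukowski z) + 1))"
    by (intro mult_left_mono norm_plus_inverse_le_joukowski z) auto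
  also have "\<dots> = 2 * ((cmod P + inverse (cmod P)) * (cmod (joukowski z) + 1))"
    by (rule mult.left_commute)
  finally show "cmod (joukowski (P * z)) \<le> (cmod P + inverse (cmod P)) * (cmod (joukowski z) + 1)"
    by (rule mult_left_le_imp_le) simp
qed

text \<open>For large b a shift multiplies |b| by a factor bounded below. Elsewhere the difference
  may be large, since the shifted point can come close to 0, but only finitely many poles are
  concerned. So C depends on f and P but not on the disc considered later.\<close>

lemma ln_joukowski_dilate_pole_bound:
  assumes mero: "f meromorphic_on UNIV" and P: "P \<noteq> 0"
  obtains C where "C \<ge> 0" "\<And>b. is_pole f b \<Longrightarrow> ln (cmod b) - ln (cmod (joukowski (P * aw_z b))) \<le> C"
proof -
  \<comment> \<open>Beyond this radius w = P \<open>aw_z b\<close> has |w| \<ge> 2, so 1/w is at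
    most half as large as w and cannot cancel it.\<close>
  define b0 where "b0 = 2 / cmod P"
  have b0: "b0 > 0" using P by (simp add: b0_def)
  define \<delta> where "\<delta> b = ln (cmod b) - ln (cmod (joukowski (P * aw_z b)))" for b
  have far: "\<delta> b \<le> - ln (cmod P / 4)" if b: "cmod b \<ge> b0" for b
  proof -
    have "2 * b = aw_z b + inverse (aw_z b)" using aw_z(1)[of b] by (simp add: joukowski_def)
    hence "2 * cmod b \<le> cmod (aw_z b) + cmod (inverse (aw_z b))"
      by (metis norm_mult norm_numeral norm_triangle_ineq)
    also have "cmod (inverse (aw_z b)) \<le> 1" using aw_z(2)[of b] by (simp add: norm_inverse inverse_le_1_iff)
    finally have b1: "cmod b \<le> cmod (aw_z b)" using aw_z(2)[of b] by simp
    define w where "w = P * aw_z b"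
    have w2: "cmod w \<ge> cmod P * cmod b" using b1 P by (simp add: w_def norm_mult)
    have "cmod P * b0 = 2" using P by (simp add: b0_def)
    hence w: "cmod w \<ge> 2" using w2 b P by (smt (verit) mult_left_mono norm_ge_zero)
    have "w = 2 * joukowski w - inverse w" by (rule joukowski_conv_inverse[symmetric])
    hence "cmod w \<le> cmod (2 * joukowski w) + cmod (inverse w)" by (metis norm_triangle_ineq4)
    moreover have "cmod (inverse w) \<le> 1" using w by (simp add: norm_inverse inverse_le_1_iff)
    ultimately have "cmod w / 4 \<le> cmod (joukowski w)" using w by (simp add: norm_mult)
    hence "cmod P / 4 * cmod b \<le> cmod (joukowski w)" using w2 by simp
    moreover have "cmod P / 4 * cmod b > 0" using P b b0 by (intro mult_pos_pos) auto
    ultimately have "ln (cmod P / 4 * cmod b) \<le> ln (cmod (joukowski w))" by (intro ln_mono) auto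
    moreover have "ln (cmod P / 4 * cmod b) = ln (cmod P / 4) + ln (cmod b)"
      using P b b0 by (subst ln_mult) auto
    ultimately show ?thesis by (simp add: \<delta>_def w_def)
  qed
  define X where "X = {b. is_pole f b \<and> cmod b \<le> b0}"
  have X: "finite X" unfolding X_def by (rule finite_poles_cball[OF mero])
  define C where "C = Max (insert 0 (insert (- ln (cmod P / 4)) (\<delta> ` X)))"
  have "\<delta> b \<le> C" if "is_pole f b" for b
  proof (cases "cmod b \<ge> b0")
    case True
    thus ?thesis using far[OF True] X unfolding C_def by (intro order_trans[OF _ Max_ge]) auto
  next
    case False
    hence "b \<in> X" using that by (simp add: X_def)
    thus ?thesis using X unfolding C_def by (intro Max_ge) auto
  qed
  moreover have "C \<ge> 0" using X unfolding C_def by (intro Max_ge) auto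
  ultimately show ?thesis using that[of C] by (simp add: \<delta>_def)
qed

lemma continuous_eq_off_finite:
  fixes f g :: "complex \<Rightarrow> complex"
  assumes "open D" "continuous_on D f" "continuous_on D g" "finite W"
    and eq: "\<And>z. z \<in> D - W \<Longrightarrow> f z = g z" and z: "z \<in> D"
  shows "f z = g z"
proof -
  have "isCont f z" "isCont g z" using assms continuous_on_eq_continuous_at by blast+
  hence f: "f \<midarrow>z\<rightarrow> f z" and g: "g \<midarrow>z\<rightarrow> g z" by (auto simp: isCont_def)
  have "open (D - (W - {z}))" using assms by (intro open_Diff finite_imp_closed) auto
  hence "\<forall>\<^sub>F w in at z. w \<in> D - (W - {z}) - {z}" by (rule eventually_at_in_open) (use z in auto)
  hence "\<forall>\<^sub>F w in at z. f w = g w" by eventually_elim (use eq in auto)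
  with f have "g \<midarrow>z\<rightarrow> f z" by (rule Lim_transform_eventually)
  thus ?thesis using g LIM_unique by blast
qed

lemma prod_mset_sum_mset:
  fixes h :: "'b \<Rightarrow> 'c::comm_monoid_mult"
  shows "prod_mset (image_mset h (\<Sum>b\<in>#M. G b)) = (\<Prod>b\<in>#M. prod_mset (image_mset h (G b)))"
  by (induction M) auto

lemma norm_prod_mset_linear_le:
  fixes w :: complex
  assumes "cmod w \<le> R" "\<And>b. b \<in># M \<Longrightarrow> cmod b \<le> R"
  shows "cmod (\<Prod>b\<in>#M. w - b) \<le> (2 * R) ^ size M"
  using assms(2)
proof (induction M)
  case (add b M)
  have "cmod (w - b) \<le> 2 * R" using add.prems[of b] assms(1) norm_triangle_ineq4[of w b] by simp
  thus ?case using add order_trans[OF norm_ge_zero assms(1)] by (auto simp: norm_mult intro!: mult_mono)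
qed simp

lemma laurent_bounded_sum_norm:
  assumes "finite J" "\<And>j. j \<in> J \<Longrightarrow> laurent_bounded (C j)"
  obtains K M where "K \<ge> 0" "\<And>z. z \<noteq> 0 \<Longrightarrow> (\<Sum>j\<in>J. cmod (C j z)) \<le> K * (cmod z + inverse (cmod z)) ^ M"
proof -
  have "\<exists>K M. K \<ge> 0 \<and> (\<forall>z. z \<noteq> 0 \<longrightarrow> (\<Sum>j\<in>J. cmod (C j z)) \<le> K * (cmod z + inverse (cmod z)) ^ M)"
    using assms
  proof (induction J)
    case empty
    show ?case by (rule exI[of _ 0]) auto
  next
    case (insert j J)
    obtain K M where K: "K \<ge> 0" "\<And>z. z \<noteq> 0 \<Longrightarrow> (\<Sum>j\<in>J. cmod (C j z)) \<le> K * (cmod z + inverse (cmod z)) ^ M"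
      using insert by auto
    have "laurent_bounded (C j)" using insert by simp
    then obtain L P where L: "L \<ge> 0" "\<And>z. z \<noteq> 0 \<Longrightarrow> cmod (C j z) \<le> L * (cmod z + inverse (cmod z)) ^ P"
      using laurent_boundedE by blast
    have "(\<Sum>j\<in>insert j J. cmod (C j z)) \<le> (L + K) * (cmod z + inverse (cmod z)) ^ (P + M)" if "z \<noteq> 0" for z
    proof -
      let ?t = "cmod z + inverse (cmod z)"
      have "?t \<ge> 1" by (rule norm_plus_inverse_ge_1[OF that])
      hence "K * ?t ^ M \<le> K * ?t ^ (P + M)" "L * ?t ^ P \<le> L * ?t ^ (P + M)"
        using K(1) L(1) by (auto intro!: mult_left_mono power_increasing)
      thus ?thesis using K(2)[OF that] L(2)[OF that] insert.hyps by (simp add: distrib_right)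
    qed
    thus ?case using K(1) L(1) by (metis add_nonneg_nonneg)
  qed
  thus ?thesis using that by blast
qed

text \<open>The common shape of the three operators, with Z absorbing the points where the values of F are irregular.\<close>

locale aw_form =
  fixes p :: complex and f F :: "complex \<Rightarrow> complex" and N :: nat and m :: "nat \<Rightarrow> int"
    and J :: "nat set" and S :: "nat \<Rightarrow> nat set" and C :: "nat \<Rightarrow> complex \<Rightarrow> complex"
    and ds :: "complex multiset" and Z :: "complex set"
  assumes p: "p \<noteq> 0" and mero: "f meromorphic_on UNIV"
    and m_sym: "\<And>i. i \<le> N \<Longrightarrow> m (N - i) = - m i"
    and J: "finite J" and S: "\<And>j. j \<in> J \<Longrightarrow> S j \<subseteq> {..N}"
    and C: "\<And>j. j \<in> J \<Longrightarrow> laurent_bounded (C j)" and Z: "finite Z"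
    and form: "\<And>z. z \<noteq> 0 \<Longrightarrow> z \<notin> Z \<Longrightarrow> (\<Prod>d\<in>#ds. joukowski z - d) * F (joukowski z) =
        (\<Sum>j\<in>J. C j z * (\<Prod>i\<in>S j. f (joukowski (p powi m i * z))))"
begin

abbreviation \<phi> :: "nat \<Rightarrow> complex \<Rightarrow> complex" where
  "\<phi> i z \<equiv> joukowski (p powi m i * z)"

text \<open>The roots, in the coordinate x, of the product over i of the polynomial with roots M
  taken at \<phi> i z. Replacing \<open>aw_z b\<close> by its inverse would only reverse the order
  of the indices.\<close>

definition zeros :: "complex multiset \<Rightarrow> complex multiset" where
  "zeros M = (\<Sum>b\<in>#M. image_mset (\<lambda>i. \<phi> i (aw_z b)) (mset_set {..N}))"

lemma prod_zeros:
  assumes "z \<noteq> 0"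
  shows "(\<Prod>a\<in>#zeros M. joukowski z - a) = (\<Prod>i\<le>N. \<Prod>b\<in>#M. \<phi> i z - b)"
proof -
  have "(\<Prod>a\<in>#zeros M. joukowski z - a) = (\<Prod>b\<in>#M. \<Prod>i\<le>N. joukowski z - \<phi> i (aw_z b))"
    unfolding zeros_def prod_mset_sum_mset by (simp add: prod_unfold_prod_mset image_mset.compositionality o_def)
  also have "\<dots> = (\<Prod>b\<in>#M. \<Prod>i\<le>N. \<phi> i z - b)"
    using prod_joukowski_dilate[where N = N and m = m, OF p aw_z_nonzero assms m_sym] by (simp add: aw_z)
  also have "\<dots> = (\<Prod>i\<le>N. \<Prod>b\<in>#M. \<phi> i z - b)"
    by (induction M) (auto simp: prod.distrib)
  finally show ?thesis .
qed

lemma finite_\<phi>_vimage: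
  assumes "finite E"
  shows "finite {z. z \<noteq> 0 \<and> \<phi> i z \<in> E}"
proof -
  have pk: "p powi m i \<noteq> 0" using p by simp
  have "{z. z \<noteq> 0 \<and> \<phi> i z \<in> E} \<subseteq> (\<Union>e\<in>E. {aw_z e / p powi m i, inverse (aw_z e) / p powi m i})"
  proof
    fix z assume z: "z \<in> {z. z \<noteq> 0 \<and> \<phi> i z \<in> E}"
    hence "p powi m i * z \<noteq> 0" using pk by auto
    hence "p powi m i * z = aw_z (\<phi> i z) \<or> p powi m i * z = inverse (aw_z (\<phi> i z))"
      by (metis aw_z_joukowski inverse_inverse_eq)
    hence "z = aw_z (\<phi> i z) / p powi m i \<or> z = inverse (aw_z (\<phi> i z)) / p powi m i"
      using pk by (metis nonzero_mult_div_cancel_left)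
    thus "z \<in> (\<Union>e\<in>E. {aw_z e / p powi m i, inverse (aw_z e) / p powi m i})" using z by blast
  qed
  thus ?thesis by (rule finite_subset) (use assms in auto)
qed

lemma holomorphic_\<phi>: "\<phi> i holomorphic_on - {0}"
proof -
  have "(joukowski \<circ> (\<lambda>z. p powi m i * z)) holomorphic_on - {0}"
    by (rule holomorphic_on_compose_gen[OF _ holomorphic_joukowski]) (use p in \<open>auto intro!: holomorphic_intros\<close>)
  thus ?thesis by (simp add: o_def)
qed

text \<open>Clearing the poles of the substituted copies of f turns F into G / H with G holomorphic
  and H a product of linear factors.\<close>

lemma disc_estimate:
  assumes r: "1 \<le> r"
    and g: "g analytic_on cball 0 R" and E: "finite E" "set_mset (nev_poles f R) \<subseteq> E"
    and fg: "\<And>w. w \<in> cball 0 R - E \<Longrightarrow> f w * (\<Prod>b\<in>#nev_poles f R. w - b) = g w"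
    and maps: "\<And>i z. i \<le> N \<Longrightarrow> z \<noteq> 0 \<Longrightarrow> cmod (joukowski z) < 2 * r \<Longrightarrow> cmod (\<phi> i z) < R"
    and gY: "\<And>i z. i \<le> N \<Longrightarrow> z \<noteq> 0 \<Longrightarrow> cmod (joukowski z) = r \<Longrightarrow> cmod (g (\<phi> i z)) \<le> exp Y"
    and hY: "\<And>i z. i \<le> N \<Longrightarrow> z \<noteq> 0 \<Longrightarrow> cmod (joukowski z) = r \<Longrightarrow>
                cmod (\<Prod>b\<in>#nev_poles f R. \<phi> i z - b) \<le> exp Y"
    and L: "\<And>z. z \<noteq> 0 \<Longrightarrow> cmod (joukowski z) = r \<Longrightarrow> (\<Sum>j\<in>J. cmod (C j z)) \<le> exp L"
           "\<And>z. z \<noteq> 0 \<Longrightarrow> cmod (joukowski z) = r \<Longrightarrow> cmod (\<Prod>d\<in>#ds. joukowski z - d) \<le> exp L"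
  shows "0 \<le> nev_T F r \<and> nev_T F r \<le> L + real (N + 1) * Y - (\<Sum>a\<in>#ds + zeros (nev_poles f R). ln (cmod a))"
proof -
  define A where "A = ds + zeros (nev_poles f R)"
  define h where "h w = (\<Prod>b\<in>#nev_poles f R. w - b)" for w
  \<comment> \<open>Multiplying by h(\<phi> i z) for every i \<le> N turns the factors f with index
    in \<open>S j\<close> into g and leaves h for the other indices, so each term has exactly N + 1
    factors.\<close>
  define \<Phi> where "\<Phi> z = (\<Sum>j\<in>J. C j z * ((\<Prod>i\<in>S j. g (\<phi> i z)) * (\<Prod>i\<in>{..N} - S j. h (\<phi> i z))))" for z
  \<comment> \<open>The radius 2r leaves room around |x| = r, as G has to be holomorphic on a larger
    disc.\<close>
  define D where "D = {z. z \<noteq> 0 \<and> joukowski z \<in> ball 0 (2 * r)}"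
  have openD: "open D" unfolding D_def by (rule open_joukowski_vimage) auto
  have gh: "g holomorphic_on cball 0 R" using g by (rule analytic_imp_holomorphic)
  have hh: "h holomorphic_on UNIV" unfolding h_def by (rule holomorphic_prod_mset_linear)
  have D0: "D \<subseteq> - {0}" by (auto simp: D_def)
  have g\<phi>: "(\<lambda>z. g (\<phi> i z)) holomorphic_on D" if "i \<le> N" for i
    by (rule holomorphic_on_compose_gen[OF holomorphic_on_subset[OF holomorphic_\<phi> D0] gh, unfolded o_def])
       (use maps[OF that] in \<open>force simp: D_def\<close>)
  have h\<phi>: "(\<lambda>z. h (\<phi> i z)) holomorphic_on D" for i
    by (rule holomorphic_on_compose_gen[OF holomorphic_on_subset[OF holomorphic_\<phi> D0] hh, unfolded o_def]) auto
  have \<Phi>_hol: "\<Phi> holomorphic_on D" unfolding \<Phi>_def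
  proof (intro holomorphic_intros)
    show "C j holomorphic_on D" if "j \<in> J" for j
      using C[OF that] D0 holomorphic_on_subset by (auto simp: laurent_bounded_def)
  qed (use S g\<phi> h\<phi> in auto)
  define W where "W = Z \<union> (\<Union>i\<le>N. {z. z \<noteq> 0 \<and> \<phi> i z \<in> E})"
  have W: "finite W" unfolding W_def using Z finite_\<phi>_vimage[OF E(1)] by auto
  have prodA: "(\<Prod>a\<in>#A. joukowski z - a) = (\<Prod>d\<in>#ds. joukowski z - d) * (\<Prod>i\<le>N. h (\<phi> i z))" if "z \<noteq> 0" for z
    by (simp add: A_def prod_zeros[OF that] h_def)
  have \<Phi>_eq: "\<Phi> z = F (joukowski z) * (\<Prod>a\<in>#A. joukowski z - a)" if z: "z \<in> D" "z \<notin> W" for z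
  proof -
    have z0: "z \<noteq> 0" "z \<notin> Z" using z by (auto simp: D_def W_def)
    have gf: "g (\<phi> i z) = f (\<phi> i z) * h (\<phi> i z)" if "i \<le> N" for i
    proof -
      have "cmod (\<phi> i z) < R" using maps[OF that z0(1)] z by (simp add: D_def)
      moreover have "\<phi> i z \<notin> E" using z that z0 by (auto simp: W_def)
      ultimately show ?thesis using fg[of "\<phi> i z"] by (simp add: h_def)
    qed
    have "\<Phi> z = (\<Sum>j\<in>J. C j z * (\<Prod>i\<in>S j. f (\<phi> i z)) * (\<Prod>i\<le>N. h (\<phi> i z)))"
      unfolding \<Phi>_def
    proof (intro sum.cong refl)
      fix j assume j: "j \<in> J"
      have "(\<Prod>i\<in>S j. g (\<phi> i z)) = (\<Prod>i\<in>S j. f (\<phi> i z)) * (\<Prod>i\<in>S j. h (\<phi> i z))"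
        unfolding prod.distrib[symmetric] by (intro prod.cong refl gf) (use S[OF j] in auto)
      moreover have "(\<Prod>i\<le>N. h (\<phi> i z)) = (\<Prod>i\<in>{..N} - S j. h (\<phi> i z)) * (\<Prod>i\<in>S j. h (\<phi> i z))"
        by (rule prod.subset_diff[OF S[OF j]]) auto
      ultimately show "C j z * ((\<Prod>i\<in>S j. g (\<phi> i z)) * (\<Prod>i\<in>{..N} - S j. h (\<phi> i z))) =
          C j z * (\<Prod>i\<in>S j. f (\<phi> i z)) * (\<Prod>i\<le>N. h (\<phi> i z))" by (simp only: mult_ac)
    qed
    also have "\<dots> = (\<Prod>d\<in>#ds. joukowski z - d) * F (joukowski z) * (\<Prod>i\<le>N. h (\<phi> i z))"
      unfolding sum_distrib_right[symmetric] form[OF z0] ..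
    finally show ?thesis by (simp add: prodA[OF z0(1)] mult_ac)
  qed
  have D_inv: "inverse z \<in> D" if "z \<in> D" for z using that by (simp add: D_def)
  \<comment> \<open>The coefficients need not be symmetric, so the symmetry is not visible in the
    formula for \<Phi>. It is read off from \<Phi> = F H away from finitely many points and extended
    by continuity.\<close>
  have sym: "\<Phi> (inverse z) = \<Phi> z" if z: "z \<in> D" for z
  proof (rule continuous_eq_off_finite[where f = "\<lambda>z. \<Phi> (inverse z)" and D = D and W = "W \<union> inverse ` W"])
    have "(\<lambda>z. \<Phi> (inverse z)) holomorphic_on D"
      by (rule holomorphic_on_compose_gen[OF _ \<Phi>_hol, unfolded o_def])
         (use D_inv D0 in \<open>auto intro!: holomorphic_intros\<close>)
    thus "continuous_on D (\<lambda>z. \<Phi> (inverse z))" by (rule holomorphic_on_imp_continuous_on)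
    show "continuous_on D \<Phi>" using \<Phi>_hol by (rule holomorphic_on_imp_continuous_on)
    fix w assume w: "w \<in> D - (W \<union> inverse ` W)"
    hence "inverse w \<notin> W" by (metis DiffD2 UnCI image_eqI inverse_inverse_eq)
    thus "\<Phi> (inverse w) = \<Phi> w" using \<Phi>_eq[of w] \<Phi>_eq[of "inverse w"] D_inv[of w] w by simp
  qed (use openD W z in auto)
  define G where "G x = \<Phi> (aw_z x)" for x
  have azD: "aw_z x \<in> D" if "x \<in> ball 0 (2 * r)" for x using that by (simp add: D_def aw_z)
  have G_hol: "G holomorphic_on ball 0 (2 * r)"
    unfolding G_def by (rule joukowski_descent) (use \<Phi>_hol sym in \<open>auto simp: D_def\<close>)
  have sph: "cmod (joukowski (aw_z x)) = r" "x \<in> ball 0 (2 * r)" if "x \<in> sphere 0 r" for x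
    using that r by (auto simp: aw_z)
  have exps: "exp (L + real (N + 1) * Y) = exp L * (\<Prod>i\<le>N. exp Y)"
  proof -
    have "exp (real (N + 1) * Y) = exp Y ^ Suc N" by (subst exp_of_nat_mult) simp
    thus ?thesis by (simp add: exp_add)
  qed
  have "0 \<le> nev_T F r \<and> nev_T F r \<le> (L + real (N + 1) * Y) - (\<Sum>a\<in>#A. ln (cmod a))"
  proof (rule nev_T_upper_bound[OF G_hol r])
    show "r < 2 * r" using r by simp
    show "finite (joukowski ` W)" using W by simp
    show "F x * (\<Prod>a\<in>#A. x - a) = G x" if "x \<in> ball 0 (2 * r) - joukowski ` W" for x
    proof -
      have "aw_z x \<notin> W" using that aw_z(1)[of x] by (metis DiffD2 image_eqI)
      thus ?thesis using \<Phi>_eq[of "aw_z x"] azD that by (simp add: G_def aw_z)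
    qed
    show "cmod (G x) \<le> exp (L + real (N + 1) * Y)" if x: "x \<in> sphere 0 r" for x
    proof -
      let ?z = "aw_z x"
      have "cmod (G x) \<le> (\<Sum>j\<in>J. cmod (C j ?z * ((\<Prod>i\<in>S j. g (\<phi> i ?z)) * (\<Prod>i\<in>{..N} - S j. h (\<phi> i ?z)))))"
        unfolding G_def \<Phi>_def by (rule norm_sum)
      also have "\<dots> \<le> (\<Sum>j\<in>J. cmod (C j ?z) * (\<Prod>i\<le>N. exp Y))"
      proof (rule sum_mono)
        fix j assume j: "j \<in> J"
        have "(\<Prod>i\<in>S j. cmod (g (\<phi> i ?z))) \<le> (\<Prod>i\<in>S j. exp Y)"
          using S[OF j] gY sph[OF x] by (intro prod_mono) auto
        moreover have "(\<Prod>i\<in>{..N} - S j. cmod (h (\<phi> i ?z))) \<le> (\<Prod>i\<in>{..N} - S j. exp Y)"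
          using hY sph[OF x] by (intro prod_mono) (auto simp: h_def)
        moreover have "(\<Prod>i\<le>N. exp Y) = (\<Prod>i\<in>{..N} - S j. exp Y) * (\<Prod>i\<in>S j. exp Y)"
          by (rule prod.subset_diff[OF S[OF j]]) auto
        ultimately have "(\<Prod>i\<in>S j. cmod (g (\<phi> i ?z))) * (\<Prod>i\<in>{..N} - S j. cmod (h (\<phi> i ?z))) \<le> (\<Prod>i\<le>N. exp Y)"
          by (simp only: mult.commute[of "prod _ ({..N} - S j)"]) (intro mult_mono prod_nonneg, auto)
        thus "cmod (C j ?z * ((\<Prod>i\<in>S j. g (\<phi> i ?z)) * (\<Prod>i\<in>{..N} - S j. h (\<phi> i ?z)))) \<le> cmod (C j ?z) * (\<Prod>i\<le>N. exp Y)"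
          by (simp only: norm_mult prod_norm[symmetric]) (intro mult_left_mono, auto)
      qed
      also have "\<dots> = (\<Sum>j\<in>J. cmod (C j ?z)) * (\<Prod>i\<le>N. exp Y)" by (rule sum_distrib_right[symmetric])
      also have "\<dots> \<le> exp L * (\<Prod>i\<le>N. exp Y)" using L(1)[of ?z] sph[OF x] by (intro mult_right_mono) auto
      finally show ?thesis unfolding exps .
    qed
    show "cmod (\<Prod>a\<in>#A. x - a) \<le> exp (L + real (N + 1) * Y)" if x: "x \<in> sphere 0 r" for x
    proof -
      let ?z = "aw_z x"
      have "cmod (\<Prod>a\<in>#A. x - a) = cmod (\<Prod>d\<in>#ds. joukowski ?z - d) * (\<Prod>i\<le>N. cmod (h (\<phi> i ?z)))"
        using prodA[of ?z] by (simp add: aw_z norm_mult prod_norm)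
      also have "\<dots> \<le> exp L * (\<Prod>i\<le>N. exp Y)"
        using L(2)[of ?z] hY sph[OF x] by (intro mult_mono prod_mono prod_nonneg) (auto simp: h_def)
      finally show ?thesis unfolding exps .
    qed
  qed
  thus ?thesis by (simp add: A_def)
qed


lemma nev_T_bound:
  "\<exists>K R0. \<forall>r\<ge>R0. 0 \<le> nev_T F r \<and> nev_T F r \<le> real (N + 1) * nev_T f (r * ln r ^ 3)
      + K * (nev_T f (r * ln r ^ 3) / ln (ln r)) + K * ln r"
proof -
  define c where "c = (\<Sum>i\<le>N. cmod (p powi m i) + inverse (cmod (p powi m i)))"
  have ci: "cmod (p powi m i) + inverse (cmod (p powi m i)) \<le> c" if "i \<le> N" for i
    unfolding c_def using that by (intro member_le_sum) auto
  have c1: "c \<ge> 1" using ci[of 0] norm_plus_inverse_ge_1[of "p powi m 0"] p by simp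
  have \<phi>_le: "cmod (\<phi> i z) \<le> c * (cmod (joukowski z) + 1)" if "i \<le> N" "z \<noteq> 0" for i z
    using norm_joukowski_dilate_le[of z "p powi m i"] that ci[OF that(1)]
    by (smt (verit) mult_right_mono norm_ge_zero power_int_not_zero)
  have "\<exists>C\<ge>0. \<forall>b. is_pole f b \<longrightarrow> ln (cmod b) - ln (cmod (\<phi> i (aw_z b))) \<le> C" for i
    using ln_joukowski_dilate_pole_bound[OF mero, of "p powi m i"] p by (metis power_int_not_zero)
  then obtain Cp where Cp: "\<And>i. Cp i \<ge> 0" "\<And>i b. is_pole f b \<Longrightarrow> ln (cmod b) - ln (cmod (\<phi> i (aw_z b))) \<le> Cp i"
    by metis
  define C0 where "C0 = (\<Sum>i\<le>N. Cp i)"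
  have C0: "C0 \<ge> 0" unfolding C0_def by (intro sum_nonneg Cp)
  obtain K1 M1 where K1: "K1 \<ge> 0" "\<And>z. z \<noteq> 0 \<Longrightarrow> (\<Sum>j\<in>J. cmod (C j z)) \<le> K1 * (cmod z + inverse (cmod z)) ^ M1"
    using laurent_bounded_sum_norm[OF J, of C] C by blast
  obtain K2 M2 where K2: "K2 \<ge> 0" "\<And>z. z \<noteq> 0 \<Longrightarrow> cmod (\<Prod>d\<in>#ds. joukowski z - d) \<le> K2 * (cmod z + inverse (cmod z)) ^ M2"
    using laurent_boundedE[OF laurent_bounded_prod_mset[of 1 ds]] by (metis mult_1 one_neq_zero)
  define M where "M = M1 + M2"
  define K0 where "K0 = 1 + K1 + K2"
  have K0: "K0 \<ge> 1" using K1 K2 by (simp add: K0_def)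
  define D0 where "D0 = (\<Sum>d\<in>#ds. ln (cmod d))"
  \<comment> \<open>The three groups are the coefficients of n, of m(R, f) / ln r and of ln r in the
    estimate below.\<close>
  define K where "K = (C0 + real (N + 1) * ln 2) + real (N + 1) * (8 * c) + (ln K0 + 3 * real M + \<bar>D0\<bar>)"
  \<comment> \<open>Gives ln r \<ge> 8 c, so R > r ln r \<ge> 8 c r. As |\<phi> i z| \<le> c (|x| +
    1), the shifted points have modulus at most 2 c r for |x| = r and at most 3 c r for |x| < 2r,
    well inside the disc of radius R.\<close>
  define R0 where "R0 = exp (8 * c)"
  have "0 \<le> nev_T F r \<and> nev_T F r \<le> real (N + 1) * nev_T f (r * ln r ^ 3)
      + K * (nev_T f (r * ln r ^ 3) / ln (ln r)) + K * ln r" if rR: "r \<ge> R0" for r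
  proof -
    have r0: "r > 0" using rR by (simp add: R0_def) (smt (verit) exp_gt_zero)
    have lr: "ln r \<ge> 8 * c" using rR r0 by (simp add: R0_def ln_ge_iff)
    have lr8: "ln r \<ge> 8" using lr c1 by simp
    have r1: "r \<ge> 8" using lr8 r0 ln_le_minus_one[of r] by simp
    have lnln: "ln (ln r) \<ge> 1"
    proof -
      have "exp 1 \<le> (3::real)" using exp_le by simp
      hence "ln (exp 1) \<le> ln (ln r)" using lr8 by (intro ln_mono) auto
      thus ?thesis by simp
    qed
    have lnln_le: "ln (ln r) \<le> ln r" using lr8 ln_le_minus_one[of "ln r"] by simp
    define A where "A = r * ln r ^ 3"
    \<comment> \<open>R avoids the moduli of the finitely many poles, so h has no zero on |w| =
      R.\<close>
    have "infinite ({r * ln r<..<2 * r * ln r} - cmod ` {b. is_pole f b \<and> cmod b \<le> 2 * r * ln r})"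
      using finite_poles_cball[OF mero, of "2 * r * ln r"] r1 lr8 infinite_Ioo[of "r * ln r" "2 * r * ln r"]
      by (intro Diff_infinite_finite finite_imageI) auto
    then obtain R where R: "r * ln r < R" "R < 2 * r * ln r" "R \<notin> cmod ` {b. is_pole f b \<and> cmod b \<le> 2 * r * ln r}"
      by (metis (no_types, lifting) DiffE ex_in_conv finite.emptyI greaterThanLessThan_iff)
    have nopole: "\<not> is_pole f w" if "cmod w = R" for w using R that by auto
    have Rr: "R \<ge> 8 * r" using R(1) mult_left_mono[OF lr8, of r] r1 by linarith
    have R8c: "R \<ge> 8 * c * r"
    proof -
      have "8 * c * r \<le> ln r * r" using lr r1 by (intro mult_right_mono) auto
      thus ?thesis using R(1) by (simp add: mult.commute)
    qed
    have R1: "R \<ge> 1" "R > 0" using Rr r1 by auto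
    define P where "P = nev_poles f R"
    define n where "n = real (size P)"
    obtain g E where g: "g analytic_on cball 0 R" "finite E"
      "\<And>w. w \<in> cball 0 R - E \<Longrightarrow> f w * (\<Prod>b\<in>#P. w - b) = g w"
      "\<And>b. b \<in># P \<Longrightarrow> g b \<noteq> 0" "set_mset P \<subseteq> E"
      unfolding P_def using meromorphic_quotient_cball[OF mero] by metis
    define h where "h w = (\<Prod>b\<in>#P. w - b)" for w
    have P_le: "cmod b \<le> R" "is_pole f b" if "b \<in># P" for b
      using that by (auto simp: P_def set_mset_nev_poles[OF mero])
    have h_le: "cmod (h w) \<le> exp (n * ln (2 * R))" if "cmod w \<le> R" for w
    proof -
      have "cmod (h w) \<le> (2 * R) ^ size P" unfolding h_def by (rule norm_prod_mset_linear_le) (use that P_le in auto)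
      also have "\<dots> = exp (n * ln (2 * R))" using R1 by (simp add: n_def exp_of_nat_mult)
      finally show ?thesis .
    qed
    have n0: "n \<ge> 0" by (simp add: n_def)
    \<comment> \<open>Off finitely many points of |w| = R this is log+ |f|, so its mean is m(R, f).
      In contrast to log+ |f| it is continuous on the whole circle, as the Harnack bound
      requires.\<close>
    define V where "V w = ln (max (cmod (g w)) (cmod (h w))) - ln (cmod (h w))" for w
    have hnz: "h w \<noteq> 0" if "w \<in> sphere 0 R" for w
      using nopole[of w] that P_le(2)[of w] unfolding h_def by (subst prod_mset_linear_eq_0_iff) auto
    have V_cont: "continuous_on (sphere 0 R) V"
    proof -
      have "continuous_on (cball 0 R) g" using g(1) by (intro holomorphic_on_imp_continuous_on analytic_imp_holomorphic)
      hence 1: "continuous_on (sphere 0 R) g" by (rule continuous_on_subset) auto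
      have 2: "continuous_on (sphere 0 R) h" unfolding h_def
        by (intro holomorphic_on_imp_continuous_on holomorphic_prod_mset_linear)
      show ?thesis unfolding V_def using hnz by (intro continuous_intros 1 2) (auto simp: max_def)
    qed
    have V0: "V w \<ge> 0" if "w \<in> sphere 0 R" for w
      unfolding V_def using hnz[OF that] by (simp add: ln_mono)
    have Vg: "cmod (g w) \<le> exp (n * ln (2 * R) + V w)" if w: "w \<in> sphere 0 R" for w
    proof -
      have "cmod (g w) \<le> max (cmod (g w)) (cmod (h w))" by simp
      also have "\<dots> = exp (V w) * cmod (h w)"
        using hnz[OF w] by (simp add: V_def exp_diff less_max_iff_disj)
      also have "\<dots> \<le> exp (V w) * exp (n * ln (2 * R))" using h_le[of w] w by (intro mult_left_mono) auto
      finally show ?thesis by (simp add: exp_add mult.commute)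
    qed
    have Vm: "circle_mean V R = nev_m f R"
    proof -
      have "((\<lambda>\<theta>. V (of_real R * cis \<theta>)) has_integral (2 * pi * circle_mean V R)) {0..2*pi}"
        using continuous_on_circle_integrable[OF V_cont] R1 by (simp add: circle_mean_def has_integral_integral)
      hence "((\<lambda>\<theta>. log_plus (cmod (f (of_real R * cis \<theta>)))) has_integral (2 * pi * circle_mean V R)) {0..2*pi}"
      proof (rule has_integral_spike_finite[rotated 2])
        show "finite {\<theta>\<in>{0..2*pi}. of_real R * cis \<theta> \<in> E}" by (rule finite_cis_vimage) (use R1 g in auto)
        fix \<theta> assume "\<theta> \<in> {0..2*pi} - {\<theta>\<in>{0..2*pi}. of_real R * cis \<theta> \<in> E}"
        hence w: "of_real R * cis \<theta> \<in> cball 0 R - E" "of_real R * cis \<theta> \<in> sphere 0 R"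
          using R1 by (auto simp: norm_mult)
        show "log_plus (cmod (f (of_real R * cis \<theta>))) = V (of_real R * cis \<theta>)"
          unfolding V_def by (rule ln_max_quotient[OF hnz[OF w(2)]]) (use g(3)[OF w(1)] in \<open>simp add: h_def\<close>)
      qed
      thus ?thesis by (simp add: nev_m_def integral_unique)
    qed
    \<comment> \<open>8 c / ln r bounds the excess 2s / (R - s) of the Harnack factor over 1, where
      s \<le> 2 c r and R - s \<ge> r ln r / 2.\<close>
    define Y where "Y = n * ln (2 * R) + (1 + 8 * c / ln r) * nev_m f R"
    have lnR: "ln (2 * R) \<ge> 0" using R1 by simp
    have hY: "n * ln (2 * R) \<le> Y" unfolding Y_def using nev_m_nonneg[of f R] c1 lr8 by simp
    have \<phi>_r: "cmod (\<phi> i z) \<le> 2 * c * r" if "i \<le> N" "z \<noteq> 0" "cmod (joukowski z) = r" for i z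
    proof -
      have "c * (r + 1) \<le> c * (2 * r)" using c1 r1 by (intro mult_left_mono) auto
      thus ?thesis using \<phi>_le[OF that(1,2)] that(3) by simp
    qed
    have \<phi>_R: "cmod (\<phi> i z) < R" if "i \<le> N" "z \<noteq> 0" "cmod (joukowski z) < 2 * r" for i z
    proof -
      have "c * (cmod (joukowski z) + 1) \<le> c * (3 * r)" using c1 r1 that by (intro mult_left_mono) auto
      also have "\<dots> < 8 * c * r" using c1 r1 by simp
      finally show ?thesis using \<phi>_le[OF that(1,2)] R8c by simp
    qed
    have gY: "cmod (g (\<phi> i z)) \<le> exp Y" if "i \<le> N" "z \<noteq> 0" "cmod (joukowski z) = r" for i z
    proof -
      define s where "s = cmod (\<phi> i z)"
      have s: "s \<le> 2 * c * r" "s < R" "s \<ge> 0" using \<phi>_r[OF that] \<phi>_R[OF that(1,2)] that(3) r1 by (auto simp: s_def)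
      have "(R + s) / (R - s) \<le> 1 + 8 * c / ln r"
      proof -
        have "2 * c * r \<le> r * ln r / 2" using lr r1 c1 by (simp add: mult.commute mult_left_mono)
        hence Rs: "R - s \<ge> r * ln r / 2" using R(1) s by linarith
        have "(R + s) / (R - s) = 1 + 2 * s / (R - s)" using s by (simp add: field_simps)
        also have "2 * s / (R - s) \<le> (4 * c * r) / (r * ln r / 2)"
          using s Rs r1 lr8 c1 by (intro frac_le) auto
        also have "\<dots> = 8 * c / ln r" using r1 lr8 by (simp add: field_simps)
        finally show ?thesis by simp
      qed
      hence "(R + s) / (R - s) * nev_m f R \<le> (1 + 8 * c / ln r) * nev_m f R"
        by (rule mult_right_mono) (rule nev_m_nonneg)
      moreover have "cmod (g (\<phi> i z)) \<le> exp (n * ln (2 * R) + (R + s) / (R - s) * circle_mean V R)"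
        unfolding s_def by (rule Poisson_Harnack_bound[OF g(1) V_cont V0 Vg]) (use s in \<open>auto simp: s_def\<close>)
      ultimately show ?thesis unfolding Vm Y_def by (smt (verit) exp_le_cancel_iff)
    qed
    \<comment> \<open>On |x| = r one has |z| + 1/|z| \<le> 4r, so the coefficients and the
      denominator contribute only O(log r).\<close>
    define L where "L = ln K0 + real M * ln (4 * r)"
    have L: "K1 * (cmod z + inverse (cmod z)) ^ M1 \<le> exp L" "K2 * (cmod z + inverse (cmod z)) ^ M2 \<le> exp L"
      if z: "z \<noteq> 0" "cmod (joukowski z) = r" for z
    proof -
      let ?t = "cmod z + inverse (cmod z)"
      have t: "1 \<le> ?t" "?t \<le> 4 * r"
        using norm_plus_inverse_le_joukowski[OF z(1)] norm_plus_inverse_ge_1[OF z(1)] z(2) r1 by auto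
      have "exp L = K0 * (4 * r) ^ M" using K0 r1 by (simp add: L_def exp_add exp_of_nat_mult)
      moreover have "?t ^ k \<le> (4 * r) ^ M" if "k \<le> M" for k
      proof -
        have "?t ^ k \<le> (4 * r) ^ k" using t by (intro power_mono) auto
        also have "\<dots> \<le> (4 * r) ^ M" using that r1 by (intro power_increasing) auto
        finally show ?thesis .
      qed
      hence "?t ^ M1 \<le> (4 * r) ^ M" "?t ^ M2 \<le> (4 * r) ^ M" by (auto simp: M_def)
      ultimately show "K1 * ?t ^ M1 \<le> exp L" "K2 * ?t ^ M2 \<le> exp L"
        using K1(1) K2(1) t by (auto simp: K0_def intro!: mult_mono)
    qed
    have main: "0 \<le> nev_T F r \<and> nev_T F r \<le> L + real (N + 1) * Y - (\<Sum>a\<in>#ds + zeros P. ln (cmod a))"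
      unfolding P_def
    proof (rule disc_estimate)
      show "g analytic_on cball 0 R" "finite E" by (rule g)+
      show "set_mset (nev_poles f R) \<subseteq> E" using g(5) by (simp add: P_def)
      show "f w * (\<Prod>b\<in>#nev_poles f R. w - b) = g w" if "w \<in> cball 0 R - E" for w
        using g(3)[OF that] by (simp add: P_def)
      show "cmod (\<Prod>b\<in>#nev_poles f R. \<phi> i z - b) \<le> exp Y" if "i \<le> N" "z \<noteq> 0" "cmod (joukowski z) = r" for i z
      proof -
        have "cmod (\<phi> i z) \<le> R" using \<phi>_R[OF that(1,2)] that(3) r1 by simp
        from h_le[OF this] have "cmod (h (\<phi> i z)) \<le> exp Y" using hY by (smt (verit) exp_le_cancel_iff)
        thus ?thesis by (simp add: h_def P_def)
      qed
      show "(\<Sum>j\<in>J. cmod (C j z)) \<le> exp L" if "z \<noteq> 0" "cmod (joukowski z) = r" for z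
        using K1(2)[OF that(1)] L(1)[OF that] by (rule order_trans)
      show "cmod (\<Prod>d\<in>#ds. joukowski z - d) \<le> exp L" if "z \<noteq> 0" "cmod (joukowski z) = r" for z
        using K2(2)[OF that(1)] L(2)[OF that] by (rule order_trans)
    qed (use r1 \<phi>_R gY in auto)
    \<comment> \<open>The i-th shift of a pole b lowers ln |b| by at most \<open>Cp i\<close>,
      uniformly in b, so its N + 1 copies together lose at most C0.\<close>
    have zeros_bound: "- (\<Sum>a\<in>#zeros Q. ln (cmod a)) \<le> - (real (N + 1) * (\<Sum>b\<in>#Q. ln (cmod b))) + C0 * real (size Q)"
      if "\<And>b. b \<in># Q \<Longrightarrow> is_pole f b" for Q
      using that
    proof (induction Q)
      case (add b Q)
      have "(\<Sum>i\<le>N. ln (cmod b) - ln (cmod (\<phi> i (aw_z b)))) \<le> C0"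
        unfolding C0_def by (intro sum_mono Cp add.prems) auto
      hence "- (\<Sum>i\<le>N. ln (cmod (\<phi> i (aw_z b)))) \<le> - real (N + 1) * ln (cmod b) + C0"
        by (simp add: sum_subtractf algebra_simps)
      moreover have "(\<Sum>a\<in>#zeros (add_mset b Q). ln (cmod a)) =
          (\<Sum>i\<le>N. ln (cmod (\<phi> i (aw_z b)))) + (\<Sum>a\<in>#zeros Q. ln (cmod a))"
        by (simp add: zeros_def sum_unfold_sum_mset image_mset.compositionality o_def)
      moreover have "- (\<Sum>a\<in>#zeros Q. ln (cmod a)) \<le> - (real (N + 1) * (\<Sum>b\<in>#Q. ln (cmod b))) + C0 * real (size Q)"
        using add by auto
      ultimately show ?case by (simp add: algebra_simps)
    qed (simp add: zeros_def)
    have NR: "nev_N f R = n * ln R - (\<Sum>b\<in>#P. ln (cmod b))"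
    proof -
      have "(\<Sum>b\<in>#P. ln (max R (cmod b))) = (\<Sum>b\<in>#P. ln R)"
        by (intro arg_cong[of _ _ sum_mset] image_mset_cong) (simp add: P_le(1))
      also have "\<dots> = n * ln R" by (simp add: n_def)
      finally show ?thesis using nev_N_eq[OF mero R1(2) order_refl] by (simp add: P_def)
    qed
    have lnR2: "ln (2 * R) = ln 2 + ln R" using R1 by (simp add: ln_mult)
    have 1: "nev_T F r \<le> L - D0 + real (N + 1) * nev_T f R + n * (C0 + real (N + 1) * ln 2)
        + real (N + 1) * (8 * c) * (nev_m f R / ln r)"
    proof -
      have "nev_T F r \<le> L + real (N + 1) * Y - D0 - real (N + 1) * (\<Sum>b\<in>#P. ln (cmod b)) + C0 * n"
      proof -
        have "- (\<Sum>a\<in>#zeros P. ln (cmod a)) \<le> - (real (N + 1) * (\<Sum>b\<in>#P. ln (cmod b))) + C0 * n"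
          unfolding n_def by (rule zeros_bound) (rule P_le(2))
        moreover have "(\<Sum>a\<in>#ds + zeros P. ln (cmod a)) = D0 + (\<Sum>a\<in>#zeros P. ln (cmod a))"
          by (simp add: D0_def)
        ultimately show ?thesis using main by linarith
      qed
      also have "real (N + 1) * Y = real (N + 1) * (n * ln 2 + n * ln R + nev_m f R + 8 * c / ln r * nev_m f R)"
        unfolding Y_def lnR2 by (simp add: algebra_simps)
      also have "n * ln R = nev_N f R + (\<Sum>b\<in>#P. ln (cmod b))" using NR by simp
      finally show ?thesis unfolding nev_T_def by (simp add: algebra_simps add_divide_distrib)
    qed
    have RA: "R \<le> A"
    proof -
      have "2 * r * ln r \<le> ln r ^ 2 * r * ln r" using lr8 r1
        by (intro mult_right_mono) (auto simp: power2_eq_square intro: order_trans[OF _ mult_mono[of 8 "ln r" 8 "ln r"]])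
      thus ?thesis using R(2) by (simp add: A_def power2_eq_square power3_eq_cube mult_ac)
    qed
    have TA: "nev_T f R \<le> nev_T f A" using R1 RA by (intro nev_T_mono mero) auto
    have mA: "nev_m f R \<le> nev_T f A" using TA nev_N_nonneg[OF mero R1(1)] by (simp add: nev_T_def)
    have TA0: "nev_T f A \<ge> 0" using mA nev_m_nonneg[of f R] by linarith
    \<comment> \<open>Origin of the exponent 3: ln A - ln R is at least 2 ln (ln r) - ln 2, and ln 2
      \<le> 1 \<le> ln (ln r).\<close>
    have nA: "n \<le> nev_T f A / ln (ln r)"
    proof -
      have "ln A = ln r + 3 * ln (ln r)" unfolding A_def using r1 lr8 by (simp add: ln_mult ln_realpow)
      moreover have "ln R \<le> ln (2 * r * ln r)" using R R1 by (intro ln_mono) auto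
      moreover have "ln (2 * r * ln r) = ln 2 + ln r + ln (ln r)" using r1 lr8 by (simp add: ln_mult)
      moreover have "ln 2 \<le> (1::real)" using ln_2_less_1 by simp
      ultimately have "ln (ln r) \<le> ln A - ln R" using lnln by linarith
      hence "n * ln (ln r) \<le> n * (ln A - ln R)" by (intro mult_left_mono n0)
      also have "\<dots> \<le> nev_N f A" unfolding n_def P_def by (rule nev_N_ge[OF mero R1(1) RA])
      also have "\<dots> \<le> nev_T f A" using nev_m_nonneg[of f A] by (simp add: nev_T_def)
      finally show ?thesis using lnln by (simp add: field_simps)
    qed
    have mlr: "nev_m f R / ln r \<le> nev_T f A / ln (ln r)"
      using mA lnln lnln_le TA0 lr8 by (intro frac_le) auto
    have LD: "L - D0 \<le> (ln K0 + 3 * real M + \<bar>D0\<bar>) * ln r"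
    proof -
      have "ln (4 * r) \<le> 3 * ln r"
      proof -
        have "ln 4 \<le> ln r" using r1 by (intro ln_mono) auto
        moreover have "ln (4 * r) = ln 4 + ln r" using r1 by (simp add: ln_mult)
        ultimately show ?thesis using lr8 by linarith
      qed
      hence "real M * ln (4 * r) \<le> real M * (3 * ln r)" by (intro mult_left_mono) auto
      moreover have "ln K0 * 1 \<le> ln K0 * ln r" "\<bar>D0\<bar> * 1 \<le> \<bar>D0\<bar> * ln r" using K0 lr8 by (intro mult_left_mono; simp)+
      ultimately show ?thesis unfolding L_def by (simp add: distrib_right)
    qed
    have "n * (C0 + real (N + 1) * ln 2) \<le> (nev_T f A / ln (ln r)) * (C0 + real (N + 1) * ln 2)"
      using C0 nA by (intro mult_right_mono) auto
    moreover have "real (N + 1) * (8 * c) * (nev_m f R / ln r) \<le> real (N + 1) * (8 * c) * (nev_T f A / ln (ln r))"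
      using c1 mlr by (intro mult_left_mono) auto
    moreover have "real (N + 1) * nev_T f R \<le> real (N + 1) * nev_T f A" using TA by (intro mult_left_mono) auto
    ultimately have "nev_T F r \<le> (ln K0 + 3 * real M + \<bar>D0\<bar>) * ln r + real (N + 1) * nev_T f A +
        (nev_T f A / ln (ln r)) * ((C0 + real (N + 1) * ln 2) + real (N + 1) * (8 * c))"
      using 1 LD by (simp add: distrib_left mult.commute)
    moreover have "(ln K0 + 3 * real M + \<bar>D0\<bar>) * ln r \<le> K * ln r"
      using C0 c1 lr8 by (intro mult_right_mono) (auto simp: K_def)
    moreover have "(nev_T f A / ln (ln r)) * ((C0 + real (N + 1) * ln 2) + real (N + 1) * (8 * c)) \<le> (nev_T f A / ln (ln r)) * K"
      using TA0 lnln K0 by (intro mult_left_mono) (auto simp: K_def)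
    ultimately show ?thesis using main unfolding A_def by (simp add: mult.commute)
  qed
  thus ?thesis by blast
qed

end

section \<open>Growth outside an exceptional set\<close>

lemma nn_integral_inverse_mult_ln:
  assumes "1 < a" "a \<le> b"
  shows "(\<integral>\<^sup>+t. ennreal (1 / (t * ln t)) * indicator {a..b} t \<partial>lborel) = ennreal (ln (ln b) - ln (ln a))"
proof (rule nn_integral_FTC_Icc[where F = "\<lambda>t. ln (ln t)"])
  fix t assume "t \<in> {a..b}"
  hence "t > 1" using assms by simp
  thus "((\<lambda>t. ln (ln t)) has_real_derivative 1 / (t * ln t)) (at t)"
    by (auto intro!: derivative_eq_intros simp: field_simps)
  show "0 \<le> 1 / (t * ln t)" using \<open>t > 1\<close> by simp
qed (use assms in auto)

text \<open>The intervals may overlap, so countable subadditivity of the measure with density 1/(t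
  ln t) is used; since the density is nonnegative on the union, its finite integral there yields
  \<open>integrable_on\<close>.\<close>

lemma integrable_on_UN_intervals_inverse_mult_ln:
  fixes a b :: "nat \<Rightarrow> real"
  assumes ab: "\<And>j. j \<in> B \<Longrightarrow> 1 < a j \<and> a j \<le> b j"
    and sm: "summable (\<lambda>j. if j \<in> B then ln (ln (b j)) - ln (ln (a j)) else 0)"
  shows "(\<lambda>t::real. 1 / (t * ln t)) integrable_on (\<Union>j\<in>B. {a j..b j})"
proof -
  define F where "F = (\<Union>j\<in>B. {a j..b j})"
  define I where "I j = (if j \<in> B then {a j..b j} else {})" for j
  have F: "F = (\<Union>j. I j)" by (auto simp: F_def I_def split: if_splits)
  have [measurable]: "I j \<in> sets borel" for j by (simp add: I_def)
  have [measurable]: "F \<in> sets borel" unfolding F by auto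
  define w where "w t = 1 / (t * ln t)" for t :: real
  have [measurable]: "w \<in> borel_measurable borel" unfolding w_def by measurable
  have le: "emeasure (density lborel (\<lambda>t. ennreal (w t))) (I j) \<le>
      ennreal (if j \<in> B then ln (ln (b j)) - ln (ln (a j)) else 0)" for j
  proof (cases "j \<in> B")
    case True
    have "emeasure (density lborel (\<lambda>t. ennreal (w t))) (I j) = (\<integral>\<^sup>+t. ennreal (w t) * indicator {a j..b j} t \<partial>lborel)"
      using True by (subst emeasure_density) (auto simp: I_def)
    also have "\<dots> = ennreal (ln (ln (b j)) - ln (ln (a j)))"
      unfolding w_def using ab[OF True] by (intro nn_integral_inverse_mult_ln) auto
    finally show ?thesis using True by simp
  qed (simp add: I_def)
  have nonneg: "0 \<le> (if j \<in> B then ln (ln (b j)) - ln (ln (a j)) else 0)" for j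
    using ab[of j] by (auto intro!: ln_mono)
  have "(\<integral>\<^sup>+t. ennreal (w t) * indicator F t \<partial>lborel) = emeasure (density lborel (\<lambda>t. ennreal (w t))) F"
    by (subst emeasure_density) auto
  also have "\<dots> \<le> (\<Sum>j. emeasure (density lborel (\<lambda>t. ennreal (w t))) (I j))"
    unfolding F by (rule emeasure_subadditive_countably) auto
  also have "\<dots> \<le> (\<Sum>j. ennreal (if j \<in> B then ln (ln (b j)) - ln (ln (a j)) else 0))"
    by (intro suminf_le le) auto
  also have "\<dots> = ennreal (\<Sum>j. if j \<in> B then ln (ln (b j)) - ln (ln (a j)) else 0)"
    by (rule suminf_ennreal2[OF nonneg sm])
  finally have fin: "(\<integral>\<^sup>+t. ennreal (w t) * indicator F t \<partial>lborel) < \<infinity>"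
    by (rule le_less_trans) simp
  have w0: "w t \<ge> 0" if "t \<in> F" for t
  proof -
    from that obtain j where "j \<in> B" "a j \<le> t" unfolding F_def by auto
    hence "t > 1" using ab[of j] by auto
    thus ?thesis by (simp add: w_def)
  qed
  have eq: "ennreal (w t) * indicator F t = ennreal (if t \<in> F then w t else 0)" for t by auto
  define r where "r = enn2real (\<integral>\<^sup>+t. ennreal (if t \<in> F then w t else 0) \<partial>lborel)"
  have r: "r \<ge> 0" "(\<integral>\<^sup>+t. ennreal (if t \<in> F then w t else 0) \<partial>lborel) = ennreal r"
    using fin unfolding eq by (auto simp: r_def)
  have "((\<lambda>t. if t \<in> F then w t else 0) has_integral r) UNIV"
    by (rule nn_integral_has_integral[OF _ _ r(2,1)]) (use w0 in auto)
  hence "(w has_integral r) F" by (simp add: has_integral_restrict_UNIV)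
  thus ?thesis unfolding w_def F_def by blast
qed

text \<open>In the variable s = ln r take the grid x j = j^\<beta> with 1 < \<beta> < 1/a. A step of the grid exceeds the shift
  3 ln s, and an interval is bad if ln (1 + T) grows by more than 1/ln s over two steps. Its measure is
  O(1/j), and summation by parts against the growth bound j^(\<beta> a) shows that the bad intervals have
  finite total measure.\<close>

lemma growth_outside_exceptional_set:
  fixes T :: "real \<Rightarrow> real"
  assumes mono: "\<And>r s. 0 < r \<Longrightarrow> r \<le> s \<Longrightarrow> T r \<le> T s" and nonneg: "\<And>r. r \<ge> 1 \<Longrightarrow> T r \<ge> 0"
    and a: "0 < a" "a < 1" and bound: "\<And>r. r \<ge> r0 \<Longrightarrow> ln (1 + T r) \<le> 1 + ln r powr a"
  obtains F R where "F \<subseteq> {1<..}" "(\<lambda>t::real. 1 / (t * ln t)) integrable_on F"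
    "\<And>r. r \<ge> R \<Longrightarrow> r \<notin> F \<Longrightarrow> T (r * ln r ^ 3) \<le> T r + 2 * (T r / ln (ln r)) + 2"
proof -
  \<comment> \<open>\<beta> is the midpoint of 1 and 1/a, so that \<gamma> = \<beta> a < 1, and
    \<delta> lies strictly between \<gamma> and 1: above \<gamma> for the convergence of the sums,
    below 1 to absorb the factor ln j in \<beta>^2 ln (j + 1) / j.\<close>
  define \<beta> where "\<beta> = (1 + 1 / a) / 2"
  define \<gamma> where "\<gamma> = (a + 1) / 2"
  define \<delta> where "\<delta> = (\<gamma> + 1) / 2"
  have \<beta>: "\<beta> > 1" using a by (simp add: \<beta>_def field_simps)
  have \<beta>a: "\<beta> * a = \<gamma>" using a by (simp add: \<beta>_def \<gamma>_def field_simps)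
  have \<gamma>\<delta>: "0 < \<gamma>" "\<gamma> < \<delta>" "\<delta> < 1" using a by (auto simp: \<gamma>_def \<delta>_def)
  define x where "x j = real j powr \<beta>" for j
  define \<phi> where "\<phi> j = ln (1 + T (exp (x j)))" for j
  have x_mono: "x i \<le> x j" if "i \<le> j" for i j using that \<beta> by (simp add: x_def powr_mono2)
  have x0: "x j \<ge> 0" for j by (simp add: x_def)
  have T0: "T (exp (x j)) \<ge> 0" for j using x0[of j] by (intro nonneg) simp
  have \<phi>0: "\<phi> j \<ge> 0" for j using T0[of j] by (simp add: \<phi>_def)
  have \<phi>_mono: "\<phi> i \<le> \<phi> j" if "i \<le> j" for i j
    unfolding \<phi>_def using T0[of i] T0[of j] x_mono[OF that] mono[of "exp (x i)" "exp (x j)"] by (intro ln_mono) auto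
  have ev1: "\<forall>\<^sub>F j in sequentially. x (Suc j) + 3 * ln (x (Suc j)) \<le> x (Suc (Suc j))"
    unfolding x_def using \<beta> by real_asymp
  have ev2: "\<forall>\<^sub>F j in sequentially. r0 \<le> exp (x j)"
    unfolding x_def using \<beta> by real_asymp
  have ev3: "\<forall>\<^sub>F j in sequentially. \<beta>\<^sup>2 * ln (real (Suc j)) / real j \<le> real j powr (- \<delta>)"
    using \<gamma>\<delta> \<beta> by real_asymp
  obtain J where J: "J \<ge> 3" "\<And>j. j \<ge> J \<Longrightarrow> x (Suc j) + 3 * ln (x (Suc j)) \<le> x (Suc (Suc j))"
      "\<And>j. j \<ge> J \<Longrightarrow> r0 \<le> exp (x j)"
      "\<And>j. j \<ge> J \<Longrightarrow> \<beta>\<^sup>2 * ln (real (Suc j)) / real j \<le> real j powr (- \<delta>)"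
    using eventually_conj[OF eventually_ge_at_top[of 3] eventually_conj[OF ev1 eventually_conj[OF ev2 ev3]]]
    unfolding eventually_sequentially by (metis (mono_tags, lifting) nle_le)
  have \<phi>_le: "\<phi> j \<le> 1 + real j powr \<gamma>" if "j \<ge> J" for j
    using bound[OF J(3)[OF that]] by (simp add: \<phi>_def x_def powr_powr \<beta>a)
  have x_gt1: "x j > exp 1" if "j \<ge> J" for j
  proof -
    have "exp 1 < (3::real)" using exp_le e_less_272 by simp
    also have "3 \<le> real j powr 1" using that J(1) by simp
    also have "\<dots> \<le> x j" unfolding x_def using \<beta> that J(1) by (intro powr_mono) auto
    finally show ?thesis .
  qed
  define Bad where "Bad = {j. j \<ge> J \<and> \<phi> (Suc (Suc j)) - \<phi> j > 1 / ln (x (Suc j))}"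
  define F where "F = (\<Union>j\<in>Bad. {exp (x j)..exp (x (Suc j))})"
  \<comment> \<open>The two-step increment of \<phi> is the one-step increment of \<psi>, which
    permits summation by parts. The boundary terms w \<psi> vanish in the limit because \<gamma> <
    \<delta>, and w j - w (j + 1) has size j^(-\<delta> - 1) against j^\<gamma> for \<psi>.\<close>
  define \<psi> where "\<psi> j = \<phi> (Suc j) + \<phi> j" for j
  define w where "w j = real j powr (- \<delta>)" for j
  have \<psi>0: "\<psi> j \<ge> 0" for j using \<phi>0 by (simp add: \<psi>_def)
  have \<psi>_le: "\<psi> j \<le> 2 * (1 + real (Suc j) powr \<gamma>)" if "j \<ge> J" for j
  proof -
    have "\<psi> j \<le> 2 * \<phi> (Suc j)" using \<phi>_mono[of j "Suc j"] by (simp add: \<psi>_def)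
    thus ?thesis using \<phi>_le[of "Suc j"] that by simp
  qed
  have sum1: "summable (\<lambda>j. w (Suc j) * \<psi> (Suc j) - w j * \<psi> j)"
  proof (rule telescope_summable)
    show "(\<lambda>j. w j * \<psi> j) \<longlonglongrightarrow> 0"
    proof (rule tendsto_sandwich[of "\<lambda>_. 0" _ _ "\<lambda>j. real j powr (- \<delta>) * (2 * (1 + real (Suc j) powr \<gamma>))"])
      show "(\<lambda>j. real j powr (- \<delta>) * (2 * (1 + real (Suc j) powr \<gamma>))) \<longlonglongrightarrow> 0"
        using \<gamma>\<delta> by real_asymp
      show "\<forall>\<^sub>F j in sequentially. w j * \<psi> j \<le> real j powr (- \<delta>) * (2 * (1 + real (Suc j) powr \<gamma>))"
        using eventually_ge_at_top[of J]
        by eventually_elim (simp only: w_def, intro mult_left_mono \<psi>_le, auto)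
    qed (auto simp: w_def \<psi>0)
  qed
  have sum2: "summable (\<lambda>j. (w j - w (Suc j)) * \<psi> (Suc j))"
  proof (rule summable_comparison_test_ev)
    show "summable (\<lambda>j. (real j powr (- \<delta>) - real (Suc j) powr (- \<delta>)) * (2 * (1 + real (Suc (Suc j)) powr \<gamma>)))"
    proof (rule summable_comparison_test_bigo)
      show "summable (\<lambda>j. norm (real j powr (\<gamma> - \<delta> - 1)))" using \<gamma>\<delta> by (simp add: summable_real_powr_iff)
      show "(\<lambda>j. (real j powr (- \<delta>) - real (Suc j) powr (- \<delta>)) * (2 * (1 + real (Suc (Suc j)) powr \<gamma>)))
          \<in> O(\<lambda>j. real j powr (\<gamma> - \<delta> - 1))"
        using \<gamma>\<delta> by real_asymp
    qed
    show "\<forall>\<^sub>F j in sequentially. norm ((w j - w (Suc j)) * \<psi> (Suc j)) \<le>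
        (real j powr (- \<delta>) - real (Suc j) powr (- \<delta>)) * (2 * (1 + real (Suc (Suc j)) powr \<gamma>))"
      using eventually_ge_at_top[of J]
    proof eventually_elim
      case (elim j)
      have "w (Suc j) \<le> w j" unfolding w_def using elim J(1) \<gamma>\<delta> by (intro powr_mono2') auto
      thus ?case using \<psi>_le[of "Suc j"] \<psi>0[of "Suc j"] elim
        by (auto simp: w_def abs_mult intro!: mult_left_mono)
    qed
  qed
  have sum3: "summable (\<lambda>j. w j * (\<phi> (Suc (Suc j)) - \<phi> j))"
  proof -
    have "w j * (\<phi> (Suc (Suc j)) - \<phi> j) = (w (Suc j) * \<psi> (Suc j) - w j * \<psi> j) + (w j - w (Suc j)) * \<psi> (Suc j)" for j
      by (simp add: \<psi>_def algebra_simps)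
    thus ?thesis using summable_add[OF sum1 sum2] by simp
  qed
  have F_int: "(\<lambda>t::real. 1 / (t * ln t)) integrable_on F"
    unfolding F_def
  proof (rule integrable_on_UN_intervals_inverse_mult_ln)
    show "1 < exp (x j) \<and> exp (x j) \<le> exp (x (Suc j))" if "j \<in> Bad" for j
      using that x_gt1[of j] x_mono[of j "Suc j"] by (auto simp: Bad_def intro: less_trans[OF exp_gt_zero])
    show "summable (\<lambda>j. if j \<in> Bad then ln (ln (exp (x (Suc j)))) - ln (ln (exp (x j))) else 0)"
    proof (rule summable_comparison_test_ev[OF _ sum3])
      show "\<forall>\<^sub>F j in sequentially. norm (if j \<in> Bad then ln (ln (exp (x (Suc j)))) - ln (ln (exp (x j))) else 0)
          \<le> w j * (\<phi> (Suc (Suc j)) - \<phi> j)"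
        using eventually_ge_at_top[of J]
      proof eventually_elim
        case (elim j)
        show ?case
        proof (cases "j \<in> Bad")
          case True
          have j0: "real j > 0" using elim J(1) by simp
          have lx: "ln (x i) = \<beta> * ln (real i)" if "i > 0" for i using that by (simp add: x_def ln_powr)
          have "real (Suc j) = real j * (1 + 1 / real j)" using j0 by (simp add: field_simps)
          moreover have "ln (real j * (1 + 1 / real j)) = ln (real j) + ln (1 + 1 / real j)"
            using j0 by (intro ln_mult_pos add_pos_pos) auto
          ultimately have "ln (real (Suc j)) - ln (real j) = ln (1 + 1 / real j)" by simp
          also have "\<dots> \<le> 1 / real j" using j0 by (intro ln_add_one_self_le_self) auto
          finally have "\<beta> * (ln (real (Suc j)) - ln (real j)) \<le> \<beta> * (1 / real j)"
            using \<beta> by (intro mult_left_mono) auto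
          hence d: "ln (x (Suc j)) - ln (x j) \<le> \<beta> / real j"
            using j0 lx[of j] lx[of "Suc j"] by (simp add: right_diff_distrib)
          have "exp 1 < x (Suc j)" using x_gt1[of "Suc j"] elim by simp
          hence lpos: "ln (x (Suc j)) > 0" by (smt (verit) exp_gt_one less_trans ln_gt_zero zero_less_one exp_gt_zero)
          \<comment> \<open>Badness supplies a factor exceeding 1 by which the length of the
            interval in ln (ln r), at most \<beta> / j, may be multiplied; this produces the
            increment of \<phi> that makes the series summable.\<close>
          have "1 < ln (x (Suc j)) * (\<phi> (Suc (Suc j)) - \<phi> j)"
            using True lpos by (simp add: Bad_def field_simps)
          hence "\<beta> / real j * 1 \<le> \<beta> / real j * (ln (x (Suc j)) * (\<phi> (Suc (Suc j)) - \<phi> j))"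
            using \<beta> j0 by (intro mult_left_mono) auto
          also have "\<dots> = (\<beta>\<^sup>2 * ln (real (Suc j)) / real j) * (\<phi> (Suc (Suc j)) - \<phi> j)"
            by (simp add: lx power2_eq_square)
          also have "\<dots> \<le> w j * (\<phi> (Suc (Suc j)) - \<phi> j)"
            unfolding w_def using J(4)[OF elim] \<phi>_mono[of j "Suc (Suc j)"] by (intro mult_right_mono) auto
          finally have "ln (x (Suc j)) - ln (x j) \<le> w j * (\<phi> (Suc (Suc j)) - \<phi> j)" using d by simp
          moreover have "ln (x j) \<le> ln (x (Suc j))"
            using x_gt1[OF elim] x_mono[of j "Suc j"] by (intro ln_mono) (auto intro: less_trans[OF exp_gt_zero])
          ultimately show ?thesis using True by simp
        next
          case False
          thus ?thesis using \<phi>_mono[of j "Suc (Suc j)"] by (simp add: w_def)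
        qed
      qed
    qed
  qed
  have F_sub: "F \<subseteq> {1<..}"
  proof
    fix t assume "t \<in> F"
    then obtain j where "j \<ge> J" "exp (x j) \<le> t" by (auto simp: F_def Bad_def)
    moreover have "x j > 0" using x_gt1[of j] \<open>j \<ge> J\<close> by (auto intro: less_trans[OF exp_gt_zero])
    ultimately show "t \<in> {1<..}" by (smt (verit) exp_gt_one greaterThan_iff)
  qed
  have "T (r * ln r ^ 3) \<le> T r + 2 * (T r / ln (ln r)) + 2" if r: "r \<ge> exp (x J)" "r \<notin> F" for r
  proof -
    define s where "s = ln r"
    have r0: "r > 0" using r(1) by (smt (verit) exp_gt_zero)
    have rs: "r = exp s" using r0 by (simp add: s_def)
    have sJ: "s \<ge> x J" using r(1) r0 by (simp add: s_def ln_ge_iff)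
    have s_gt: "s > exp 1" using sJ x_gt1[of J] by simp
    hence s0: "s > 0" by (auto intro: less_trans[OF exp_gt_zero])
    have ls: "ln s \<ge> 1" using s_gt s0 by (simp add: ln_ge_iff)
    \<comment> \<open>The grid interval containing s. The enlarged radius has logarithm s + 3 ln s
      \<le> x (j + 2), which is why badness is measured over two steps.\<close>
    define j where "j = nat \<lfloor>s powr (1 / \<beta>)\<rfloor>"
    have j: "real j \<le> s powr (1 / \<beta>)" "s powr (1 / \<beta>) < real (Suc j)"
      by (auto simp: j_def) linarith
    have pb: "(s powr (1 / \<beta>)) powr \<beta> = s" using \<beta> s0 by (simp add: powr_powr)
    have xs: "x j \<le> s" "s \<le> x (Suc j)"
      using powr_mono2[OF _ _ j(1), of \<beta>] powr_mono2[OF _ _ less_imp_le[OF j(2)], of \<beta>] \<beta> pb by (auto simp: x_def)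
    have "real J \<le> s powr (1 / \<beta>)"
      using powr_mono2[OF _ _ sJ, of "1 / \<beta>"] x0[of J] \<beta> by (simp add: x_def powr_powr)
    hence jJ: "j \<ge> J" unfolding j_def by (simp add: le_nat_floor)
    have "r \<in> {exp (x j)..exp (x (Suc j))}" using xs by (simp add: rs)
    hence "j \<notin> Bad" using r(2) by (auto simp: F_def)
    hence \<phi>: "\<phi> (Suc (Suc j)) - \<phi> j \<le> 1 / ln (x (Suc j))" using jJ by (simp add: Bad_def)
    also have "\<dots> \<le> 1 / ln s"
    proof -
      have "ln s \<le> ln (x (Suc j))" using xs(2) s0 by (intro ln_mono) auto
      thus ?thesis using ls by (intro frac_le) auto
    qed
    finally have \<phi>d: "\<phi> (Suc (Suc j)) \<le> \<phi> j + 1 / ln s" by simp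
    have "r * ln r ^ 3 = exp (s + 3 * ln s)"
      using s0 exp_of_nat_mult[of 3 "ln s"] by (simp add: rs exp_add)
    also have "\<dots> \<le> exp (x (Suc (Suc j)))"
    proof -
      have "ln s \<le> ln (x (Suc j))" using xs(2) s0 by (intro ln_mono) auto
      thus ?thesis using J(2)[OF jJ] xs(2) by simp
    qed
    finally have "T (r * ln r ^ 3) \<le> T (exp (x (Suc (Suc j))))"
      using r0 s0 by (intro mono) (auto simp: s_def)
    also have "1 + T (exp (x (Suc (Suc j)))) = exp (\<phi> (Suc (Suc j)))" using T0[of "Suc (Suc j)"] by (simp add: \<phi>_def)
    hence "T (exp (x (Suc (Suc j)))) \<le> exp (\<phi> j + 1 / ln s) - 1" using \<phi>d by (smt (verit) exp_le_cancel_iff)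
    also have "exp (\<phi> j + 1 / ln s) = (1 + T (exp (x j))) * exp (1 / ln s)" using T0[of j] by (simp add: \<phi>_def exp_add)
    \<comment> \<open>For u = 1 / ln s in [0, 1] one has exp u \<le> 1 + u + u^2 \<le> 1 +
      2u.\<close>
    also have "\<dots> \<le> (1 + T r) * (1 + 2 * (1 / ln s))"
    proof (intro mult_mono)
      show "1 + T (exp (x j)) \<le> 1 + T r" using xs(1) by (auto simp: rs intro!: mono)
      have u: "0 \<le> 1 / ln s" "1 / ln s \<le> 1" using ls by auto
      have "exp (1 / ln s) \<le> 1 + 1 / ln s + (1 / ln s)\<^sup>2" by (rule exp_bound[OF u])
      also have "(1 / ln s)\<^sup>2 \<le> 1 / ln s" using u by (simp only: power2_eq_square) (intro mult_left_le_one_le, auto)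
      finally show "exp (1 / ln s) \<le> 1 + 2 * (1 / ln s)" by simp
      show "0 \<le> 1 + T r" using s0 by (intro add_nonneg_nonneg nonneg) (auto simp: rs)
    qed auto
    also have "(1 + T r) * (1 + 2 * (1 / ln s)) - 1 = T r + 2 * (T r / ln s) + 2 * (1 / ln s)"
      by (simp add: algebra_simps add_divide_distrib)
    also have "2 * (1 / ln s) \<le> 2" using ls by (simp add: divide_le_eq)
    finally show ?thesis by (simp add: s_def)
  qed
  thus ?thesis using that F_sub F_int by blast
qed

section \<open>The logarithmic hyper-order\<close>

lemma sigma2_log_nonneg: "sigma2_log f \<ge> 0"
proof -
  have "0 \<le> Liminf at_top (\<lambda>r::real. ereal (log_plus (log_plus (nev_T f r)) / ln (ln r)))"
  proof (rule Liminf_bounded)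
    have "\<forall>\<^sub>F r in at_top. ln (ln r) > (0::real)" by real_asymp
    thus "\<forall>\<^sub>F r in at_top. 0 \<le> ereal (log_plus (log_plus (nev_T f r)) / ln (ln r))"
      by eventually_elim (auto simp: log_plus_def)
  qed
  also have "\<dots> \<le> sigma2_log f" unfolding sigma2_log_def by (rule Liminf_le_Limsup) simp
  finally show ?thesis .
qed

lemma log_plus_le_of_log_plus_log_plus_less:
  assumes "log_plus (log_plus T) / ln (ln r) < b" "ln (ln r) > 0" "ln r > 0"
  shows "log_plus T \<le> ln r powr b"
proof (cases "log_plus T > 0")
  case True
  have "ln (log_plus T) \<le> log_plus (log_plus T)" by (simp add: log_plus_def)
  also have "\<dots> < b * ln (ln r)" using assms by (simp add: field_simps)
  finally have "log_plus T < exp (b * ln (ln r))" using True by (metis exp_less_cancel_iff exp_ln)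
  thus ?thesis using assms(3) by (simp add: powr_def)
qed (simp add: not_less order_trans[OF _ powr_ge_zero])

lemma sigma2_log_less_imp_eventually:
  assumes "sigma2_log f < ereal b"
  shows "\<forall>\<^sub>F r in at_top. log_plus (nev_T f r) \<le> ln r powr b"
proof -
  have "\<forall>\<^sub>F r in at_top. ereal (log_plus (log_plus (nev_T f r)) / ln (ln r)) < ereal b"
    using assms unfolding sigma2_log_def by (rule Limsup_lessD)
  moreover have "\<forall>\<^sub>F r in at_top. ln (ln r) > (0::real)" "\<forall>\<^sub>F r in at_top. ln r > (0::real)"
    by real_asymp+
  ultimately show ?thesis by eventually_elim (auto intro: log_plus_le_of_log_plus_log_plus_less)
qed

lemma le_exp_log_plus: "T \<le> exp (log_plus T)"
  by (cases "T > 0") (auto simp: log_plus_def le_max_iff_disj not_less intro: order_trans[of _ 0]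
       order_trans[OF eq_refl[OF exp_ln[symmetric]]])

text \<open>Passing from r to r (ln r)^3 at most doubles ln r eventually. For b1 < b the power (ln
  r)^b absorbs both 2^b1 (ln r)^b1 and the logarithms of the remaining factors, so neither the
  larger radius nor the constants raise the order.\<close>

lemma sigma2_log_mono:
  assumes C: "C > 0"
    and bound: "\<forall>\<^sub>F r in at_top. 0 \<le> nev_T F r \<and> nev_T F r \<le> C * nev_T f (r * ln r ^ 3) + C * ln r"
  shows "sigma2_log F \<le> sigma2_log f"
proof (rule dense_ge)
  fix x assume "sigma2_log f < x"
  then obtain b where b: "sigma2_log f < ereal b" "ereal b < x" using ereal_dense2 by blast
  then obtain b1 where b1: "sigma2_log f < ereal b1" "b1 < b" using ereal_dense2[OF b(1)] by auto
  have b1_pos: "b1 > 0" using order.strict_trans1[OF sigma2_log_nonneg b1(1)] by simp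
  have lim: "filterlim (\<lambda>r::real. r * ln r ^ 3) at_top at_top" by real_asymp
  have "\<forall>\<^sub>F r in at_top. log_plus (nev_T f (r * ln r ^ 3)) \<le> ln (r * ln r ^ 3) powr b1"
    using eventually_compose_filterlim[OF sigma2_log_less_imp_eventually[OF b1(1)] lim] .
  moreover have "\<forall>\<^sub>F r in at_top. C * exp (ln (r * ln r ^ 3) powr b1) + C * ln r \<le> exp (ln r powr b)"
  proof -
    have "\<forall>\<^sub>F r::real in at_top. ln (r * ln r ^ 3) \<le> 2 * ln r" by real_asymp
    moreover have "\<forall>\<^sub>F r::real in at_top. 0 \<le> ln (r * ln r ^ 3)" by real_asymp
    moreover have "\<forall>\<^sub>F r::real in at_top. 2 powr b1 * ln r powr b1 + ln (2 * C) \<le> ln r powr b"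
      using C b1_pos b1(2) by real_asymp
    moreover have "\<forall>\<^sub>F r::real in at_top. ln (2 * C) + ln (ln r) \<le> ln r powr b"
      using C b1_pos b1(2) by real_asymp
    moreover have "\<forall>\<^sub>F r::real in at_top. 0 < ln r" by real_asymp
    ultimately show ?thesis
    proof eventually_elim
      case (elim r)
      have "ln (r * ln r ^ 3) powr b1 \<le> (2 * ln r) powr b1" using elim b1_pos by (intro powr_mono2) auto
      also have "\<dots> = 2 powr b1 * ln r powr b1" using elim by (simp add: powr_mult)
      finally have "ln (r * ln r ^ 3) powr b1 + ln (2 * C) \<le> ln r powr b" using elim(3) by simp
      hence "exp (ln (r * ln r ^ 3) powr b1 + ln (2 * C)) \<le> exp (ln r powr b)" by simp
      hence "2 * (C * exp (ln (r * ln r ^ 3) powr b1)) \<le> exp (ln r powr b)" using C by (simp add: exp_add mult_ac)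
      moreover have "exp (ln (2 * C) + ln (ln r)) \<le> exp (ln r powr b)" using elim(4) by simp
      hence "2 * (C * ln r) \<le> exp (ln r powr b)" using C elim(5) by (simp add: exp_add mult_ac)
      ultimately show ?case by linarith
    qed
  qed
  moreover have "\<forall>\<^sub>F r in at_top. ln (ln r) > (0::real)" "\<forall>\<^sub>F r in at_top. ln r > (0::real)"
    by real_asymp+
  ultimately have "\<forall>\<^sub>F r in at_top. ereal (log_plus (log_plus (nev_T F r)) / ln (ln r)) \<le> ereal b"
    using bound
  proof eventually_elim
    case (elim r)
    note lr = \<open>0 < ln r\<close>
    have "nev_T f (r * ln r ^ 3) \<le> exp (ln (r * ln r ^ 3) powr b1)"
      by (rule order_trans[OF le_exp_log_plus]) (use elim(1) in simp)
    hence "nev_T F r \<le> exp (ln r powr b)" using elim(2,5) C by (smt (verit) mult_left_mono)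
    hence "ln (nev_T F r) \<le> ln r powr b" if "nev_T F r > 0" using that by (metis ln_exp ln_mono)
    hence 1: "log_plus (nev_T F r) \<le> ln r powr b"
      by (cases "nev_T F r > 0") (use elim(5) in \<open>auto simp: log_plus_def\<close>)
    have "log_plus (log_plus (nev_T F r)) \<le> b * ln (ln r)"
    proof (cases "log_plus (nev_T F r) > 0")
      case True
      have "ln (log_plus (nev_T F r)) \<le> ln (ln r powr b)" using 1 True by (intro ln_mono) auto
      thus ?thesis using lr elim(3) b1_pos b1(2) by (simp add: log_plus_def ln_powr)
    next
      case False
      thus ?thesis using elim(3) b1_pos b1(2) by (auto simp: log_plus_def)
    qed
    thus ?case using elim(3) by (simp add: field_simps)
  qed
  hence "sigma2_log F \<le> ereal b" unfolding sigma2_log_def by (rule Limsup_bounded)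
  thus "sigma2_log F \<le> x" using b(2) by simp
qed

lemma nev_T_nonneg:
  assumes "f meromorphic_on UNIV" "r \<ge> 1"
  shows "nev_T f r \<ge> 0"
  using nev_m_nonneg[of f r] nev_N_nonneg[OF assms] by (simp add: nev_T_def)

text \<open>The conclusion is stated for all C' \<ge> C so that one constant, the maximum, can serve
  the three operators simultaneously.\<close>

lemma nev_T_bound_outside_exceptional_set:
  assumes mero: "f meromorphic_on UNIV"
    and bound: "\<forall>r\<ge>R0. 0 \<le> nev_T F r \<and> nev_T F r \<le> c * nev_T f (r * ln r ^ 3) + K * (nev_T f (r * ln r ^ 3) / ln (ln r)) + K * ln r"
    and c: "c \<ge> 0"
    and growth: "\<And>r. r \<ge> R1 \<Longrightarrow> r \<notin> E \<Longrightarrow> nev_T f (r * ln r ^ 3) \<le> nev_T f r + 2 * (nev_T f r / ln (ln r)) + 2"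
  shows "\<exists>C R. \<forall>C'\<ge>C. \<forall>r. r \<ge> R \<and> r \<notin> E \<longrightarrow> nev_T F r \<le> c * nev_T f r + C' * (nev_T f r / ln (ln r)) + C' * ln r"
proof -
  define k where "k = \<bar>K\<bar>"
  \<comment> \<open>With u = T / ln (ln r) the coefficients of u and of ln r both come out as 2c +
    3k, which this value covers.\<close>
  define C where "C = 2 * c + 5 * k"
  define R where "R = max (max R0 R1) (exp (exp 1))"
  have "nev_T F r \<le> c * nev_T f r + C' * (nev_T f r / ln (ln r)) + C' * ln r"
    if C': "C' \<ge> C" and r: "r \<ge> R" "r \<notin> E" for C' r
  proof -
    have rr: "r \<ge> R0" "r \<ge> R1" "r \<ge> exp (exp 1)" using r by (auto simp: R_def)
    have r0: "r > 0" using rr(3) by (rule less_le_trans[OF exp_gt_zero])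
    have lr: "ln r \<ge> exp 1" using rr(3) r0 by (simp add: ln_ge_iff)
    have lr1: "ln r \<ge> 1" using lr exp_ge_add_one_self[of 1] by simp
    have l: "ln (ln r) \<ge> 1" using lr lr1 by (simp add: ln_ge_iff)
    have r1: "r \<ge> 1" using rr(3) by (smt (verit) exp_ge_zero one_le_exp_iff)
    define T where "T = nev_T f r"
    define A where "A = nev_T f (r * ln r ^ 3)"
    have T0: "T \<ge> 0" unfolding T_def by (rule nev_T_nonneg[OF mero r1])
    have "1 * 1 \<le> r * ln r ^ 3" using r1 lr1 by (intro mult_mono one_le_power) auto
    hence A0: "A \<ge> 0" unfolding A_def by (intro nev_T_nonneg[OF mero]) simp
    have A1: "A \<le> T + 2 * (T / ln (ln r)) + 2" unfolding A_def T_def by (rule growth[OF rr(2) r(2)])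
    define u where "u = T / ln (ln r)"
    have u: "0 \<le> u" "u \<le> T" using T0 l by (auto simp: u_def divide_le_eq mult_le_cancel_left1)
    have "A / ln (ln r) \<le> (3 * T + 2) / ln (ln r)" using A1 u l by (intro divide_right_mono) (auto simp: u_def)
    also have "\<dots> = 3 * u + 2 / ln (ln r)" by (simp add: u_def add_divide_distrib)
    also have "2 / ln (ln r) \<le> 2" using l by (simp add: divide_le_eq)
    finally have A2: "A / ln (ln r) \<le> 3 * u + 2" by simp
    have "nev_T F r \<le> c * A + K * (A / ln (ln r)) + K * ln r" using bound rr(1) by (simp add: A_def)
    also have "\<dots> \<le> c * (T + 2 * u + 2) + k * (3 * u + 2) + k * ln r"
    proof (intro add_mono)
      show "c * A \<le> c * (T + 2 * u + 2)" using A1 c by (intro mult_left_mono) (auto simp: u_def)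
      have "K * (A / ln (ln r)) \<le> k * (A / ln (ln r))" using A0 l by (intro mult_right_mono) (auto simp: k_def)
      also have "\<dots> \<le> k * (3 * u + 2)" using A2 by (intro mult_left_mono) (auto simp: k_def)
      finally show "K * (A / ln (ln r)) \<le> k * (3 * u + 2)" .
      show "K * ln r \<le> k * ln r" using lr1 by (intro mult_right_mono) (auto simp: k_def)
    qed
    also have "\<dots> = c * T + (2 * c + 3 * k) * u + (2 * c + 2 * k) * 1 + k * ln r" by (simp add: algebra_simps)
    also have "\<dots> \<le> c * T + (2 * c + 3 * k) * u + (2 * c + 2 * k) * ln r + k * ln r"
      using lr1 c by (intro add_mono mult_left_mono) (auto simp: k_def)
    also have "\<dots> = c * T + (2 * c + 3 * k) * u + (2 * c + 3 * k) * ln r" by (simp add: algebra_simps)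
    also have "\<dots> \<le> c * T + C' * u + C' * ln r"
      using C' u lr1 by (intro add_mono mult_right_mono order_refl) (auto simp: C_def k_def)
    finally show ?thesis by (simp add: T_def u_def)
  qed
  thus ?thesis by blast
qed

lemma sigma2_log_le_of_bound:
  assumes mero: "f meromorphic_on UNIV"
    and bound: "\<forall>r\<ge>R0. 0 \<le> nev_T F r \<and> nev_T F r \<le> c * nev_T f (r * ln r ^ 3) + K * (nev_T f (r * ln r ^ 3) / ln (ln r)) + K * ln r"
  shows "sigma2_log F \<le> sigma2_log f"
proof (rule sigma2_log_mono)
  show "0 < \<bar>c\<bar> + \<bar>K\<bar> + 1" by simp
  have "\<forall>\<^sub>F r in at_top. ln (ln r) \<ge> (1::real)" by real_asymp
  moreover have "\<forall>\<^sub>F r::real in at_top. r * ln r ^ 3 \<ge> 1" by real_asymp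
  moreover have "\<forall>\<^sub>F r::real in at_top. ln r \<ge> 0" by real_asymp
  ultimately show "\<forall>\<^sub>F r in at_top. 0 \<le> nev_T F r \<and> nev_T F r \<le> (\<bar>c\<bar> + \<bar>K\<bar> + 1) * nev_T f (r * ln r ^ 3) + (\<bar>c\<bar> + \<bar>K\<bar> + 1) * ln r"
    using eventually_ge_at_top[of R0]
  proof eventually_elim
    case (elim r)
    define A where "A = nev_T f (r * ln r ^ 3)"
    have A0: "A \<ge> 0" unfolding A_def by (rule nev_T_nonneg[OF mero elim(2)])
    have "A / ln (ln r) \<le> A" using A0 elim(1) by (simp add: divide_le_eq mult_le_cancel_left1)
    hence "K * (A / ln (ln r)) \<le> \<bar>K\<bar> * A" using A0 elim(1) by (intro mult_mono) auto
    moreover have "c * A \<le> (\<bar>c\<bar> + 1) * A" using A0 by (intro mult_right_mono) auto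
    moreover have "K * ln r \<le> (\<bar>c\<bar> + \<bar>K\<bar> + 1) * ln r" using elim(3) by (intro mult_right_mono) auto
    moreover have "nev_T F r \<le> c * A + K * (A / ln (ln r)) + K * ln r" using bound elim(4) by (simp add: A_def)
    moreover have "0 \<le> nev_T F r" using bound elim(4) by simp
    ultimately show ?case by (simp add: A_def algebra_simps)
  qed
qed

section \<open>The three operators as instances of the common form\<close>

lemma nev_T_aw_D_bound:
  assumes p: "p \<noteq> 0" "p\<^sup>2 \<noteq> 1" and mero: "f meromorphic_on UNIV"
  shows "\<exists>K R0. \<forall>r\<ge>R0. 0 \<le> nev_T ((aw_D p ^^ n) f) r \<and> nev_T ((aw_D p ^^ n) f) r \<le> real (n + 1) * nev_T f (r * ln r ^ 3)
      + K * (nev_T f (r * ln r ^ 3) / ln (ln r)) + K * ln r"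
proof -
  obtain ds C Z where *: "finite Z" "\<forall>k. laurent_bounded (C k)"
    "\<forall>z. z \<noteq> 0 \<and> z \<notin> Z \<longrightarrow> (\<Prod>d\<in>#ds. joukowski z - d) * (aw_D p ^^ n) f (joukowski z) =
        (\<Sum>k\<le>n. C k z * f (joukowski (p powi (int n - 2 * int k) * z)))"
    using aw_D_power_representation[OF p, of n f] by blast
  \<comment> \<open>The exponents n - 2i change sign under i -> n - i, and each term contains a
    single shifted value, so N = n.\<close>
  interpret aw_form p f "(aw_D p ^^ n) f" n "\<lambda>i. int n - 2 * int i" "{..n}" "\<lambda>j. {j}" C ds Z
    by unfold_locales (use p mero * in auto)
  show ?thesis by (rule nev_T_bound)
qed

lemma nev_T_aw_A_bound:
  assumes p: "p \<noteq> 0" and mero: "f meromorphic_on UNIV"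
  shows "\<exists>K R0. \<forall>r\<ge>R0. 0 \<le> nev_T (aw_A p n f) r \<and> nev_T (aw_A p n f) r \<le> 2 * nev_T f (r * ln r ^ 3)
      + K * (nev_T f (r * ln r ^ 3) / ln (ln r)) + K * ln r"
proof -
  define m where "m i = (if i = 0 then int n else - int n)" for i :: nat
  have form: "aw_A p n f (joukowski z) = (\<Sum>j\<le>1. 1 / 2 * f (joukowski (p powi m j * z)))" if "z \<noteq> 0" for z
  proof -
    have two: "(\<Sum>j\<le>1. h j) = h 0 + h 1" for h :: "nat \<Rightarrow> complex" by simp
    have "aw_eta p (int n) f (joukowski z) + aw_eta p (- int n) f (joukowski z) =
        f (joukowski (p powi m 0 * z)) + f (joukowski (p powi m 1 * z))"
      using aw_eta_joukowski[OF that, of p f] unfolding m_def by (elim disjE) (simp_all add: add.commute)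
    thus ?thesis unfolding two aw_A_def by (simp add: field_simps)
  qed
  interpret aw_form p f "aw_A p n f" 1 m "{..1}" "\<lambda>j. {j}" "\<lambda>_ _. 1 / 2" "{#}" "{}"
  proof unfold_locales
    show "m (1 - i) = - m i" if "i \<le> 1" for i using that by (cases "i = 0") (auto simp: m_def)
  qed (use p mero form in auto)
  show ?thesis using nev_T_bound by simp
qed

lemma nev_T_aw_eta_prod_bound:
  assumes p: "p \<noteq> 0" and mero: "f meromorphic_on UNIV"
  shows "\<exists>K R0. \<forall>r\<ge>R0. 0 \<le> nev_T (\<lambda>x. aw_eta p (int n) f x * aw_eta p (- int n) f x) r \<and> nev_T (\<lambda>x. aw_eta p (int n) f x * aw_eta p (- int n) f x) r \<le> 2 * nev_T f (r * ln r ^ 3)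
      + K * (nev_T f (r * ln r ^ 3) / ln (ln r)) + K * ln r"
proof -
  define m where "m i = (if i = 0 then int n else - int n)" for i :: nat
  have form: "aw_eta p (int n) f (joukowski z) * aw_eta p (- int n) f (joukowski z) =
      (\<Prod>i\<le>1. f (joukowski (p powi m i * z)))" if "z \<noteq> 0" for z
  proof -
    have two: "(\<Prod>j\<le>1. h j) = h 0 * h 1" for h :: "nat \<Rightarrow> complex" by simp
    show ?thesis unfolding two m_def
      using aw_eta_joukowski[OF that, of p f] by (elim disjE) (simp_all add: mult.commute)
  qed
  \<comment> \<open>A single term containing both shifted values, in contrast to the sums above;
    with two exponents the factor is again 2.\<close>
  interpret aw_form p f "\<lambda>x. aw_eta p (int n) f x * aw_eta p (- int n) f x" 1 m "{0}" "\<lambda>_. {..1}" "\<lambda>_ _. 1" "{#}" "{}"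
  proof unfold_locales
    show "m (1 - i) = - m i" if "i \<le> 1" for i using that by (cases "i = 0") (auto simp: m_def)
  qed (use p mero form in auto)
  show ?thesis using nev_T_bound by simp
qed

lemma nev_T_exceptional_set:
  assumes mero: "f meromorphic_on UNIV" and order: "sigma2_log f < 1"
  obtains E R where "E \<subseteq> {1<..}" "(\<lambda>t::real. 1 / (t * ln t)) integrable_on E"
    "\<And>r. r \<ge> R \<Longrightarrow> r \<notin> E \<Longrightarrow> nev_T f (r * ln r ^ 3) \<le> nev_T f r + 2 * (nev_T f r / ln (ln r)) + 2"
proof -
  obtain a where a: "sigma2_log f < ereal a" "a < 1"
    using ereal_dense2[of "sigma2_log f" 1] order by (auto simp: one_ereal_def)
  have a0: "a > 0" using order.strict_trans1[OF sigma2_log_nonneg a(1)] by simp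
  \<comment> \<open>Below radius 1 the characteristic may be negative because of ln r; cutting off
    at 1 keeps T nonnegative and monotone.\<close>
  define T where "T r = nev_T f (max 1 r)" for r
  have Tnn: "T r \<ge> 0" for r unfolding T_def by (rule nev_T_nonneg[OF mero]) simp
  have "\<forall>\<^sub>F r in at_top. log_plus (nev_T f r) \<le> ln r powr a" by (rule sigma2_log_less_imp_eventually[OF a(1)])
  then obtain r0 where r0: "\<And>r. r \<ge> r0 \<Longrightarrow> log_plus (nev_T f r) \<le> ln r powr a"
    unfolding eventually_at_top_linorder by blast
  have T_le: "ln (1 + T r) \<le> 1 + ln r powr a" if r: "r \<ge> max 1 r0" for r
  proof -
    have "T r = nev_T f r" using r by (simp add: T_def max_absorb2)
    also have "\<dots> \<le> exp (log_plus (nev_T f r))" by (rule le_exp_log_plus)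
    also have "\<dots> \<le> exp (ln r powr a)" using r0[of r] r by simp
    finally have "T r \<le> exp (ln r powr a)" .
    moreover have "1 \<le> exp (ln r powr a)" by simp
    \<comment> \<open>The factor 2 is absorbed by exp 1, whence the summand 1 in the growth
      bound.\<close>
    ultimately have "1 + T r \<le> 2 * exp (ln r powr a)" by linarith
    also have "\<dots> \<le> exp 1 * exp (ln r powr a)" using exp_ge_add_one_self[of 1] by (intro mult_right_mono) auto
    finally have "1 + T r \<le> exp (1 + ln r powr a)" by (simp add: exp_add)
    thus ?thesis using Tnn[of r] by (metis add_pos_nonneg ln_exp ln_mono zero_less_one)
  qed
  have T_mono: "T r \<le> T s" if "0 < r" "r \<le> s" for r s
    unfolding T_def by (rule nev_T_mono[OF mero]) (use that in auto)
  obtain E R where E: "E \<subseteq> {1<..}" "(\<lambda>t::real. 1 / (t * ln t)) integrable_on E"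
    "\<And>r. r \<ge> R \<Longrightarrow> r \<notin> E \<Longrightarrow> T (r * ln r ^ 3) \<le> T r + 2 * (T r / ln (ln r)) + 2"
    using growth_outside_exceptional_set[of T a "max 1 r0", OF T_mono Tnn a0 a(2) T_le] by blast
  have "nev_T f (r * ln r ^ 3) \<le> nev_T f r + 2 * (nev_T f r / ln (ln r)) + 2" if r: "r \<ge> max R (exp 1)" "r \<notin> E" for r
  proof -
    have "r \<ge> exp 1" using r by simp
    hence "r \<ge> 1" "r > 0" using exp_ge_add_one_self[of 1] by linarith+
    hence "ln r \<ge> 1" using \<open>r \<ge> exp 1\<close> by (simp add: ln_ge_iff)
    hence "1 * 1 \<le> r * ln r ^ 3" using \<open>r \<ge> 1\<close> by (intro mult_mono one_le_power) auto
    thus ?thesis using E(3)[of r] r \<open>r \<ge> 1\<close> by (simp add: T_def max_absorb2)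
  qed
  thus ?thesis using that[OF E(1,2)] by blast
qed

theorem theorem3p4:
  fixes q p :: complex and n :: nat and f :: "complex \<Rightarrow> complex"
  assumes q: "0 < cmod q" "cmod q < 1"
    and p: "p ^ 2 = q"
    and mero: "f meromorphic_on UNIV"
    and nonconst: "\<not> (\<exists>c. eventually (\<lambda>z. f z = c) (cosparse UNIV))"
    and order: "sigma2_log f < 1"
  shows "(\<exists>F. F \<subseteq> {1<..} \<and> (\<lambda>t::real. 1 / (t * ln t)) integrable_on F \<and>
           (\<exists>C R. \<forall>r. r \<ge> R \<and> r \<notin> F \<longrightarrow>
              nev_T ((aw_D p ^^ n) f) r
                \<le> real (n + 1) * nev_T f r + C * (nev_T f r / ln (ln r)) + C * ln r \<and>
              nev_T (aw_A p n f) r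
                \<le> 2 * nev_T f r + C * (nev_T f r / ln (ln r)) + C * ln r \<and>
              nev_T (\<lambda>x. aw_eta p (int n) f x * aw_eta p (- int n) f x) r
                \<le> 2 * nev_T f r + C * (nev_T f r / ln (ln r)) + C * ln r))
       \<and> sigma2_log ((aw_D p ^^ n) f) \<le> sigma2_log f
       \<and> sigma2_log (aw_A p n f) \<le> sigma2_log f
       \<and> sigma2_log (\<lambda>x. aw_eta p (int n) f x * aw_eta p (- int n) f x) \<le> sigma2_log f"
proof -
  \<comment> \<open>Since |p|^2 = |q| lies strictly between 0 and 1, p - 1/p is nonzero; it is a
    factor of the denominator of the operator.\<close>
  have p0: "p \<noteq> 0" and p1: "p\<^sup>2 \<noteq> 1" using p q by auto
  obtain K1 R1 where 1: "\<forall>r\<ge>R1. 0 \<le> nev_T ((aw_D p ^^ n) f) r \<and> nev_T ((aw_D p ^^ n) f) r \<le> real (n + 1) * nev_T f (r * ln r ^ 3)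
      + K1 * (nev_T f (r * ln r ^ 3) / ln (ln r)) + K1 * ln r"
    using nev_T_aw_D_bound[OF p0 p1 mero] by blast
  obtain K2 R2 where 2: "\<forall>r\<ge>R2. 0 \<le> nev_T (aw_A p n f) r \<and> nev_T (aw_A p n f) r \<le> 2 * nev_T f (r * ln r ^ 3)
      + K2 * (nev_T f (r * ln r ^ 3) / ln (ln r)) + K2 * ln r"
    using nev_T_aw_A_bound[OF p0 mero] by blast
  obtain K3 R3 where 3: "\<forall>r\<ge>R3. 0 \<le> nev_T (\<lambda>x. aw_eta p (int n) f x * aw_eta p (- int n) f x) r \<and> nev_T (\<lambda>x. aw_eta p (int n) f x * aw_eta p (- int n) f x) r \<le> 2 * nev_T f (r * ln r ^ 3)
      + K3 * (nev_T f (r * ln r ^ 3) / ln (ln r)) + K3 * ln r"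
    using nev_T_aw_eta_prod_bound[OF p0 mero] by blast
  obtain E R where E: "E \<subseteq> {1<..}" "(\<lambda>t::real. 1 / (t * ln t)) integrable_on E"
    and growth: "\<And>r. r \<ge> R \<Longrightarrow> r \<notin> E \<Longrightarrow> nev_T f (r * ln r ^ 3) \<le> nev_T f r + 2 * (nev_T f r / ln (ln r)) + 2"
    using nev_T_exceptional_set[OF mero order] by blast
  have "\<exists>C R. \<forall>C'\<ge>C. \<forall>r. r \<ge> R \<and> r \<notin> E \<longrightarrow> nev_T ((aw_D p ^^ n) f) r
      \<le> real (n + 1) * nev_T f r + C' * (nev_T f r / ln (ln r)) + C' * ln r"
    by (rule nev_T_bound_outside_exceptional_set[OF mero 1]) (use growth in auto)
  then obtain C1 S1 where 4: "\<forall>C'\<ge>C1. \<forall>r. r \<ge> S1 \<and> r \<notin> E \<longrightarrow> nev_T ((aw_D p ^^ n) f) r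
      \<le> real (n + 1) * nev_T f r + C' * (nev_T f r / ln (ln r)) + C' * ln r"
    by blast
  have "\<exists>C R. \<forall>C'\<ge>C. \<forall>r. r \<ge> R \<and> r \<notin> E \<longrightarrow> nev_T (aw_A p n f) r
      \<le> 2 * nev_T f r + C' * (nev_T f r / ln (ln r)) + C' * ln r"
    by (rule nev_T_bound_outside_exceptional_set[OF mero 2]) (use growth in auto)
  then obtain C2 S2 where 5: "\<forall>C'\<ge>C2. \<forall>r. r \<ge> S2 \<and> r \<notin> E \<longrightarrow> nev_T (aw_A p n f) r
      \<le> 2 * nev_T f r + C' * (nev_T f r / ln (ln r)) + C' * ln r"
    by blast
  have "\<exists>C R. \<forall>C'\<ge>C. \<forall>r. r \<ge> R \<and> r \<notin> E \<longrightarrow> nev_T (\<lambda>x. aw_eta p (int n) f x * aw_eta p (- int n) f x) r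
      \<le> 2 * nev_T f r + C' * (nev_T f r / ln (ln r)) + C' * ln r"
    by (rule nev_T_bound_outside_exceptional_set[OF mero 3]) (use growth in auto)
  then obtain C3 S3 where 6: "\<forall>C'\<ge>C3. \<forall>r. r \<ge> S3 \<and> r \<notin> E \<longrightarrow> nev_T (\<lambda>x. aw_eta p (int n) f x * aw_eta p (- int n) f x) r
      \<le> 2 * nev_T f r + C' * (nev_T f r / ln (ln r)) + C' * ln r"
    by blast
  define C where "C = max C1 (max C2 C3)"
  define S where "S = max S1 (max S2 S3)"
  have C: "C1 \<le> C" "C2 \<le> C" "C3 \<le> C" and S: "S1 \<le> S" "S2 \<le> S" "S3 \<le> S" by (auto simp: C_def S_def)
  have "\<forall>r. r \<ge> S \<and> r \<notin> E \<longrightarrow>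
        nev_T ((aw_D p ^^ n) f) r \<le> real (n + 1) * nev_T f r + C * (nev_T f r / ln (ln r)) + C * ln r \<and>
        nev_T (aw_A p n f) r \<le> 2 * nev_T f r + C * (nev_T f r / ln (ln r)) + C * ln r \<and>
        nev_T (\<lambda>x. aw_eta p (int n) f x * aw_eta p (- int n) f x) r
          \<le> 2 * nev_T f r + C * (nev_T f r / ln (ln r)) + C * ln r"
    using 4[rule_format, OF C(1)] 5[rule_format, OF C(2)] 6[rule_format, OF C(3)] S by (meson order_trans)
  thus ?thesis
    using E sigma2_log_le_of_bound[OF mero 1] sigma2_log_le_of_bound[OF mero 2] sigma2_log_le_of_bound[OF mero 3]
    by blast
qed

end
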